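(* Let $\alpha\ge 0$ be an integer. As $n\to\infty$, $$I_{2n}\left(\widehat{P}_{2n}^{(\alpha+1/2)}\right)(z)=\begin{cases}(z^2-1)^{2n-\alpha}z^{2\alpha}(1+o(1)) & \text{if } z\in\mathcal{F}_1,\\[2mm] \dfrac{(-1)^n2^{2n-\alpha}z^{2n}}{\sqrt{\pi n}\,(1+z^2)}(1+o(1)) & \text{if } z\in\mathcal{F}_2,\end{cases}$$ $$I_{2n+1}\left(\widehat{P}_{2n+1}^{(\alpha+1/2)}\right)(z)=\begin{cases}(z^2-1)^{2n+1-\alpha}z^{2\alpha}(1+o(1)) & \text{if } z\in\mathcal{F}_1,\\[2mm] \dfrac{(-1)^n2^{2n+1-\alpha}z^{2n+2}}{\sqrt{\pi n}\,(1+z^2)}(1+o(1)) & \text{if } z\in\mathcal{F}_2.\end{cases}$$ Moreover, the zero distribution $\beta$ of these polynomials (the weak-$*$ limit, as $n\to\infty$, of the normalized counting measures of the zeros different from $0$ of $I_n(\widehat{P}_n^{(\alpha+1/2)})$) is supported on $\varphi_1^{-1}(\Gamma)$, where $\varphi_1(z)=-z^2$, and for each Borel set $E$ this measure satisfies $$\beta(E)=\mu_\Gamma(\varphi_1(E)).$$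
   Context: For a monic polynomial $p$ of degree $n$ and an integer $m\ge0$, $I_m(p)$ denotes the normalized $m$-fold integral from $0$: the unique monic polynomial of degree $n+m$ with $(I_m(p))^{(m)}=\frac{(n+m)!}{n!}p$ and $(I_m(p))^{(j)}(0)=0$ for $0\le j\le m-1$. $\widehat{P}_n^{(\alpha+1/2)}$ is the monic ultraspherical (Gegenbauer) polynomial of degree $n$ with parameter $\alpha+1/2$, i.e. the monic orthogonal polynomial of degree $n$ for the weight $(1-x^2)^{\alpha}$ on $[-1,1]$ (so $\alpha=0$ gives the monic Legendre polynomials). Define $$\mathcal{E}_1=\left\{z:\left|\tfrac{(z+1)^2}{4z}\right|>1,\ |z|>1\right\},\quad \mathcal{E}_2=\left\{z:\left|\tfrac{(z+1)^2}{4z}\right|<1\right\}\cup\left\{z:\left|\tfrac{(z+1)^2}{4z}\right|>1,\ |z|<1\right\},$$ and let $\mathcal{F}_j=\varphi_1^{-1}(\mathcal{E}_j)$, $j=1,2$, with $\varphi_1(z)=-z^2$. $\Gamma=\{z\in\mathbb{C}:|\frac{(z+1)^2}{4z}|=1,\ |z|\ge1\}$, and $\mu_\Gamma$ is its equilibrium measure, given by $\mu_\Gamma(B)=\mathfrak{m}(\varphi(B\cap\Gamma))$ for Borel $B\subset\mathbb{C}$, where $\varphi(z)=\frac{(z+1)^2}{4z}$ and $\mathfrak{m}$ is the normalized arc-length on the unit circle. Weak-$*$ convergence is tested against continuous compactly supported functions on $\mathbb{C}$.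
   Formalization: The identity β(E)=μ_Γ(φ1(E)) is false for general Borel E, since φ1(z)=-z² is two-to-one and the right side is not additive; it is stated for Borel sets with E=-E, together with β(-E)=β(E) for every Borel E, which determines β. *)

theory Defs
  imports "HOL-Probability.Probability" "HOL-Computational_Algebra.Computational_Algebra"
begin

definition I_int :: "nat \<Rightarrow> 'a::field_char_0 poly \<Rightarrow> 'a poly" where
  "I_int m p = (THE q. lead_coeff q = 1 \<and> degree q = degree p + m \<and>
     (pderiv ^^ m) q = smult (fact (degree p + m) / fact (degree p)) p \<and>
     (\<forall>j<m. poly ((pderiv ^^ j) q) 0 = 0))"

lemma I_int_ex1:
  fixes p :: "'a::field_char_0 poly"
  assumes "lead_coeff p = 1"
  shows "\<exists>!q. lead_coeff q = 1 \<and> degree q = degree p + m \<and>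
     (pderiv ^^ m) q = smult (fact (degree p + m) / fact (degree p)) p \<and>
     (\<forall>j<m. poly ((pderiv ^^ j) q) 0 = 0)"
proof -
  have poch: "pochhammer (of_nat (Suc i)) k = (fact (i + k) / fact i :: 'a)" for i k
    using pochhammer_product'[of "1::'a" i k]
    by (simp add: pochhammer_fact[symmetric] nonzero_eq_divide_eq mult.commute)
  have low: "poly ((pderiv ^^ j) q) 0 = fact j * coeff q j" for q :: "'a poly" and j
    using poch[of 0 j] by (simp add: poly_0_coeff_0 coeff_higher_pderiv)
  let ?C = "fact (degree p + m) / fact (degree p) :: 'a"
  define c where "c k = (if k < m then 0 else
     ?C * coeff p (k - m) * fact (k - m) / fact k)" for k
  have char: "((pderiv ^^ m) q = smult ?C p \<and> (\<forall>j<m. poly ((pderiv ^^ j) q) 0 = 0))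
      \<longleftrightarrow> (\<forall>k. coeff q k = c k)" (is "?L \<longleftrightarrow> ?R") for q :: "'a poly"
  proof
    assume L: ?L
    show ?R
    proof
      fix k
      show "coeff q k = c k"
      proof (cases "k < m")
        case True
        then show ?thesis using L low[of k q] by (simp add: c_def)
      next
        case False
        then have "coeff ((pderiv ^^ m) q) (k - m) = fact k / fact (k - m) * coeff q k"
          using poch[of "k - m" m] by (simp add: coeff_higher_pderiv)
        moreover have "coeff ((pderiv ^^ m) q) (k - m) = ?C * coeff p (k - m)"
          using L by simp
        ultimately have "fact k / fact (k - m) * coeff q k = ?C * coeff p (k - m)" by simp
        then have "coeff q k = ?C * coeff p (k - m) * fact (k - m) / fact k"
          by (metis (no_types, lifting) divide_divide_eq_right fact_nonzero
              nonzero_mult_div_cancel_left times_divide_eq_left times_divide_eq_right mult.commute)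
        then show ?thesis using False by (simp add: c_def)
      qed
    qed
  next
    assume R: ?R
    have "coeff ((pderiv ^^ m) q) i = coeff (smult ?C p) i" for i
      using R poch[of i m] by (simp add: coeff_higher_pderiv c_def)
    then have "(pderiv ^^ m) q = smult ?C p" by (rule poly_eqI)
    then show ?L using R by (auto simp: low c_def)
  qed
  define q0 where "q0 = Abs_poly c"
  have "c k = 0" if "k > degree p + m" for k
    using that by (auto simp: c_def coeff_eq_0)
  then have q0: "coeff q0 = c"
    unfolding q0_def by (intro coeff_Abs_poly) auto
  have c1: "c (degree p + m) = 1"
    using assms by (simp add: c_def)
  have "degree q0 \<le> degree p + m"
    by (rule degree_le) (auto simp: q0 c_def coeff_eq_0)
  moreover have "degree q0 \<ge> degree p + m"
    by (rule le_degree) (simp add: q0 c1)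
  ultimately have "degree q0 = degree p + m" by simp
  with q0 c1 char[of q0] have "lead_coeff q0 = 1 \<and> degree q0 = degree p + m \<and>
     (pderiv ^^ m) q0 = smult ?C p \<and> (\<forall>j<m. poly ((pderiv ^^ j) q0) 0 = 0)"
    by auto
  moreover have "q = q0" if "(pderiv ^^ m) q = smult ?C p \<and> (\<forall>j<m. poly ((pderiv ^^ j) q) 0 = 0)" for q
    using char[of q] that q0 by (intro poly_eqI) auto
  ultimately show ?thesis by blast
qed

text \<open>The monic ultraspherical polynomial with parameter \<open>\<alpha> + 1/2\<close>, as a complex polynomial.\<close>

definition ultraspherical :: "nat \<Rightarrow> nat \<Rightarrow> complex poly" where
  "ultraspherical \<alpha> n = map_poly complex_of_real
     (THE p. degree p = n \<and> lead_coeff p = 1 \<and>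
        (\<forall>q. degree q < n \<longrightarrow>
           integral {-1..1} (\<lambda>x. poly p x * poly q x * (1 - x^2) ^ \<alpha>) = 0))"

definition \<phi> :: "complex \<Rightarrow> complex" where
  "\<phi> z = (z + 1)^2 / (4 * z)"

definition \<phi>1 :: "complex \<Rightarrow> complex" where
  "\<phi>1 z = - (z^2)"

definition E1 :: "complex set" where
  "E1 = {z. cmod (\<phi> z) > 1 \<and> cmod z > 1}"

text \<open>The pole \<open>0\<close> of \<open>\<phi>\<close> lies in \<open>E2\<close>: classically because \<open>\<bar>\<phi> 0\<bar> = \<infinity>\<close>, here because \<open>\<phi> 0 = 0\<close>.\<close>

definition E2 :: "complex set" where
  "E2 = {z. cmod (\<phi> z) < 1} \<union> {z. cmod (\<phi> z) > 1 \<and> cmod z < 1}"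

definition F1 :: "complex set" where
  "F1 = \<phi>1 -` E1"

definition F2 :: "complex set" where
  "F2 = \<phi>1 -` E2"

definition \<Gamma> :: "complex set" where
  "\<Gamma> = {z. cmod (\<phi> z) = 1 \<and> cmod z \<ge> 1}"

definition unit_circle_measure :: "complex measure" where
  "unit_circle_measure = distr (uniform_measure lborel {0..<2 * pi}) borel cis"

definition \<mu>\<Gamma> :: "complex measure" where
  "\<mu>\<Gamma> = measure_of UNIV (sets borel) (\<lambda>B. emeasure unit_circle_measure (\<phi> ` (B \<inter> \<Gamma>)))"

lemma compact_\<Gamma>: "compact \<Gamma>"
proof -
  have eq: "\<Gamma> = {z. cmod (z + 1) ^ 2 = 4 * cmod z} \<inter> {z. cmod z \<ge> 1}"
    by (auto simp: \<Gamma>_def \<phi>_def norm_divide norm_mult norm_power divide_simps split: if_splits)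
  have "closed \<Gamma>"
    unfolding eq by (intro closed_Int closed_Collect_eq closed_Collect_le continuous_intros)
  moreover have "cmod z \<le> 6" if "z \<in> \<Gamma>" for z
  proof (rule ccontr)
    assume "\<not> cmod z \<le> 6"
    moreover have "cmod z - 1 \<le> cmod (z + 1)"
      using norm_triangle_ineq4[of "z + 1" 1] by simp
    ultimately have "(cmod z - 1)^2 \<le> cmod (z + 1) ^ 2" "6 * cmod z \<le> cmod z * cmod z"
      by (auto intro!: power_mono mult_right_mono)
    then show False using that \<open>\<not> cmod z \<le> 6\<close>
      by (auto simp: eq power2_eq_square algebra_simps)
  qed
  then have "bounded \<Gamma>" by (auto simp: bounded_iff)
  ultimately show ?thesis by (simp add: compact_eq_bounded_closed)
qed

lemma inj_on_\<phi>_\<Gamma>: "inj_on \<phi> \<Gamma>"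
proof (rule inj_onI)
  fix z w assume zw: "z \<in> \<Gamma>" "w \<in> \<Gamma>" and eq: "\<phi> z = \<phi> w"
  then have nz: "z \<noteq> 0" "w \<noteq> 0" and n1: "cmod z \<ge> 1" "cmod w \<ge> 1"
    by (auto simp: \<Gamma>_def)
  have "(z + 1)^2 * w = (w + 1)^2 * z"
    using eq nz by (simp add: \<phi>_def field_simps)
  then have "(z - w) * (z * w - 1) = 0" by (simp add: power2_eq_square algebra_simps)
  then consider "z = w" | "z * w = 1" by auto
  then show "z = w"
  proof cases
    case 2
    then have p: "cmod z * cmod w = 1" by (metis norm_mult norm_one)
    moreover have "cmod z * 1 \<le> cmod z * cmod w" using n1 by (intro mult_left_mono) auto
    ultimately have z1: "cmod z = 1" using n1 by simp
    with p have w1: "cmod w = 1" by simp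
    have "x = 1" if "x \<in> \<Gamma>" "cmod x = 1" for x
    proof -
      have "cmod (x + 1) ^ 2 = 4" "cmod x ^ 2 = 1"
        using that by (auto simp: \<Gamma>_def \<phi>_def norm_divide norm_mult norm_power)
      then have a: "(Re x + 1)^2 + (Im x)^2 = 4" "(Re x)^2 + (Im x)^2 = 1"
        by (simp_all add: cmod_power2)
      then have "Re x = 1" by (simp add: power2_eq_square algebra_simps)
      with a show ?thesis by (simp add: complex_eq_iff)
    qed
    with zw z1 w1 show ?thesis by metis
  qed
qed

lemma borel_\<phi>_image:
  assumes "B \<in> sets borel"
  shows "\<phi> ` (B \<inter> \<Gamma>) \<in> sets borel"
proof -
  have cont: "continuous_on \<Gamma> \<phi>"
    unfolding \<phi>_def by (intro continuous_intros) (auto simp: \<Gamma>_def)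
  let ?g = "inv_into \<Gamma> \<phi>"
  have g: "continuous_on (\<phi> ` \<Gamma>) ?g"
    using cont compact_\<Gamma> inj_on_\<phi>_\<Gamma> by (intro continuous_on_inv) auto
  have cl: "\<phi> ` \<Gamma> \<in> sets borel"
    using compact_continuous_image[OF cont compact_\<Gamma>] by (simp add: borel_compact)
  have "?g \<in> borel_measurable (restrict_space borel (\<phi> ` \<Gamma>))"
    using g by (rule borel_measurable_continuous_on_restrict)
  then have "?g -` B \<inter> space (restrict_space borel (\<phi> ` \<Gamma>)) \<in> sets (restrict_space borel (\<phi> ` \<Gamma>))"
    using assms by (rule measurable_sets)
  then have "?g -` B \<inter> \<phi> ` \<Gamma> \<in> sets borel"
    using cl by (simp add: sets_restrict_space_iff space_restrict_space)
  moreover have "?g -` B \<inter> \<phi> ` \<Gamma> = \<phi> ` (B \<inter> \<Gamma>)"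
    using inj_on_\<phi>_\<Gamma> by (auto simp: inv_into_f_f)
  ultimately show ?thesis by simp
qed

lemma sets_\<mu>\<Gamma> [simp, measurable_cong]: "sets \<mu>\<Gamma> = sets borel"
  and space_\<mu>\<Gamma> [simp]: "space \<mu>\<Gamma> = UNIV"
  using sets.sigma_sets_eq[of "borel :: complex measure"]
  by (simp_all add: \<mu>\<Gamma>_def sets_measure_of space_measure_of)

lemma emeasure_\<mu>\<Gamma>:
  assumes "B \<in> sets borel"
  shows "emeasure \<mu>\<Gamma> B = emeasure unit_circle_measure (\<phi> ` (B \<inter> \<Gamma>))"
proof (rule emeasure_measure_of[OF \<mu>\<Gamma>_def])
  show "countably_additive (sets \<mu>\<Gamma>) (\<lambda>B. emeasure unit_circle_measure (\<phi> ` (B \<inter> \<Gamma>)))"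
  proof (rule countably_additiveI)
    fix A :: "nat \<Rightarrow> complex set"
    assume A: "range A \<subseteq> sets \<mu>\<Gamma>" "disjoint_family A"
    have "(\<Sum>i. emeasure unit_circle_measure (\<phi> ` (A i \<inter> \<Gamma>)))
        = emeasure unit_circle_measure (\<Union>i. \<phi> ` (A i \<inter> \<Gamma>))"
    proof (rule suminf_emeasure)
      show "range (\<lambda>i. \<phi> ` (A i \<inter> \<Gamma>)) \<subseteq> sets unit_circle_measure"
        using A by (auto simp: unit_circle_measure_def intro!: borel_\<phi>_image)
      show "disjoint_family (\<lambda>i. \<phi> ` (A i \<inter> \<Gamma>))"
        using A(2) inj_on_\<phi>_\<Gamma> unfolding disjoint_family_on_def inj_on_def by blast
    qed
    also have "(\<Union>i. \<phi> ` (A i \<inter> \<Gamma>)) = \<phi> ` (\<Union> (range A) \<inter> \<Gamma>)" by auto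
    finally show "(\<Sum>i. emeasure unit_circle_measure (\<phi> ` (A i \<inter> \<Gamma>)))
        = emeasure unit_circle_measure (\<phi> ` (\<Union> (range A) \<inter> \<Gamma>))" .
  qed
qed (use assms in \<open>auto simp: positive_def\<close>)

text \<open>Zeros are counted with multiplicity. The value is unspecified when \<open>p\<close> has no nonzero zero.\<close>

definition nonzero_zeros_measure :: "complex poly \<Rightarrow> complex measure" where
  "nonzero_zeros_measure p =
     distr (measure_pmf (pmf_of_multiset {#z \<in># proots p. z \<noteq> 0#})) borel (\<lambda>z. z)"

definition weak_star_tendsto :: "(nat \<Rightarrow> complex measure) \<Rightarrow> complex measure \<Rightarrow> bool" where
  "weak_star_tendsto M \<beta> \<longleftrightarrow>
     (\<forall>f :: complex \<Rightarrow> real. continuous_on UNIV f \<and> compact (closure {z. f z \<noteq> 0}) \<longrightarrow>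
        (\<lambda>n. integral\<^sup>L (M n) f) \<longlonglongrightarrow> integral\<^sup>L \<beta> f)"

end

theory Submission
  imports Defs "HOL-Complex_Analysis.Complex_Analysis" "HOL-Real_Asymp.Real_Asymp"
begin

text \<open>
  Let \<open>w = \<phi>1 z = - z\<^sup>2\<close>. Up to sign, the \<open>N\<close>-fold integral is the part of degree at least \<open>N/2\<close> of
  the sum \<open>\<Sum>m\<le>N. (N choose m) q(m) w^m\<close>, where \<open>q\<close> is a polynomial of degree \<open>\<alpha>\<close> with
  \<open>q(m) \<approx> (m/N)^\<alpha>\<close>. The complete sum behaves like \<open>(1 + w)^N (w / (1 + w))^\<alpha>\<close>, and for
  \<open>\<bar>w\<bar> \<ge> 1\<close> the removed terms are at most of order \<open>2^N \<bar>w\<bar>^(N/2)\<close>, hence negligible exactly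
  when \<open>\<bar>\<phi> w\<bar> > 1\<close>. On the rest of the plane (off \<open>\<Gamma>\<close>) the truncated sum for \<open>\<alpha> = 0\<close>, divided by its
  lowest term, is trivially \<open>O(\<surd>N)\<close>; Cauchy's estimate gives the same bound for its derivative, and a
  first-order differential equation then forces convergence to \<open>1 / (1 - w)\<close>. Raising \<open>\<alpha>\<close> by one applies
  a differential operator that in the limit multiplies by \<open>1/2\<close>.

  Consequently the zeros in the variable \<open>w\<close> approach \<open>\<Gamma>\<close>. Logarithmic derivatives at \<open>0\<close> and at
  \<open>\<infinity>\<close> determine the limits of their normalised power sums of all integer exponents, and these make the
  mean of \<open>\<phi>^k\<close> tend to \<open>0\<close> for every \<open>k > 0\<close>. As \<open>\<phi>\<close> maps \<open>\<Gamma>\<close> homeomorphically onto the unit circle, density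
  of trigonometric polynomials identifies the limit distribution as \<open>\<mu>\<Gamma>\<close>.
\<close>

subsection \<open>Orthogonality of polynomial solutions of the Gegenbauer equation\<close>

text \<open>The right-hand side of \<beta>(E) =
  \<open>\<mu>\<Gamma>\<close>(\<open>\<phi>1\<close>(E)) is not additive in E, since E and -E have
  the same image under \<open>\<phi>1\<close>. The identity is therefore proved for sets with E =
  -E, together with invariance of \<beta> under negation; these two facts determine \<beta>. The
  truncated binomial sum has its origin in Rodrigues' formula: for \<alpha> = 0 the complete sum is
  (1 + w)^N, that is (z^2 - 1)^N up to sign, and integrating its N-th derivative from 0 returns it
  without the powers of z below N. For the power sums, two-sided bounds on the normalised
  polynomials near 0 and near infinity are enough: they control logarithmic derivatives up to O(1),
  which is negligible against the number of zeros. In the limit the mean of x^j is 0 for j < 0, 1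
  for j = 0 and 2 (-1)^j for j > 0, and the expansion of \<open>\<phi>^k\<close> reduces by symmetry
  to an alternating sum of binomial coefficients.\<close>

lemma integrable_poly_Icc: "(poly (f :: real poly)) integrable_on {a..b}"
  by (intro integrable_continuous_real continuous_intros)

lemma integral_pderiv:
  fixes f :: "real poly"
  assumes "a \<le> b"
  shows "integral {a..b} (poly (pderiv f)) = poly f b - poly f a"
proof -
  have "(poly (pderiv f) has_integral (poly f b - poly f a)) {a..b}"
    by (rule fundamental_theorem_of_calculus[OF assms])
       (auto intro!: DERIV_subset[OF poly_DERIV] simp flip: has_real_derivative_iff_has_vector_derivative)
  then show ?thesis by (rule integral_unique)
qed

text \<open>The Sturm-Liouville operator attached to the weight (1 - x^2)^\<alpha>. Its
  eigenfunction of degree n, with eigenvalue -n (n + 2 \<alpha> + 1), is the orthogonal polynomial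
  of degree n, so integrals can be traded for a recurrence of coefficients.\<close>

definition gegenbauer_op :: "nat \<Rightarrow> real poly \<Rightarrow> real poly" where
  "gegenbauer_op \<alpha> p =
     [:1, 0, -1:] * pderiv (pderiv p) - [:0, 2 * real \<alpha> + 2:] * pderiv p"

lemma gegenbauer_op_weight:
  "pderiv ([:1, 0, -1:] ^ Suc \<alpha> * pderiv p) = [:1, 0, -1:] ^ \<alpha> * gegenbauer_op \<alpha> p"
proof -
  have *: "pderiv ([:1, 0, -1:] ^ Suc \<alpha> :: real poly) = - ([:1, 0, -1:] ^ \<alpha> * [:0, 2 * real \<alpha> + 2:])"
    by (simp only: pderiv_power_Suc) (simp add: pderiv_pCons algebra_simps flip: smult_minus_left)
  have **: "A * X * P2 + P1 * - (X * B) = X * (A * P2 - B * P1)" for A X P2 P1 B :: "real poly"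
    by (simp add: algebra_simps)
  show ?thesis
    unfolding gegenbauer_op_def pderiv_mult[of "_ ^ _"] * by (simp only: power_Suc **)
qed

text \<open>Lagrange's identity: the difference of the integrands is the derivative of the weighted
  Wronskian \<open>?F\<close>, whose factor (1 - x^2)^(\<alpha> + 1) vanishes at both endpoints,
  even for \<alpha> = 0.\<close>

lemma gegenbauer_op_symmetric:
  "integral {-1..1} (poly ([:1, 0, -1:] ^ \<alpha> * (gegenbauer_op \<alpha> p * q))) =
   integral {-1..1} (poly ([:1, 0, -1:] ^ \<alpha> * (p * gegenbauer_op \<alpha> q)))"
proof -
  let ?w = "[:1, 0, -1:] :: real poly"
  let ?F = "?w ^ Suc \<alpha> * pderiv p * q - ?w ^ Suc \<alpha> * pderiv q * p"
  have "pderiv ?F = pderiv (?w ^ Suc \<alpha> * pderiv p) * q - pderiv (?w ^ Suc \<alpha> * pderiv q) * p"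
    unfolding pderiv_diff pderiv_mult[of "?w ^ Suc \<alpha> * pderiv p"]
      pderiv_mult[of "?w ^ Suc \<alpha> * pderiv q"] by (simp add: mult_ac)
  then have F: "pderiv ?F = ?w ^ \<alpha> * (gegenbauer_op \<alpha> p * q) - ?w ^ \<alpha> * (p * gegenbauer_op \<alpha> q)"
    by (simp only: gegenbauer_op_weight) (simp add: mult_ac)
  have "integral {-1..1} (poly (pderiv ?F)) = 0"
    by (subst integral_pderiv) auto
  moreover have "poly (pderiv ?F) = (\<lambda>x. poly (?w ^ \<alpha> * (gegenbauer_op \<alpha> p * q)) x
      - poly (?w ^ \<alpha> * (p * gegenbauer_op \<alpha> q)) x)"
    unfolding F by (rule ext) (rule poly_diff)
  ultimately show ?thesis
    using Henstock_Kurzweil_Integration.integral_diff[OF integrable_poly_Icc integrable_poly_Icc,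
      of "-1" 1 "?w ^ \<alpha> * (gegenbauer_op \<alpha> p * q)" "?w ^ \<alpha> * (p * gegenbauer_op \<alpha> q)"]
    by simp
qed

lemma coeff_gegenbauer_op:
  "coeff (gegenbauer_op \<alpha> p) k =
     (real k + 2) * (real k + 1) * coeff p (k + 2) - real k * (real k + 2 * real \<alpha> + 1) * coeff p k"
proof -
  have *: "[:1, 0, -1:] * r = r - pCons 0 (pCons 0 r)" "[:0, c:] * r = smult c (pCons 0 r)"
    for c and r :: "real poly" by (simp_all)
  consider "k = 0" | "k = 1" | j where "k = j + 2"
    by (metis One_nat_def Suc_1 Suc_eq_plus1 add_Suc_right not0_implies_Suc)
  then show ?thesis
    unfolding gegenbauer_op_def *
    by cases (auto simp: coeff_pderiv coeff_pCons algebra_simps)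
qed

lemma gegenbauer_op_monom:
  "gegenbauer_op \<alpha> (monom 1 k) =
     smult (real k * (real k - 1)) (monom 1 (k - 2))
     - smult (real k * (real k + 2 * real \<alpha> + 1)) (monom 1 k)"
  by (rule poly_eqI) (cases "k < 2"; auto simp: coeff_gegenbauer_op of_nat_diff less_2_cases_iff algebra_simps)

lemma integral_poly_smult: "integral {a..b} (poly (smult c f)) = c * integral {a..b} (poly f)" for c :: real
proof -
  have "poly (smult c f) = (\<lambda>x. c * poly f x)" by (rule ext) simp
  then show ?thesis by simp
qed

text \<open>Moving the operator from p to x^k gives x^k back with the factor -k (k + 2 \<alpha> +
  1), plus a multiple of x^(k - 2) that the induction removes. As the factors for n and k differ,
  the integral vanishes.\<close>

lemma gegenbauer_orthogonal_monom:
  assumes p: "gegenbauer_op \<alpha> p = smult (- (real n * (real n + 2 * real \<alpha> + 1))) p"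
  shows "k < n \<Longrightarrow> integral {-1..1} (poly ([:1, 0, -1:] ^ \<alpha> * (p * monom 1 k))) = 0"
proof (induction k rule: less_induct)
  case (less k)
  let ?w = "[:1, 0, -1:] :: real poly"
  let ?M = "\<lambda>k. integral {-1..1} (poly (?w ^ \<alpha> * (p * monom 1 k)))"
  note lin = integral_poly_smult
  have "- (real n * (real n + 2 * real \<alpha> + 1)) * ?M k
      = integral {-1..1} (poly (?w ^ \<alpha> * (gegenbauer_op \<alpha> p * monom 1 k)))"
    unfolding p lin[symmetric] by simp
  also have "\<dots> = integral {-1..1} (poly (?w ^ \<alpha> * (p * gegenbauer_op \<alpha> (monom 1 k))))"
    by (rule gegenbauer_op_symmetric)
  also have "poly (?w ^ \<alpha> * (p * gegenbauer_op \<alpha> (monom 1 k))) =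
      (\<lambda>x. poly (smult (real k * (real k - 1)) (?w ^ \<alpha> * (p * monom 1 (k - 2)))) x
       - poly (smult (real k * (real k + 2 * real \<alpha> + 1)) (?w ^ \<alpha> * (p * monom 1 k))) x)"
    unfolding gegenbauer_op_monom by (rule ext) (simp add: algebra_simps)
  also have "integral {-1..1} \<dots> = real k * (real k - 1) * ?M (k - 2)
      - real k * (real k + 2 * real \<alpha> + 1) * ?M k"
    unfolding lin[symmetric] by (intro Henstock_Kurzweil_Integration.integral_diff integrable_poly_Icc)
  \<comment> \<open>For k < 2 the factor k (k - 1) is 0, so the truncated exponent
    \<open>k - 2\<close> does no harm.\<close>
  also have "real k * (real k - 1) * ?M (k - 2) = 0"
  proof (cases "k < 2")
    case False
    then show ?thesis using less.IH[of "k - 2"] less.prems by (simp del: poly_mult)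
  qed (auto simp: less_2_cases_iff)
  finally have "- (real n * (real n + 2 * real \<alpha> + 1)) * ?M k = 0 - real k * (real k + 2 * real \<alpha> + 1) * ?M k" .
  moreover have "((a - b) * (a + b + c + 1)) * m = 0" if "- (a * (a + c + 1)) * m = 0 - b * (b + c + 1) * m"
    for a b c m :: real using that by (simp add: algebra_simps)
  ultimately have "((real n - real k) * (real n + real k + 2 * real \<alpha> + 1)) * ?M k = 0" by blast
  moreover have "(real n - real k) * (real n + real k + 2 * real \<alpha> + 1) \<noteq> 0"
    using less.prems by simp
  ultimately show ?case by (metis mult_eq_0_iff)
qed

lemma gegenbauer_orthogonal:
  assumes p: "gegenbauer_op \<alpha> p = smult (- (real n * (real n + 2 * real \<alpha> + 1))) p"
    and q: "degree q < n"
  shows "integral {-1..1} (\<lambda>x. poly p x * poly q x * (1 - x^2) ^ \<alpha>) = 0"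
proof -
  let ?f = "\<lambda>k. smult (coeff q k) ([:1, 0, -1:] ^ \<alpha> * (p * monom 1 k))"
  have "poly p x * poly q x * (1 - x^2) ^ \<alpha> = (\<Sum>k\<le>degree q. poly (?f k) x)" for x
  proof -
    have "poly q x = (\<Sum>k\<le>degree q. coeff q k * x ^ k)" by (rule poly_altdef)
    then show ?thesis
      by (simp add: sum_distrib_left sum_distrib_right poly_monom power2_eq_square mult_ac)
  qed
  then have "integral {-1..1} (\<lambda>x. poly p x * poly q x * (1 - x^2) ^ \<alpha>)
      = (\<Sum>k\<le>degree q. integral {-1..1} (poly (?f k)))"
    using integrable_poly_Icc by (simp only:) (rule integral_sum, auto simp del: poly_smult poly_mult)
  also have "\<dots> = (\<Sum>k\<le>degree q. coeff q k * integral {-1..1} (poly ([:1, 0, -1:] ^ \<alpha> * (p * monom 1 k))))"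
    by (simp only: integral_poly_smult)
  also have "\<dots> = 0"
    using gegenbauer_orthogonal_monom[OF p] q by (simp del: poly_mult)
  finally show ?thesis .
qed

lemma weighted_square_integral_eq_0:
  fixes d :: "real poly"
  assumes "integral {-1..1} (\<lambda>x. poly d x * poly d x * (1 - x^2) ^ \<alpha>) = 0"
  shows "d = 0"
proof (rule ccontr)
  assume "d \<noteq> 0"
  let ?f = "\<lambda>x. poly d x * poly d x * (1 - x^2) ^ \<alpha>"
  have *: "?f x = 0" if "x \<in> {-1..1}" for x
  proof -
    have cont: "continuous_on {-1..1} ?f" by (intro continuous_intros)
    have nn: "0 \<le> ?f y" if "y \<in> {-1..1}" for y
      using that by (auto intro!: mult_nonneg_nonneg zero_le_power simp: abs_square_le_1 abs_le_iff)
    show ?thesis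
      using has_integral_0_cbox_imp_0[of "-1::real" 1 ?f x] cont nn that assms
        integrable_integral[OF integrable_continuous_real[OF cont]] by auto
  qed
  have "poly d x = 0" if "x \<in> {-1<..<1}" for x
  proof -
    have "x\<^sup>2 < 1" using that by (simp add: abs_square_less_1 abs_less_iff)
    then have "(1 - x\<^sup>2) ^ \<alpha> \<noteq> 0" by simp
    with * [of x] that show ?thesis
      by (metis atLeastAtMost_iff greaterThanLessThan_iff less_imp_le mult_eq_0_iff)
  qed
  then have "{-1<..<1} \<subseteq> {x. poly d x = 0}" by blast
  with poly_roots_finite[OF \<open>d \<noteq> 0\<close>] show False
    using infinite_Ioo[of "-1::real" 1] finite_subset[of "{-1<..<1::real}"] by simp
qed

text \<open>The difference of two monic orthogonal candidates has degree below n, hence is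
  orthogonal to both and so to itself; this is the uniqueness that the \<open>THE\<close> in
  \<open>ultraspherical\<close> requires.\<close>

lemma ultraspherical_eqI:
  fixes p :: "real poly"
  assumes "degree p = n" "lead_coeff p = 1"
    and "gegenbauer_op \<alpha> p = smult (- (real n * (real n + 2 * real \<alpha> + 1))) p"
  shows "ultraspherical \<alpha> n = map_poly complex_of_real p"
proof -
  let ?P = "\<lambda>p :: real poly. degree p = n \<and> lead_coeff p = 1 \<and>
    (\<forall>q. degree q < n \<longrightarrow> integral {-1..1} (\<lambda>x. poly p x * poly q x * (1 - x^2) ^ \<alpha>) = 0)"
  have "(THE p. ?P p) = p"
  proof (rule the_equality)
    show P: "?P p" using assms gegenbauer_orthogonal by blast
    fix p' assume P': "?P p'"
    show "p' = p"
    proof (rule ccontr)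
      assume ne: "p' \<noteq> p"
      define d where "d = p' - p"
      have "degree d < n \<or> d = 0"
      \<comment> \<open>For n = 0 no degree is below n and orthogonality says nothing; uniqueness
        then comes from being monic, as both candidates are 1.\<close>
      proof (cases "n = 0")
        case True
        with P P' have "p' = 1" "p = 1"
          by (auto elim!: degree_eq_zeroE simp: one_pCons)
        with ne show ?thesis by simp
      next
        case False
        have "coeff d n = 0" "degree d \<le> n"
          using P P' by (auto simp: d_def intro!: degree_diff_le)
        then show ?thesis
          by (metis False bot_nat_0.not_eq_extremum degree_0 le_neq_implies_less leading_coeff_0_iff)
      qed
      with ne have dn: "degree d < n" by (auto simp: d_def)
      have "integral {-1..1} (\<lambda>x. poly d x * poly d x * (1 - x^2) ^ \<alpha>)
         = integral {-1..1} (\<lambda>x. poly p' x * poly d x * (1 - x^2) ^ \<alpha> - poly p x * poly d x * (1 - x^2) ^ \<alpha>)"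
        by (simp add: d_def left_diff_distrib)
      also have "\<dots> = integral {-1..1} (\<lambda>x. poly p' x * poly d x * (1 - x^2) ^ \<alpha>)
          - integral {-1..1} (\<lambda>x. poly p x * poly d x * (1 - x^2) ^ \<alpha>)"
        by (intro Henstock_Kurzweil_Integration.integral_diff integrable_continuous_real continuous_intros)
      also have "\<dots> = 0" using P P' dn by simp
      finally have "d = 0" by (rule weighted_square_integral_eq_0)
      with ne show False by (simp add: d_def)
    qed
  qed
  then show ?thesis by (simp add: ultraspherical_def)
qed

subsection \<open>Explicit coefficients\<close>

text \<open>The product is the quotient of the rising factorials (m + 1/2)_\<alpha> and (N +
  1/2)_\<alpha>: a polynomial in m of degree \<alpha>, normalised to be 1 at m = N.\<close>

definition gcoef :: "nat \<Rightarrow> nat \<Rightarrow> nat \<Rightarrow> real" where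
  "gcoef \<alpha> N m = real (N choose m) * (\<Prod>j<\<alpha>. (2 * real m + 2 * real j + 1) / (2 * real N + 2 * real j + 1))"

lemma gcoef_0: "gcoef 0 N m = real (N choose m)"
  by (simp add: gcoef_def)

lemma gcoef_Suc:
  "gcoef (Suc \<alpha>) N m = gcoef \<alpha> N m * ((2 * real m + 2 * real \<alpha> + 1) / (2 * real N + 2 * real \<alpha> + 1))"
  by (simp add: gcoef_def)

lemma gcoef_eq_0: "N < m \<Longrightarrow> gcoef \<alpha> N m = 0"
  by (simp add: gcoef_def)

lemma gcoef_top [simp]: "gcoef \<alpha> N N = 1"
proof -
  have "(\<Prod>j<\<alpha>. (2 * real N + 2 * real j + 1) / (2 * real N + 2 * real j + 1)) = (\<Prod>j<\<alpha>. 1)"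
    by (intro prod.cong) (auto simp: add_nonneg_eq_0_iff)
  then show ?thesis by (simp add: gcoef_def)
qed

lemma gcoef_nonneg: "0 \<le> gcoef \<alpha> N m"
  by (auto simp: gcoef_def intro!: mult_nonneg_nonneg prod_nonneg)

lemma gcoef_pos: "m \<le> N \<Longrightarrow> 0 < gcoef \<alpha> N m"
  by (auto simp: gcoef_def intro!: mult_pos_pos prod_pos divide_pos_pos)

lemma gcoef_le_binomial: "gcoef \<alpha> N m \<le> real (N choose m)"
proof (cases "m \<le> N")
  case True
  then have "(\<Prod>j<\<alpha>. (2 * real m + 2 * real j + 1) / (2 * real N + 2 * real j + 1)) \<le> 1"
    by (intro prod_le_1) (auto simp: divide_simps)
  then show ?thesis by (auto simp: gcoef_def intro!: mult_left_le)
qed (simp add: gcoef_def binomial_eq_0)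

lemma binomial_absorb: "(real m + 1) * real (N choose Suc m) = (real N - real m) * real (N choose m)"
proof (cases "m \<le> N")
  case True
  have "Suc m * (N choose Suc m) = (N - m) * (N choose m)"
    by (metis Suc_times_binomial_eq Suc_times_binomial binomial_absorption binomial_absorb_comp mult.commute)
  then have "real (Suc m * (N choose Suc m)) = real ((N - m) * (N choose m))" by simp
  then show ?thesis using True by (simp add: of_nat_diff algebra_simps)
qed (simp add: binomial_eq_0)

text \<open>This is the Gegenbauer equation read on coefficients. In the induction both sides gain
  the factor \<open>?X\<close>: at m + 1 it is the new factor of the product, while at m it replaces
  2m + 2 \<alpha> + 1, which is absorbed into the coefficient.\<close>

lemma gcoef_rec:
  "(real m + 1) * (2 * real m + 1) * gcoef \<alpha> N (Suc m)
     = (real N - real m) * (2 * real m + 2 * real \<alpha> + 1) * gcoef \<alpha> N m"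
proof (induction \<alpha>)
  case 0
  then show ?case using arg_cong[OF binomial_absorb[of m N], of "\<lambda>x. (2 * real m + 1) * x"]
    by (simp add: gcoef_0 mult_ac)
next
  case (Suc \<alpha>)
  let ?d = "2 * real N + 2 * real \<alpha> + 1" and ?X = "2 * real m + 2 * real \<alpha> + 3"
  have X: "2 * real (Suc m) + 2 * real \<alpha> + 1 = ?X" "2 * real m + 2 * real (Suc \<alpha>) + 1 = ?X" by simp_all
  have "(real m + 1) * (2 * real m + 1) * gcoef (Suc \<alpha>) N (Suc m)
     = ((real m + 1) * (2 * real m + 1) * gcoef \<alpha> N (Suc m)) * (?X / ?d)"
    unfolding gcoef_Suc X by (simp only: mult_ac)
  also have "\<dots> = (real N - real m) * (2 * real m + 2 * real (Suc \<alpha>) + 1) * gcoef (Suc \<alpha>) N m"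
    unfolding Suc.IH gcoef_Suc X by (simp only: times_divide_eq_right times_divide_eq_left mult_ac)
  finally show ?case .
qed

text \<open>The cut at \<open>(N + 1) div 2\<close>, the least m with 2m >= N, reflects that
  integration from 0 leaves no power below N; the discarded terms of the complete sum are exactly
  those killed by N differentiations.\<close>

definition integrated_poly :: "nat \<Rightarrow> nat \<Rightarrow> real poly" where
  "integrated_poly \<alpha> N = (\<Sum>m = (N + 1) div 2..N. monom ((-1) ^ (N + m) * gcoef \<alpha> N m) (2 * m))"

lemma coeff_integrated_poly_even:
  "coeff (integrated_poly \<alpha> N) (2 * m) = (if (N + 1) div 2 \<le> m then (-1) ^ (N + m) * gcoef \<alpha> N m else 0)"
proof -
  have "coeff (integrated_poly \<alpha> N) (2 * m) =
     (\<Sum>i = (N + 1) div 2..N. if i = m then (-1) ^ (N + m) * gcoef \<alpha> N m else 0)"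
    unfolding integrated_poly_def coeff_sum by (intro sum.cong) auto
  also have "\<dots> = (if m \<in> {(N + 1) div 2..N} then (-1) ^ (N + m) * gcoef \<alpha> N m else 0)"
    by (subst sum.delta) auto
  finally show ?thesis by (auto simp: gcoef_eq_0)
qed

lemma coeff_integrated_poly_odd: "odd k \<Longrightarrow> coeff (integrated_poly \<alpha> N) k = 0"
  unfolding integrated_poly_def coeff_sum by (intro sum.neutral) auto

lemma coeff_integrated_poly_low: "k < N \<Longrightarrow> coeff (integrated_poly \<alpha> N) k = 0"
  by (cases "even k") (auto simp: coeff_integrated_poly_odd coeff_integrated_poly_even elim!: evenE)

lemma degree_integrated_poly: "degree (integrated_poly \<alpha> N) = 2 * N"
proof (rule antisym)
  show "degree (integrated_poly \<alpha> N) \<le> 2 * N"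
    unfolding integrated_poly_def by (rule degree_sum_le) (auto intro: order.trans[OF degree_monom_le])
  show "2 * N \<le> degree (integrated_poly \<alpha> N)"
    by (rule le_degree) (simp add: coeff_integrated_poly_even)
qed

lemma coeff_integrated_poly_top: "coeff (integrated_poly \<alpha> N) (2 * N) = 1"
  by (simp add: coeff_integrated_poly_even flip: mult_2)

section \<open>Identification of the ultraspherical polynomials and of their integrals\<close>

lemma pochhammer_fact_shift: "pochhammer (of_nat (Suc i)) k = (fact (i + k) / fact i :: 'a :: field_char_0)"
  using pochhammer_product'[of "1::'a" i k]
  by (simp add: pochhammer_fact[symmetric] nonzero_eq_divide_eq mult.commute)

text \<open>Obtained by differentiating the intended integral, so that the relation to
  \<open>I_int\<close> is immediate and only the Gegenbauer equation remains to be checked.\<close>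

definition monic_gegenbauer :: "nat \<Rightarrow> nat \<Rightarrow> real poly" where
  "monic_gegenbauer \<alpha> N = smult (fact N / fact (2 * N)) ((pderiv ^^ N) (integrated_poly \<alpha> N))"

lemma coeff_monic_gegenbauer:
  "coeff (monic_gegenbauer \<alpha> N) i = fact N / fact (2 * N) * (fact (i + N) / fact i * coeff (integrated_poly \<alpha> N) (i + N))"
  unfolding monic_gegenbauer_def coeff_smult coeff_higher_pderiv pochhammer_fact_shift by (rule refl)

lemma degree_monic_gegenbauer: "degree (monic_gegenbauer \<alpha> N) = N"
proof (rule antisym)
  show "degree (monic_gegenbauer \<alpha> N) \<le> N"
    by (rule degree_le) (auto simp: coeff_monic_gegenbauer degree_integrated_poly intro!: coeff_eq_0)
  show "N \<le> degree (monic_gegenbauer \<alpha> N)"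
    by (rule le_degree) (simp add: coeff_monic_gegenbauer coeff_integrated_poly_top flip: mult_2)
qed

lemma gegenbauer_op_monic_gegenbauer:
  "gegenbauer_op \<alpha> (monic_gegenbauer \<alpha> N) = smult (- (real N * (real N + 2 * real \<alpha> + 1))) (monic_gegenbauer \<alpha> N)"
proof (rule poly_eqI)
  fix i
  have rec: "(real i + real N + 2) * (real i + real N + 1) * coeff (integrated_poly \<alpha> N) (i + N + 2)
     = (real i - real N) * (real i + real N + 2 * real \<alpha> + 1) * coeff (integrated_poly \<alpha> N) (i + N)"
  proof (cases "even (i + N)")
    case True
    then obtain m where m: "i + N = 2 * m" by (elim evenE)
    \<comment> \<open>Since 2m = i + N >= N, both coefficients lie at or above the cut, and the
      truncation does not disturb the recurrence.\<close>
    then have le: "(N + 1) div 2 \<le> m" by linarith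
    have ri: "real i = 2 * real m - real N" using m by linarith
    let ?s = "(-1) ^ (N + m) :: real"
    have c: "coeff (integrated_poly \<alpha> N) (i + N) = ?s * gcoef \<alpha> N m"
      "coeff (integrated_poly \<alpha> N) (i + N + 2) = - ?s * gcoef \<alpha> N (Suc m)"
      using le coeff_integrated_poly_even[of \<alpha> N m] coeff_integrated_poly_even[of \<alpha> N "Suc m"] by (simp_all add: m)
    have "(2 * real m + 2) * (2 * real m + 1) * gcoef \<alpha> N (Suc m)
        = 2 * ((real m + 1) * (2 * real m + 1) * gcoef \<alpha> N (Suc m))" by (simp add: algebra_simps)
    also have "\<dots> = (2 * real N - 2 * real m) * (2 * real m + 2 * real \<alpha> + 1) * gcoef \<alpha> N m"
      unfolding gcoef_rec by (simp add: algebra_simps)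
    finally have "- ?s * ((2 * real m + 2) * (2 * real m + 1) * gcoef \<alpha> N (Suc m))
        = - ?s * ((2 * real N - 2 * real m) * (2 * real m + 2 * real \<alpha> + 1) * gcoef \<alpha> N m)" by (rule arg_cong)
    then show ?thesis unfolding c by (simp add: ri algebra_simps)
  next
    case False
    then show ?thesis by (simp add: coeff_integrated_poly_odd)
  qed
  have f: "fact (i + 2 + N) = (real i + real N + 2) * (real i + real N + 1) * fact (i + N)"
    "fact (i + 2) = (real i + 2) * (real i + 1) * fact i"
    by (simp_all add: algebra_simps)
  have e: "i + 2 + N = i + N + 2" by simp
  have gen2: "a * (c * x) = b * (c * y)" if "a * x = b * y" for a b c x y :: real
    using that by (simp add: mult.left_commute)
  have gen: "c * ((d * f) / (c * g) * y) = f / g * (d * y)" if "c \<noteq> 0" for c d f g y :: real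
    using that by simp
  have "(real i + 2) * (real i + 1) * (fact (i + 2 + N) / fact (i + 2) * coeff (integrated_poly \<alpha> N) (i + 2 + N))
    = fact (i + N) / fact i * ((real i + real N + 2) * (real i + real N + 1) * coeff (integrated_poly \<alpha> N) (i + 2 + N))"
    unfolding f by (rule gen) simp
  also have "\<dots> = (real i - real N) * (real i + real N + 2 * real \<alpha> + 1) *
      (fact (i + N) / fact i * coeff (integrated_poly \<alpha> N) (i + N))"
    unfolding e rec by simp
  finally have *: "(real i + 2) * (real i + 1) * coeff (monic_gegenbauer \<alpha> N) (i + 2)
     = (real i - real N) * (real i + real N + 2 * real \<alpha> + 1) * coeff (monic_gegenbauer \<alpha> N) i"
    unfolding coeff_monic_gegenbauer by (rule gen2)
  show "coeff (gegenbauer_op \<alpha> (monic_gegenbauer \<alpha> N)) i =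
      coeff (smult (- (real N * (real N + 2 * real \<alpha> + 1))) (monic_gegenbauer \<alpha> N)) i"
    unfolding coeff_gegenbauer_op * by (simp add: algebra_simps)
qed

lemma ultraspherical_eq: "ultraspherical \<alpha> N = map_poly complex_of_real (monic_gegenbauer \<alpha> N)"
  by (rule ultraspherical_eqI)
     (simp_all add: degree_monic_gegenbauer gegenbauer_op_monic_gegenbauer coeff_monic_gegenbauer coeff_integrated_poly_top flip: mult_2)

lemma I_int_ultraspherical:
  "I_int N (ultraspherical \<alpha> N) = map_poly complex_of_real (integrated_poly \<alpha> N)"
proof -
  let ?c = "complex_of_real" and ?J = "map_poly complex_of_real (integrated_poly \<alpha> N)"
  let ?p = "ultraspherical \<alpha> N"
  have deg: "degree ?p = N"
    by (simp add: ultraspherical_eq degree_map_poly degree_monic_gegenbauer)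
  have lead: "lead_coeff ?p = 1"
    by (simp add: deg) (simp add: ultraspherical_eq coeff_map_poly coeff_monic_gegenbauer coeff_integrated_poly_top flip: mult_2)
  have "lead_coeff ?J = 1" "degree ?J = 2 * N"
    by (simp_all add: degree_map_poly coeff_map_poly degree_integrated_poly coeff_integrated_poly_top)
  moreover have "(pderiv ^^ N) ?J = smult (fact (2 * N) / fact N) ?p"
  proof (rule poly_eqI)
    fix i
    show "coeff ((pderiv ^^ N) ?J) i = coeff (smult (fact (2 * N) / fact N) ?p) i"
      unfolding ultraspherical_eq coeff_smult coeff_higher_pderiv pochhammer_fact_shift
      by (simp add: coeff_map_poly coeff_monic_gegenbauer)
  qed
  moreover have "poly ((pderiv ^^ j) ?J) 0 = 0" if "j < N" for j
    using that by (simp add: poly_0_coeff_0 coeff_higher_pderiv coeff_map_poly coeff_integrated_poly_low)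
  ultimately have "lead_coeff ?J = 1 \<and> degree ?J = degree ?p + N \<and>
     (pderiv ^^ N) ?J = smult (fact (degree ?p + N) / fact (degree ?p)) ?p \<and>
     (\<forall>j<N. poly ((pderiv ^^ j) ?J) 0 = 0)"
    by (simp add: deg flip: mult_2)
  then show ?thesis
    unfolding I_int_def using I_int_ex1[OF lead, of N] by (rule the1_equality[rotated])
qed

subsection \<open>The reduced polynomials\<close>

text \<open>What remains of the integral, in the variable w = -z^2, after removal of the sign and of
  the lowest power of w. Its constant coefficient is nonzero, so its zeros account for exactly the
  nonzero zeros in z.\<close>

definition tail_poly :: "nat \<Rightarrow> nat \<Rightarrow> complex poly" where
  "tail_poly \<alpha> N = (\<Sum>k\<le>N div 2. monom (of_real (gcoef \<alpha> N ((N + 1) div 2 + k))) k)"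

lemma coeff_tail_poly: "coeff (tail_poly \<alpha> N) k = of_real (gcoef \<alpha> N ((N + 1) div 2 + k))"
proof -
  have "coeff (tail_poly \<alpha> N) k = (\<Sum>i\<le>N div 2. if i = k then of_real (gcoef \<alpha> N ((N + 1) div 2 + k)) else 0)"
    unfolding tail_poly_def coeff_sum by (intro sum.cong) auto
  also have "\<dots> = (if k \<le> N div 2 then of_real (gcoef \<alpha> N ((N + 1) div 2 + k)) else 0)"
    by (subst sum.delta) auto
  finally show ?thesis by (auto simp: gcoef_eq_0)
qed

lemma degree_tail_poly: "degree (tail_poly \<alpha> N) = N div 2"
proof (rule antisym)
  show "degree (tail_poly \<alpha> N) \<le> N div 2"
    by (rule degree_le) (auto simp: coeff_tail_poly intro!: gcoef_eq_0)
  have "(N + 1) div 2 + N div 2 = N" by linarith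
  then show "N div 2 \<le> degree (tail_poly \<alpha> N)"
    by (intro le_degree) (simp add: coeff_tail_poly)
qed

lemma power_mid_tail_poly:
  "w ^ ((N + 1) div 2) * poly (tail_poly \<alpha> N) w = (\<Sum>m = (N + 1) div 2..N. of_real (gcoef \<alpha> N m) * w ^ m)"
proof -
  have "w ^ ((N + 1) div 2) * poly (tail_poly \<alpha> N) w
     = (\<Sum>k\<le>N div 2. of_real (gcoef \<alpha> N ((N + 1) div 2 + k)) * w ^ ((N + 1) div 2 + k))"
    by (simp add: tail_poly_def poly_sum poly_monom sum_distrib_left power_add mult_ac)
  also have "\<dots> = (\<Sum>m = (N + 1) div 2..N. of_real (gcoef \<alpha> N m) * w ^ m)"
    by (rule sum.reindex_bij_witness[of _ "\<lambda>m. m - (N + 1) div 2" "\<lambda>k. (N + 1) div 2 + k"]) auto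
  finally show ?thesis .
qed

lemma poly_I_int_ultraspherical:
  "poly (I_int N (ultraspherical \<alpha> N)) z =
     (-1) ^ N * (\<phi>1 z ^ ((N + 1) div 2) * poly (tail_poly \<alpha> N) (\<phi>1 z))"
proof -
  have "map_poly complex_of_real (integrated_poly \<alpha> N) =
      (\<Sum>m = (N + 1) div 2..N. monom (of_real ((-1) ^ (N + m) * gcoef \<alpha> N m)) (2 * m))"
    unfolding integrated_poly_def by (intro poly_eqI) (auto simp: coeff_map_poly coeff_sum intro!: sum.cong)
  then have "poly (I_int N (ultraspherical \<alpha> N)) z =
     (\<Sum>m = (N + 1) div 2..N. of_real ((-1) ^ (N + m) * gcoef \<alpha> N m) * z ^ (2 * m))"
    by (simp add: I_int_ultraspherical poly_sum poly_monom)
  also have "\<dots> = (-1) ^ N * (\<Sum>m = (N + 1) div 2..N. of_real (gcoef \<alpha> N m) * \<phi>1 z ^ m)"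
    unfolding sum_distrib_left
    by (intro sum.cong) (simp_all add: \<phi>1_def power_add power_mult power_minus[of "z\<^sup>2"])
  finally show ?thesis by (simp only: power_mid_tail_poly)
qed

text \<open>At m = (N + 1) div 2 + k the new factor 2m + 2 \<alpha> + 1 is a constant plus 2k, and
  multiplying the k-th coefficient by k is the operator w d/dw.\<close>

lemma tail_poly_Suc:
  "tail_poly (Suc \<alpha>) N = smult (of_real (1 / (2 * real N + 2 * real \<alpha> + 1)))
     (smult (of_real (2 * real ((N + 1) div 2) + 2 * real \<alpha> + 1)) (tail_poly \<alpha> N)
       + smult 2 (pCons 0 (pderiv (tail_poly \<alpha> N))))"
proof (rule poly_eqI)
  fix k
  have d: "coeff (pCons 0 (pderiv p)) k = of_nat k * coeff p k" for p :: "complex poly"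
    by (cases k) (auto simp: coeff_pderiv)
  show "coeff (tail_poly (Suc \<alpha>) N) k = coeff (smult (of_real (1 / (2 * real N + 2 * real \<alpha> + 1)))
     (smult (of_real (2 * real ((N + 1) div 2) + 2 * real \<alpha> + 1)) (tail_poly \<alpha> N)
       + smult 2 (pCons 0 (pderiv (tail_poly \<alpha> N))))) k"
    unfolding coeff_smult coeff_add d coeff_tail_poly gcoef_Suc
    by (simp add: divide_inverse ring_distribs mult_ac)
qed

text \<open>(1 + w)^N solves (1 + w) f' = N f. Cutting off the low terms leaves a single boundary
  term, of degree one below the cut; inserting f = w^((N + 1) div 2) Q and cancelling the common
  power gives this equation, with the boundary term as its constant.\<close>

lemma tail_poly_0_ode:
  "(of_nat ((N + 1) div 2) - of_nat (N div 2) * w) * poly (tail_poly 0 N) w =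
     of_nat ((N + 1) div 2) * of_nat (N choose (N div 2)) - w * (1 + w) * poly (pderiv (tail_poly 0 N)) w"
proof -
  let ?a = "(N + 1) div 2" and ?b = "N div 2" and ?Q = "tail_poly 0 N"
  have ab: "?a + ?b = N" by linarith
  have d: "coeff (pCons 0 (pderiv p)) k = of_nat k * coeff p k" for p :: "complex poly" and k
    by (cases k) (auto simp: coeff_pderiv)
  have "smult (of_nat ?a) ?Q - smult (of_nat ?b) (pCons 0 ?Q) + (pCons 0 (pderiv ?Q) + pCons 0 (pCons 0 (pderiv ?Q)))
     = [:of_nat ?a * of_nat (N choose ?b):]"
  proof (rule poly_eqI)
    fix k
    show "coeff (smult (of_nat ?a) ?Q - smult (of_nat ?b) (pCons 0 ?Q) + (pCons 0 (pderiv ?Q) + pCons 0 (pCons 0 (pderiv ?Q)))) k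
      = coeff [:of_nat ?a * of_nat (N choose ?b):] k"
    proof (cases k)
      case 0
      have "N choose ?a = N choose ?b"
        using binomial_symmetric[of ?a N] ab by (metis add_diff_cancel_left' le_add1)
      then show ?thesis using 0 by (simp add: coeff_tail_poly gcoef_0)
    next
      case (Suc j)
      have "(real (?a + j) + 1) * real (N choose Suc (?a + j)) = (real N - real (?a + j)) * real (N choose (?a + j))"
        by (rule binomial_absorb)
      then have "(real ?a + real j + 1) * real (N choose Suc (?a + j)) = (real ?b - real j) * real (N choose (?a + j))"
        using arg_cong[OF ab, of real] by simp
      then have "complex_of_real ((real ?a + real j + 1) * real (N choose Suc (?a + j)))
          = complex_of_real ((real ?b - real j) * real (N choose (?a + j)))" by (rule arg_cong)
      then show ?thesis
        unfolding coeff_add coeff_diff coeff_smult d Suc coeff_pCons_Suc coeff_tail_poly gcoef_0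
        by (simp add: coeff_pderiv coeff_tail_poly gcoef_0 algebra_simps)
    qed
  qed
  then have "poly (smult (of_nat ?a) ?Q - smult (of_nat ?b) (pCons 0 ?Q) + (pCons 0 (pderiv ?Q) + pCons 0 (pCons 0 (pderiv ?Q)))) w
     = of_nat ?a * of_nat (N choose ?b)" by simp
  then show ?thesis by (simp add: algebra_simps)
qed

subsection \<open>Central binomial coefficients\<close>

lemma filterlim_half: "filterlim (\<lambda>N::nat. N div 2) at_top at_top"
  unfolding filterlim_at_top
proof
  fix Z :: nat
  show "\<forall>\<^sub>F N in sequentially. Z \<le> N div 2"
    using eventually_ge_at_top[of "2 * Z"] by eventually_elim simp
qed

lemma central_binomial_Suc:
  "real (2 * Suc n choose Suc n) = real (2 * n choose n) * (2 * (2 * real n + 1) / (real n + 1))"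
proof -
  have gen: "(2 * k * (d * F)) / (k * A * (k * A)) = F / (A * A) * (2 * d / k)" if "k \<noteq> 0" for k d F A :: real
    using that by (simp add: mult_ac)
  have f: "fact (2 * n + 2) = 2 * (real n + 1) * ((2 * real n + 1) * fact (2 * n))"
    "fact (n + 1) = (real n + 1) * fact n" by (simp_all add: algebra_simps)
  have "real (2 * Suc n choose Suc n) = fact (2 * n + 2) / (fact (n + 1) * fact (n + 1))"
    using binomial_fact[of "Suc n" "2 * Suc n", where ?'a = real] by simp
  also have "\<dots> = fact (2 * n) / (fact n * fact n) * (2 * (2 * real n + 1) / (real n + 1))"
    unfolding f by (rule gen) simp
  also have "fact (2 * n) / (fact n * fact n) = real (2 * n choose n)"
    using binomial_fact[of n "2 * n", where ?'a = real] by simp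
  finally show ?thesis .
qed

text \<open>Gives access to the Gamma-function asymptotics of generalised binomials; the constant 1
  / sqrt pi below is 1 / Gamma(1/2).\<close>

lemma gchoose_minus_half: "((-1/2 :: real) gchoose n) = (-1) ^ n * real (2 * n choose n) / 4 ^ n"
proof (induction n)
  case (Suc n)
  have gen: "a * b / c * (- d / 4) = (-1) ^ Suc n * (b * d) / 4 ^ Suc n" if "a = (-1) ^ n" "c = 4 ^ n" for a b c d :: real
    using that by (simp add: mult_ac)
  have "((-1/2 :: real) gchoose Suc n) = ((-1/2) gchoose n) * ((-1/2 - real n) / (real n + 1))"
    by (simp add: gbinomial_prod_rev mult.commute)
  also have "(-1/2 - real n) / (real n + 1) = - (2 * (2 * real n + 1) / (real n + 1)) / 4"
    by (simp add: field_simps)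
  also have "((-1/2 :: real) gchoose n) * \<dots> = (-1) ^ Suc n * real (2 * Suc n choose Suc n) / 4 ^ Suc n"
    unfolding Suc.IH central_binomial_Suc by (rule gen) simp_all
  finally show ?case .
qed simp

lemma central_binomial_tendsto:
  "(\<lambda>n. real (2 * n choose n) / 4 ^ n * sqrt (real n)) \<longlonglongrightarrow> 1 / sqrt pi"
proof -
  have "(\<lambda>n. ((-1/2 :: real) gchoose n) / ((-1)^n / exp ((-1/2 + 1) * of_real (ln (real n))))) \<longlonglongrightarrow>
           inverse (Gamma (- (-1/2)))" by (rule gbinomial_asymptotic)
  also have "inverse (Gamma (- (-1/2 :: real))) = 1 / sqrt pi"
    by (simp add: Gamma_one_half_real inverse_eq_divide)
  finally have *: "(\<lambda>n. ((-1/2 :: real) gchoose n) / ((-1)^n / exp ((-1/2 + 1) * of_real (ln (real n))))) \<longlonglongrightarrow> 1 / sqrt pi" .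
  show ?thesis
  proof (rule Lim_transform_eventually[OF *])
    show "eventually (\<lambda>n. ((-1/2 :: real) gchoose n) / ((-1)^n / exp ((-1/2 + 1) * of_real (ln (real n))))
       = real (2 * n choose n) / 4 ^ n * sqrt (real n)) sequentially"
      using eventually_gt_at_top[of 0]
    proof eventually_elim
      case (elim n)
      have "exp ((-1/2 + 1) * of_real (ln (real n))) = sqrt (real n)"
        using elim by (simp add: ln_sqrt[symmetric])
      then show ?case
        unfolding gchoose_minus_half by simp
    qed
  qed
qed

lemma central_binomial_odd_eq:
  "real (2 * n + 1 choose n) = real (2 * n choose n) * ((2 * real n + 1) / (real n + 1))"
proof -
  have "(n + 1) * (2 * n + 1 choose n) = (2 * n + 1) * (2 * n choose n)"
    using binomial_absorb_comp[of "2 * n + 1" n] by simp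
  then have "(real n + 1) * real (2 * n + 1 choose n) = (2 * real n + 1) * real (2 * n choose n)"
    by (metis (mono_tags) of_nat_1 of_nat_add of_nat_mult of_nat_numeral)
  then show ?thesis by (simp add: field_simps)
qed

text \<open>2^N divided by the middle binomial is of order sqrt N, so the further division by
  \<open>(N + 1) div 2\<close> leaves order 1 / sqrt N. The factor 2 pays for odd N, where 2^N is
  twice 4^(N div 2).\<close>

lemma pow2_le_mid_binomial:
  assumes "N \<ge> 2"
  shows "2 ^ N / real (N choose (N div 2)) / real ((N + 1) div 2)
    \<le> 2 * (inverse (real (2 * (N div 2) choose (N div 2)) / 4 ^ (N div 2) * sqrt (real (N div 2))) * inverse (sqrt (real (N div 2))))"
proof -
  let ?n = "N div 2"
  have n: "real ?n > 0" using assms by simp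
  have "(2::real) ^ N \<le> 2 ^ Suc (2 * ?n)"
    by (rule power_increasing) auto
  also have "\<dots> = 2 * 4 ^ ?n" by (simp add: power_mult)
  finally have 1: "(2::real) ^ N \<le> 2 * 4 ^ ?n" .
  have "2 * ?n choose ?n \<le> N choose ?n" by (rule binomial_right_mono) simp
  then have 2: "real (2 * ?n choose ?n) \<le> real (N choose ?n)" by simp
  have 3: "real ?n \<le> real ((N + 1) div 2)" by simp
  have pos: "real (2 * ?n choose ?n) > 0" by simp
  have "2 ^ N / real (N choose ?n) / real ((N + 1) div 2) \<le> 2 * 4 ^ ?n / real (2 * ?n choose ?n) / real ?n"
    using 1 2 3 n pos by (intro frac_le) auto
  also have "\<dots> = 2 * (inverse (real (2 * ?n choose ?n) / 4 ^ ?n * sqrt (real ?n)) * inverse (sqrt (real ?n)))"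
    using n pos by (simp add: field_simps)
  finally show ?thesis .
qed

text \<open>Up to constants, this quotient is the error in the differential equation after division
  by its large coefficient \<open>(N + 1) div 2\<close> and by the lowest coefficient of the
  tail.\<close>

lemma pow2_mid_binomial_tendsto_0:
  "(\<lambda>N. 2 ^ N / real (N choose (N div 2)) / real ((N + 1) div 2)) \<longlonglongrightarrow> 0"
proof -
  have "(\<lambda>n. 2 * (inverse (real (2 * n choose n) / 4 ^ n * sqrt (real n)) * inverse (sqrt (real n)))) \<longlonglongrightarrow> 2 * (inverse (1 / sqrt pi) * 0)"
    by (intro tendsto_intros central_binomial_tendsto tendsto_inverse_0_at_top
       filterlim_compose[OF sqrt_at_top] filterlim_real_sequentially) auto
  then have "(\<lambda>n. 2 * (inverse (real (2 * n choose n) / 4 ^ n * sqrt (real n)) * inverse (sqrt (real n)))) \<longlonglongrightarrow> 0" by simp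
  note lim = filterlim_compose[OF this filterlim_half]
  show ?thesis
  proof (rule tendsto_sandwich[OF _ _ tendsto_const lim])
    show "\<forall>\<^sub>F N in sequentially. 0 \<le> 2 ^ N / real (N choose (N div 2)) / real ((N + 1) div 2)"
      by simp
  qed (rule eventually_mono[OF eventually_ge_at_top[of 2] pow2_le_mid_binomial])
qed

subsection \<open>Asymptotics where the lowest term dominates\<close>

text \<open>Written without division, so that it is visibly open and contains 0. It exceeds
  \<open>E2\<close> by the part of the curve |\<phi>| = 1 inside the unit disc, where the same
  asymptotics hold.\<close>

definition inner_dom :: "complex set" where
  "inner_dom = {w. cmod w < 1} \<union> {w. (cmod (w + 1))\<^sup>2 < 4 * cmod w}"

lemma open_inner_dom: "open inner_dom"
  unfolding inner_dom_def by (intro open_Un open_Collect_less continuous_intros)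

lemma one_notin_inner_dom: "1 \<notin> inner_dom"
  by (simp add: inner_dom_def)

lemma E2_subset_inner_dom: "E2 \<subseteq> inner_dom"
proof
  fix w assume "w \<in> E2"
  then show "w \<in> inner_dom"
    by (cases "w = 0") (auto simp: E2_def inner_dom_def \<phi>_def norm_divide norm_mult norm_power divide_simps)
qed

text \<open>Crude but sufficient: for |w| >= 1 each power is at most the highest one, and all
  binomials together sum to 2^N.\<close>

lemma norm_low_sum_le:
  assumes "1 \<le> cmod w"
  shows "cmod (\<Sum>m<M. of_real (gcoef \<alpha> N m) * w ^ m) \<le> 2 ^ N * cmod w ^ (M - 1)"
proof -
  have "cmod (\<Sum>m<M. of_real (gcoef \<alpha> N m) * w ^ m) \<le> (\<Sum>m<M. gcoef \<alpha> N m * cmod w ^ m)"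
    by (rule order.trans[OF norm_sum]) (simp add: norm_mult norm_power gcoef_nonneg)
  also have "\<dots> \<le> (\<Sum>m<M. real (N choose m) * cmod w ^ (M - 1))"
    using assms by (intro sum_mono mult_mono gcoef_le_binomial power_increasing) auto
  also have "\<dots> = real (\<Sum>m<M. N choose m) * cmod w ^ (M - 1)"
    by (simp add: sum_distrib_right)
  also have "(\<Sum>m<M. N choose m) \<le> (\<Sum>m\<le>max M N. N choose m)"
    by (intro sum_mono2) auto
  also have "(\<Sum>m\<le>max M N. N choose m) = (\<Sum>m\<le>N. N choose m)"
    by (rule sum.mono_neutral_right) (auto simp: binomial_eq_0)
  also have "\<dots> = 2 ^ N" by (rule choose_row_sum)
  finally show ?thesis by (simp add: mult_right_mono)
qed

lemma full_sum_split:
  "(\<Sum>m\<le>N. of_real (gcoef \<alpha> N m) * w ^ m) =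
     (\<Sum>m<(N + 1) div 2. of_real (gcoef \<alpha> N m) * w ^ m) + w ^ ((N + 1) div 2) * poly (tail_poly \<alpha> N) w"
proof -
  have "{..N} = {..<(N + 1) div 2} \<union> {(N + 1) div 2..N}" by auto
  then show ?thesis
    unfolding power_mid_tail_poly by (simp only:) (subst sum.union_disjoint, auto)
qed

text \<open>In the closed unit disc the binomials alone bound the sum. Outside, the tail times w^((N
  + 1) div 2) is (1 + w)^N minus the low part, and |1 + w|^2 <= 4 |w| bounds each of these by 2^N
  |w|^((N + 1) div 2); hence the factor 2.\<close>

lemma norm_tail_poly_0_le:
  assumes w: "w \<in> inner_dom"
  shows "cmod (poly (tail_poly 0 N) w) \<le> 2 * 2 ^ N"
proof (cases "cmod w \<le> 1")
  case True
  have "cmod (poly (tail_poly 0 N) w) \<le> (\<Sum>k\<le>N div 2. real (N choose ((N + 1) div 2 + k)) * cmod w ^ k)"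
    unfolding tail_poly_def poly_sum poly_monom
    by (rule order.trans[OF norm_sum]) (simp add: norm_mult norm_power gcoef_0)
  also have "\<dots> \<le> (\<Sum>k\<le>N div 2. real (N choose ((N + 1) div 2 + k)) * 1)"
    using True by (intro sum_mono mult_left_mono power_le_one) auto
  also have "\<dots> = (\<Sum>m = (N + 1) div 2..N. real (N choose m))"
    by (rule sum.reindex_bij_witness[of _ "\<lambda>m. m - (N + 1) div 2" "\<lambda>k. (N + 1) div 2 + k"]) auto
  also have "\<dots> \<le> (\<Sum>m\<le>N. real (N choose m))"
    by (intro sum_mono2) auto
  also have "\<dots> = real (\<Sum>m\<le>N. N choose m)" by simp
  also have "\<dots> = 2 ^ N" by (simp only: choose_row_sum of_nat_power of_nat_numeral)
  finally show ?thesis by (rule order.trans) simp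
next
  case False
  let ?a = "(N + 1) div 2"
  have w1: "cmod w \<ge> 1" and lt: "(cmod (w + 1))\<^sup>2 \<le> 4 * cmod w"
    using False w by (auto simp: inner_dom_def)
  have "(4::real) ^ N = 2 ^ (2 * N)" by (simp add: power_mult)
  then have p4: "(4::real) ^ N = (2 ^ N)\<^sup>2" by (simp only: power_even_eq)
  have "((cmod (1 + w)) ^ N)\<^sup>2 = ((cmod (w + 1))\<^sup>2) ^ N"
    by (simp only: add.commute[of 1] power_mult[symmetric] mult.commute[of N])
  also have "\<dots> \<le> (4 * cmod w) ^ N" using lt by (rule power_mono) simp
  also have "\<dots> \<le> 4 ^ N * cmod w ^ (2 * ?a)"
    unfolding power_mult_distrib using w1 by (intro mult_left_mono power_increasing) auto
  also have "\<dots> = (2 ^ N * cmod w ^ ?a)\<^sup>2"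
    by (simp only: p4 power_even_eq power_mult_distrib)
  finally have "cmod (1 + w) ^ N \<le> 2 ^ N * cmod w ^ ?a"
    by (rule power2_le_imp_le) simp
  moreover have "cmod (\<Sum>m<?a. of_real (gcoef 0 N m) * w ^ m) \<le> 2 ^ N * cmod w ^ ?a"
    using w1 by (intro order.trans[OF norm_low_sum_le] mult_left_mono power_increasing) auto
  ultimately have "cmod ((1 + w) ^ N - (\<Sum>m<?a. of_real (gcoef 0 N m) * w ^ m)) \<le> 2 ^ N * cmod w ^ ?a + 2 ^ N * cmod w ^ ?a"
    by (intro order.trans[OF norm_triangle_ineq4] add_mono) (simp_all add: norm_power)
  also have "(1 + w) ^ N - (\<Sum>m<?a. of_real (gcoef 0 N m) * w ^ m) = w ^ ?a * poly (tail_poly 0 N) w"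
    using full_sum_split[of 0 N w] binomial_ring[of w 1 N] by (simp add: gcoef_0 add.commute)
  finally have "cmod w ^ ?a * cmod (poly (tail_poly 0 N) w) \<le> cmod w ^ ?a * (2 * 2 ^ N)"
    by (simp add: norm_mult norm_power mult_ac)
  moreover have "cmod w ^ ?a > 0" using w1 by (intro zero_less_power) linarith
  ultimately show ?thesis by (simp only: mult_le_cancel_left_pos)
qed

lemma norm_pderiv_le:
  assumes "r > 0" "\<And>x. cmod (z - x) = r \<Longrightarrow> cmod (poly p x) \<le> B"
  shows "cmod (poly (pderiv p) z) \<le> B / r"
proof -
  have "cmod ((deriv ^^ 1) (poly p) z) \<le> fact 1 * B / r ^ 1"
    by (rule Cauchy_inequality[OF _ _ assms]) (auto intro!: holomorphic_intros continuous_intros)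
  moreover have "deriv (poly p) z = poly (pderiv p) z" by (rule DERIV_imp_deriv[OF poly_DERIV])
  ultimately show ?thesis by simp
qed

lemma uniform_limit_dominated:
  assumes "eventually (\<lambda>n. \<forall>x\<in>S. dist (f n x) (l x) \<le> \<epsilon> n) F" "(\<epsilon> \<longlongrightarrow> (0::real)) F"
  shows "uniform_limit S f l F"
proof (rule uniform_limitI)
  fix e :: real assume "e > 0"
  with assms(2) have "eventually (\<lambda>n. \<epsilon> n < e) F" by (rule order_tendstoD)
  with assms(1) show "eventually (\<lambda>n. \<forall>x\<in>S. dist (f n x) (l x) < e) F"
    by eventually_elim fastforce
qed

text \<open>Divided by \<open>(N + 1) div 2\<close> and by the lowest coefficient, the differential
  equation reads (1 - w) x = 1 + error. The derivative in the error costs only a factor 1 / r, where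
  r is a distance by which K can be fattened inside \<open>inner_dom\<close>.\<close>

lemma tail_poly_0_uniform_limit:
  assumes K: "compact K" "K \<subseteq> inner_dom"
  shows "uniform_limit K (\<lambda>N w. poly (tail_poly 0 N) w / of_nat (N choose (N div 2))) (\<lambda>w. 1 / (1 - w)) sequentially"
proof -
  obtain r where r: "r > 0" "(\<Union>x\<in>K. cball x r) \<subseteq> inner_dom"
    using compact_subset_open_imp_cball_epsilon_subset[OF K(1) open_inner_dom K(2)] by blast
  obtain R where R: "\<And>w. w \<in> K \<Longrightarrow> cmod w \<le> R" "R \<ge> 0"
    using compact_imp_bounded[OF K(1)] unfolding bounded_iff by (meson norm_ge_zero order.trans linear)
  have "1 \<notin> K" using K one_notin_inner_dom by blast
  then obtain \<delta> where \<delta>: "\<delta> > 0" "\<And>w. w \<in> K \<Longrightarrow> \<delta> \<le> cmod (1 - w)"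
    using separate_point_closed[OF compact_imp_closed[OF K(1)], of 1] by (metis dist_norm)
  \<comment> \<open>R and R (1 + R) / r bound the two error terms, the 2 is that of
    \<open>norm_tail_poly_0_le\<close>, and \<delta> is a lower bound of |1 - w|, the final
    divisor.\<close>
  define c where "c = 2 * (R + R * (1 + R) / r) / \<delta>"
  define \<epsilon> where "\<epsilon> N = c * (2 ^ N / real (N choose (N div 2)) / real ((N + 1) div 2))" for N
  show ?thesis
  proof (rule uniform_limit_dominated)
    have "(\<lambda>N. c * (2 ^ N / real (N choose (N div 2)) / real ((N + 1) div 2))) \<longlonglongrightarrow> c * 0"
      by (intro tendsto_intros pow2_mid_binomial_tendsto_0)
    then show "\<epsilon> \<longlonglongrightarrow> 0" by (simp add: \<epsilon>_def[abs_def])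
    show "\<forall>\<^sub>F N in sequentially. \<forall>w\<in>K. dist (poly (tail_poly 0 N) w / of_nat (N choose (N div 2))) (1 / (1 - w)) \<le> \<epsilon> N"
      using eventually_gt_at_top[of 0]
    proof eventually_elim
      case (elim N)
      show ?case
      proof
        fix w assume w: "w \<in> K"
        let ?a = "(N + 1) div 2" and ?b = "N div 2" and ?Q = "tail_poly 0 N"
        define C where "C = real (N choose ?b)"
        have C: "C > 0" by (simp add: C_def)
        define x where "x = poly ?Q w / of_real C"
        define y where "y = poly (pderiv ?Q) w / of_real C"
        define t where "t = 2 * 2 ^ N / C"
        have a: "real ?a > 0" using elim by simp
        have x: "cmod x \<le> t"
          using norm_tail_poly_0_le[of w N] w K C
          by (auto simp: x_def t_def norm_divide intro!: divide_right_mono)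
        have "cmod (poly (pderiv ?Q) w) \<le> (2 * 2 ^ N) / r"
          using r(1) by (rule norm_pderiv_le) (use r(2) w in \<open>force simp: dist_norm intro!: norm_tail_poly_0_le\<close>)
        then have y: "cmod y \<le> t / r"
          using C by (simp add: y_def t_def norm_divide field_simps)
        have ode: "(of_nat ?a - of_nat ?b * w) * x = of_nat ?a - w * (1 + w) * y"
          using arg_cong[OF tail_poly_0_ode[of N w], of "\<lambda>u. u / of_real C"] C
          by (simp add: x_def y_def C_def diff_divide_distrib)
        have "of_nat ?a * ((1 - w) * x - 1) = - (of_nat ?a - of_nat ?b) * w * x - w * (1 + w) * y"
          using ode by (simp add: algebra_simps)
        then have "cmod (of_nat ?a * ((1 - w) * x - 1)) \<le> cmod (- (of_nat ?a - of_nat ?b) * w * x) + cmod (w * (1 + w) * y)"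
          by (metis norm_triangle_ineq4)
        also have "\<dots> \<le> 1 * R * t + R * (1 + R) * (t / r)"
        proof -
          \<comment> \<open>The two halves of N differ by 0 or 1, so exchanging one for the other
            costs O(1) against \<open>(N + 1) div 2\<close>.\<close>
          have "complex_of_nat ?a - of_nat ?b = 0 \<or> complex_of_nat ?a - of_nat ?b = 1"
            by (cases "even N") (auto elim!: evenE oddE)
          then have "cmod (- (complex_of_nat ?a - of_nat ?b)) \<le> 1" unfolding norm_minus_cancel by auto
          moreover have "cmod (1 + w) \<le> 1 + R"
            using norm_triangle_ineq[of 1 w] R(1)[OF w] by simp
          ultimately show ?thesis
            unfolding norm_mult using x y R(1)[OF w] R(2)
            by (intro add_mono mult_mono) auto
        qed
        also have "\<dots> = (R + R * (1 + R) / r) * t" by (simp add: field_simps)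
        finally have "real ?a * cmod ((1 - w) * x - 1) \<le> (R + R * (1 + R) / r) * t"
          unfolding norm_mult norm_of_nat .
        then have 1: "cmod ((1 - w) * x - 1) \<le> (R + R * (1 + R) / r) * t / real ?a"
          using a by (simp add: field_simps)
        have nz: "cmod (1 - w) \<ge> \<delta>" "1 - w \<noteq> 0" using \<delta> w by force+
        have "x - 1 / (1 - w) = ((1 - w) * x - 1) / (1 - w)"
          using nz by (simp add: field_simps)
        then have "cmod (x - 1 / (1 - w)) = cmod ((1 - w) * x - 1) / cmod (1 - w)"
          by (simp only: norm_divide)
        also have "\<dots> \<le> ((R + R * (1 + R) / r) * t / real ?a) / \<delta>"
          using 1 nz \<delta>(1) by (intro frac_le) (auto intro: order.trans[OF norm_ge_zero])
        also have "\<dots> = \<epsilon> N"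
          by (simp add: \<epsilon>_def c_def t_def C_def algebra_simps)
        finally show "dist (poly ?Q w / of_nat (N choose ?b)) (1 / (1 - w)) \<le> \<epsilon> N"
          by (simp add: dist_norm x_def C_def)
      qed
    qed
  qed
qed

text \<open>In \<open>tail_poly_Suc\<close> the scalar factor tends to 1/2 and the derivative
  carries a factor of order 1/N. Cauchy's estimate on a fattening of K bounds that derivative, which
  is why the induction hypothesis must cover all compact sets.\<close>

lemma tail_poly_uniform_limit:
  assumes K: "compact K" "K \<subseteq> inner_dom"
  shows "uniform_limit K (\<lambda>N w. poly (tail_poly \<alpha> N) w / of_nat (N choose (N div 2)))
    (\<lambda>w. 1 / 2 ^ \<alpha> / (1 - w)) sequentially"
  using K
proof (induction \<alpha> arbitrary: K)
  case 0
  then show ?case using tail_poly_0_uniform_limit[of K] by simp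
next
  case (Suc \<alpha>)
  obtain r where r: "r > 0" "(\<Union>x\<in>K. cball x r) \<subseteq> inner_dom"
    using compact_subset_open_imp_cball_epsilon_subset[OF Suc.prems(1) open_inner_dom Suc.prems(2)] by blast
  define K' where "K' = (\<Union>x\<in>K. cball x r)"
  have K': "compact K'" "K' \<subseteq> inner_dom"
    using r compact_minkowski_sum_cball[OF Suc.prems(1)] by (auto simp: K'_def)
  obtain R where R: "\<And>w. w \<in> K \<Longrightarrow> cmod w \<le> R" "R \<ge> 0"
    using compact_imp_bounded[OF Suc.prems(1)] unfolding bounded_iff by (meson norm_ge_zero order.trans linear)
  define l where "l w = 1 / 2 ^ \<alpha> / (1 - w)" for w :: complex
  define f where "f N w = poly (tail_poly \<alpha> N) w / of_nat (N choose (N div 2))" for N w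
  have ul: "uniform_limit K' f l sequentially"
    using Suc.IH[OF K'] by (simp add: f_def[abs_def] l_def[abs_def])
  have "continuous_on K' l"
    unfolding l_def using K' one_notin_inner_dom by (intro continuous_intros) auto
  then obtain B where B: "\<And>w. w \<in> K' \<Longrightarrow> cmod (l w) \<le> B"
    using compact_imp_bounded[OF compact_continuous_image[of K' l]] K'(1) unfolding bounded_iff by blast
  have KK': "K \<subseteq> K'" using r(1) by (force simp: K'_def)
  define q where "q N = (2 * real ((N + 1) div 2) + 2 * real \<alpha> + 1) / (2 * real N + 2 * real \<alpha> + 1)" for N
  have q: "q \<longlonglongrightarrow> 1/2"
  proof (rule tendsto_sandwich)
    show "\<forall>\<^sub>F N in sequentially. (real N + 2 * real \<alpha> + 1) / (2 * real N + 2 * real \<alpha> + 1) \<le> q N"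
      by (intro always_eventually allI) (auto simp: q_def intro!: divide_right_mono)
    show "\<forall>\<^sub>F N in sequentially. q N \<le> (real N + 2 * real \<alpha> + 2) / (2 * real N + 2 * real \<alpha> + 1)"
      by (intro always_eventually allI) (auto simp: q_def intro!: divide_right_mono)
  qed (real_asymp+)
  define g where "g N w = of_real (q N) * f N w + of_real (2 / (2 * real N + 2 * real \<alpha> + 1)) * w
     * (poly (pderiv (tail_poly \<alpha> N)) w / of_nat (N choose (N div 2)))" for N w
  have g: "poly (tail_poly (Suc \<alpha>) N) w / of_nat (N choose (N div 2)) = g N w" for N w
    unfolding tail_poly_Suc g_def f_def q_def
    by (simp add: add_divide_distrib ring_distribs)
  define \<epsilon> where "\<epsilon> N = \<bar>q N - 1/2\<bar> * (B + 1) + 2 / (2 * real N + 2 * real \<alpha> + 1) * R * ((B + 1) / r)" for N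
  have \<epsilon>0: "\<epsilon> \<longlonglongrightarrow> 0"
  proof -
    have "(\<lambda>N. 2 / (2 * real N + 2 * real \<alpha> + 1)) \<longlonglongrightarrow> 0" by real_asymp
    then have "\<epsilon> \<longlonglongrightarrow> \<bar>1/2 - 1/2\<bar> * (B + 1) + 0 * R * ((B + 1) / r)"
      unfolding \<epsilon>_def[abs_def] using q by (intro tendsto_intros) (use r in auto)
    then show ?thesis by simp
  qed
  \<comment> \<open>Comparison with \<open>f N w / 2\<close> instead of the limit uses only
    boundedness of f on K'; the bound B + 1 holds as soon as f is within 1 of its limit.\<close>
  have "uniform_limit K (\<lambda>N w. g N w - f N w / 2) (\<lambda>w. 0) sequentially"
  proof (rule uniform_limit_dominated[OF _ \<epsilon>0])
    have "\<forall>\<^sub>F N in sequentially. \<forall>w\<in>K'. dist (f N w) (l w) < 1"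
      using uniform_limitD[OF ul] by simp
    then show "\<forall>\<^sub>F N in sequentially. \<forall>w\<in>K. dist (g N w - f N w / 2) 0 \<le> \<epsilon> N"
    proof eventually_elim
      case (elim N)
      let ?C = "real (N choose (N div 2))"
      have C: "?C > 0" by simp
      have f: "cmod (f N w) \<le> B + 1" if "w \<in> K'" for w
        using elim[rule_format, OF that] B[OF that] norm_triangle_ineq2[of "f N w" "l w"]
        by (simp add: dist_norm)
      show ?case
      proof
        fix w assume w: "w \<in> K"
        have "cmod (poly (pderiv (tail_poly \<alpha> N)) w) \<le> ((B + 1) * ?C) / r"
        proof (rule norm_pderiv_le[OF r(1)])
          fix x assume "cmod (w - x) = r"
          then have "x \<in> K'" using w by (auto simp: K'_def dist_norm intro!: bexI[of _ w])
          from f[OF this] show "cmod (poly (tail_poly \<alpha> N) x) \<le> (B + 1) * ?C"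
            using C by (simp add: f_def norm_divide field_simps)
        qed
        then have d: "cmod (poly (pderiv (tail_poly \<alpha> N)) w / of_nat (N choose (N div 2))) \<le> (B + 1) / r"
          using C r(1) by (simp add: norm_divide field_simps)
        have "g N w - f N w / 2 = of_real (q N - 1/2) * f N w + of_real (2 / (2 * real N + 2 * real \<alpha> + 1)) * w
            * (poly (pderiv (tail_poly \<alpha> N)) w / of_nat (N choose (N div 2)))"
          by (simp add: g_def algebra_simps)
        also have "cmod \<dots> \<le> \<bar>q N - 1/2\<bar> * (B + 1) + 2 / (2 * real N + 2 * real \<alpha> + 1) * R * ((B + 1) / r)"
        proof (intro order.trans[OF norm_triangle_ineq] add_mono)
          show "cmod (of_real (q N - 1/2) * f N w) \<le> \<bar>q N - 1/2\<bar> * (B + 1)"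
            unfolding norm_mult norm_of_real using f[of w] w KK' by (intro mult_left_mono) auto
          show "cmod (of_real (2 / (2 * real N + 2 * real \<alpha> + 1)) * w
            * (poly (pderiv (tail_poly \<alpha> N)) w / of_nat (N choose (N div 2))))
            \<le> 2 / (2 * real N + 2 * real \<alpha> + 1) * R * ((B + 1) / r)"
            unfolding norm_mult norm_of_real using R w d by (intro mult_mono) auto
        qed
        finally show "dist (g N w - f N w / 2) 0 \<le> \<epsilon> N" by (simp add: \<epsilon>_def)
      qed
    qed
  qed
  moreover have "uniform_limit K (\<lambda>N w. f N w / 2) (\<lambda>w. l w / 2) sequentially"
    using uniform_limit_on_subset[OF ul KK'] by (intro uniform_limit_intros) auto
  ultimately have "uniform_limit K (\<lambda>N w. (g N w - f N w / 2) + f N w / 2) (\<lambda>w. 0 + l w / 2) sequentially"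
    by (rule uniform_limit_add)
  then show ?case unfolding g by (simp add: l_def field_simps)
qed

text \<open>Stated along a sequence of degrees and for any g comparable to the middle binomial, so
  that even and odd degrees are two instances.\<close>

lemma tail_poly_inner_tendsto:
  assumes w: "w \<in> inner_dom"
    and N: "filterlim N at_top sequentially"
    and C: "(\<lambda>n. real (N n choose (N n div 2)) / g n) \<longlonglongrightarrow> c" "c \<noteq> 0"
  shows "(\<lambda>n. poly (tail_poly \<alpha> (N n)) w) \<sim>[sequentially]
    (\<lambda>n. 1 / 2 ^ \<alpha> / (1 - w) * of_real c * of_real (g n))"
proof (rule asymp_equivI'_const)
  have "(\<lambda>N. poly (tail_poly \<alpha> N) w / of_nat (N choose (N div 2))) \<longlonglongrightarrow> 1 / 2 ^ \<alpha> / (1 - w)"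
    by (rule tendsto_uniform_limitI[OF tail_poly_uniform_limit[of "{w}"]]) (use w in auto)
  from filterlim_compose[OF this N]
  have "(\<lambda>n. poly (tail_poly \<alpha> (N n)) w / of_nat (N n choose (N n div 2))) \<longlonglongrightarrow> 1 / 2 ^ \<alpha> / (1 - w)" .
  moreover have "(\<lambda>n. complex_of_real (real (N n choose (N n div 2)) / g n)) \<longlonglongrightarrow> of_real c"
    using C(1) by (rule tendsto_of_real)
  ultimately have "(\<lambda>n. poly (tail_poly \<alpha> (N n)) w / of_nat (N n choose (N n div 2)) *
      complex_of_real (real (N n choose (N n div 2)) / g n)) \<longlonglongrightarrow> 1 / 2 ^ \<alpha> / (1 - w) * of_real c"
    by (rule tendsto_mult)
  then show "(\<lambda>n. poly (tail_poly \<alpha> (N n)) w / of_real (g n)) \<longlonglongrightarrow> 1 / 2 ^ \<alpha> / (1 - w) * of_real c"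
    by simp
  show "1 / 2 ^ \<alpha> / (1 - w) * of_real c \<noteq> 0"
    using C(2) w one_notin_inner_dom by auto
qed

section \<open>Asymptotics of the even and odd integrals on \<open>F2\<close>\<close>

lemma filterlim_double: "filterlim (\<lambda>n::nat. 2 * n) at_top sequentially"
  and filterlim_double_Suc: "filterlim (\<lambda>n::nat. 2 * n + 1) at_top sequentially"
  by (auto intro!: filterlim_subseq simp: strict_mono_def)

lemma I_int_even_inner:
  assumes z: "z \<in> F2"
  shows "(\<lambda>n. poly (I_int (2*n) (ultraspherical \<alpha> (2*n))) z)
        \<sim>[sequentially] (\<lambda>n. (-1)^n * 2 powi (int (2*n) - int \<alpha>) * z ^ (2*n)
            / (complex_of_real (sqrt (pi * real n)) * (1 + z^2)))"
proof -
  have w: "\<phi>1 z \<in> inner_dom" using z E2_subset_inner_dom by (auto simp: F2_def)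
  have "(\<lambda>n. real (2 * n choose (2 * n div 2)) / (4 ^ n / sqrt (real n))) \<longlonglongrightarrow> 1 / sqrt pi"
    using central_binomial_tendsto by simp
  \<comment> \<open>The power of \<open>\<phi>1 z\<close> stands unchanged on both sides, so z = 0,
    where both sides vanish for n > 0, is covered without a case distinction.\<close>
  then have "(\<lambda>n. (-1) ^ (2 * n) * (\<phi>1 z ^ ((2 * n + 1) div 2) * poly (tail_poly \<alpha> (2 * n)) (\<phi>1 z))) \<sim>[sequentially]
    (\<lambda>n. (-1) ^ (2 * n) * (\<phi>1 z ^ ((2 * n + 1) div 2) * (1 / 2 ^ \<alpha> / (1 - \<phi>1 z) * of_real (1 / sqrt pi) * of_real (4 ^ n / sqrt (real n)))))"
    by (intro asymp_equiv_mult asymp_equiv_refl tail_poly_inner_tendsto[OF w filterlim_double]) auto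
  also have "(\<lambda>n. (-1) ^ (2 * n) * (\<phi>1 z ^ ((2 * n + 1) div 2) * (1 / 2 ^ \<alpha> / (1 - \<phi>1 z) * of_real (1 / sqrt pi) * of_real (4 ^ n / sqrt (real n)))))
     = (\<lambda>n. (-1)^n * 2 powi (int (2*n) - int \<alpha>) * z ^ (2*n)
            / (complex_of_real (sqrt (pi * real n)) * (1 + z^2)))"
  proof
    fix n
    have "\<phi>1 z ^ n = (-1) ^ n * z ^ (2 * n)"
      by (simp add: \<phi>1_def power_mult power_minus[of "z\<^sup>2"])
    moreover have "(2::complex) powi (int (2*n) - int \<alpha>) = 4 ^ n / 2 ^ \<alpha>"
      using power_int_diff[of "2::complex" "int (2*n)" "int \<alpha>"] by (simp only: power_int_of_nat) (simp add: power_mult)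
    ultimately show "(-1) ^ (2 * n) * (\<phi>1 z ^ ((2 * n + 1) div 2) * (1 / 2 ^ \<alpha> / (1 - \<phi>1 z) * of_real (1 / sqrt pi) * of_real (4 ^ n / sqrt (real n))))
       = (-1)^n * 2 powi (int (2*n) - int \<alpha>) * z ^ (2*n)
            / (complex_of_real (sqrt (pi * real n)) * (1 + z^2))"
      by (simp only: real_sqrt_mult) (simp add: \<phi>1_def mult_ac)
  qed
  finally show ?thesis unfolding poly_I_int_ultraspherical .
qed

lemma I_int_odd_inner:
  assumes z: "z \<in> F2"
  shows "(\<lambda>n. poly (I_int (2*n+1) (ultraspherical \<alpha> (2*n+1))) z)
        \<sim>[sequentially] (\<lambda>n. (-1)^n * 2 powi (int (2*n+1) - int \<alpha>) * z ^ (2*n+2)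
            / (complex_of_real (sqrt (pi * real n)) * (1 + z^2)))"
proof -
  have w: "\<phi>1 z \<in> inner_dom" using z E2_subset_inner_dom by (auto simp: F2_def)
  \<comment> \<open>The quotient of the middle binomials of orders 2n + 1 and 2n; its limit is the
    extra factor 2 in 2^(2n + 1 - \<alpha>).\<close>
  have "(\<lambda>n. (2 * real n + 1) / (real n + 1)) \<longlonglongrightarrow> 2" by real_asymp
  from tendsto_mult[OF central_binomial_tendsto this]
  have "(\<lambda>n. real (2 * n + 1 choose ((2 * n + 1) div 2)) / (4 ^ n / sqrt (real n))) \<longlonglongrightarrow> 1 / sqrt pi * 2"
    using central_binomial_odd_eq by (simp add: mult_ac)
  then have "(\<lambda>n. (-1) ^ (2 * n + 1) * (\<phi>1 z ^ ((2 * n + 1 + 1) div 2) * poly (tail_poly \<alpha> (2 * n + 1)) (\<phi>1 z))) \<sim>[sequentially]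
    (\<lambda>n. (-1) ^ (2 * n + 1) * (\<phi>1 z ^ ((2 * n + 1 + 1) div 2) * (1 / 2 ^ \<alpha> / (1 - \<phi>1 z) * of_real (1 / sqrt pi * 2) * of_real (4 ^ n / sqrt (real n)))))"
    by (intro asymp_equiv_mult asymp_equiv_refl tail_poly_inner_tendsto[OF w filterlim_double_Suc]) auto
  also have "(\<lambda>n. (-1) ^ (2 * n + 1) * (\<phi>1 z ^ ((2 * n + 1 + 1) div 2) * (1 / 2 ^ \<alpha> / (1 - \<phi>1 z) * of_real (1 / sqrt pi * 2) * of_real (4 ^ n / sqrt (real n)))))
     = (\<lambda>n. (-1)^n * 2 powi (int (2*n+1) - int \<alpha>) * z ^ (2*n+2)
            / (complex_of_real (sqrt (pi * real n)) * (1 + z^2)))"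
  proof
    fix n
    have "\<phi>1 z ^ (n + 1) = (-1) ^ (n + 1) * z ^ (2 * (n + 1))"
      by (simp only: \<phi>1_def power_mult power_minus[of "z\<^sup>2"])
    \<comment> \<open>This minus sign cancels the one of (-1)^(2n + 1).\<close>
    then have "\<phi>1 z ^ (n + 1) = - ((-1) ^ n * z ^ (2 * n + 2))" by simp
    moreover have "(2::complex) powi (int (2*n+1) - int \<alpha>) = 2 * 4 ^ n / 2 ^ \<alpha>"
      using power_int_diff[of "2::complex" "int (2*n+1)" "int \<alpha>"] by (simp only: power_int_of_nat) (simp add: power_mult)
    moreover have "(2 * n + 1 + 1) div 2 = n + 1" by simp
    ultimately show "(-1) ^ (2 * n + 1) * (\<phi>1 z ^ ((2 * n + 1 + 1) div 2) * (1 / 2 ^ \<alpha> / (1 - \<phi>1 z) * of_real (1 / sqrt pi * 2) * of_real (4 ^ n / sqrt (real n))))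
       = (-1)^n * 2 powi (int (2*n+1) - int \<alpha>) * z ^ (2*n+2)
            / (complex_of_real (sqrt (pi * real n)) * (1 + z^2))"
      by (simp only: real_sqrt_mult) (simp add: \<phi>1_def mult_ac)
  qed
  finally show ?thesis unfolding poly_I_int_ultraspherical .
qed

subsection \<open>Asymptotics where the complete binomial sum dominates\<close>

text \<open>The basis of binomials is used because their moments against (N choose m) w^m have a
  closed form. Only the leading coefficient affects the limit.\<close>

lemma odd_product_binomial_expansion:
  "\<exists>b. b \<alpha> = 2 ^ \<alpha> * fact \<alpha> \<and>
     (\<forall>m. (\<Prod>j<\<alpha>. 2 * real m + 2 * real j + 1) = (\<Sum>i\<le>\<alpha>. b i * real (m choose i)))"
proof (induction \<alpha>)
  case 0
  show ?case by (rule exI[of _ "\<lambda>_. 1"]) simp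
next
  case (Suc \<alpha>)
  then obtain b where b: "b \<alpha> = 2 ^ \<alpha> * fact \<alpha>"
    "\<And>m. (\<Prod>j<\<alpha>. 2 * real m + 2 * real j + 1) = (\<Sum>i\<le>\<alpha>. b i * real (m choose i))" by blast
  \<comment> \<open>From m (m choose i) = (i + 1) (m choose (i + 1)) + i (m choose i), applied to
    the factor 2m + 2 \<alpha> + 1.\<close>
  define b' where "b' i = (if i = 0 then 0 else 2 * real i * b (i - 1))
     + (if i \<le> \<alpha> then (2 * real i + 2 * real \<alpha> + 1) * b i else 0)" for i
  have "(\<Prod>j<Suc \<alpha>. 2 * real m + 2 * real j + 1) = (\<Sum>i\<le>Suc \<alpha>. b' i * real (m choose i))" for m
  proof -
    have *: "(2 * real m + 2 * real \<alpha> + 1) * real (m choose i) =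
        2 * (real i + 1) * real (m choose Suc i) + (2 * real i + 2 * real \<alpha> + 1) * real (m choose i)" for i
      using binomial_absorb[of i m] by (simp add: algebra_simps)
    have "(\<Prod>j<Suc \<alpha>. 2 * real m + 2 * real j + 1) =
      (\<Sum>i\<le>\<alpha>. b i * ((2 * real m + 2 * real \<alpha> + 1) * real (m choose i)))"
      unfolding prod.lessThan_Suc b(2) sum_distrib_right by (intro sum.cong) simp_all
    also have "\<dots> = (\<Sum>i\<le>\<alpha>. b i * (2 * (real i + 1) * real (m choose Suc i) + (2 * real i + 2 * real \<alpha> + 1) * real (m choose i)))"
      unfolding * ..
    also have "\<dots> = (\<Sum>i\<le>\<alpha>. 2 * real (Suc i) * b i * real (m choose Suc i))
        + (\<Sum>i\<le>\<alpha>. (2 * real i + 2 * real \<alpha> + 1) * b i * real (m choose i))"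
      unfolding sum.distrib[symmetric] by (intro sum.cong) (auto simp: algebra_simps)
    also have "(\<Sum>i\<le>\<alpha>. 2 * real (Suc i) * b i * real (m choose Suc i))
        = (\<Sum>i\<le>Suc \<alpha>. (if i = 0 then 0 else 2 * real i * b (i - 1)) * real (m choose i))"
      by (simp only: sum.atMost_Suc_shift) simp
    also have "(\<Sum>i\<le>\<alpha>. (2 * real i + 2 * real \<alpha> + 1) * b i * real (m choose i))
        = (\<Sum>i\<le>Suc \<alpha>. (if i \<le> \<alpha> then (2 * real i + 2 * real \<alpha> + 1) * b i else 0) * real (m choose i))"
      by simp
    finally show ?thesis
      unfolding b'_def distrib_right sum.distrib .
  qed
  moreover have "b' (Suc \<alpha>) = 2 ^ Suc \<alpha> * fact (Suc \<alpha>)"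
    by (simp add: b'_def b(1))
  ultimately show ?case by blast
qed

text \<open>By (N choose m) (m choose i) = (N choose i) ((N - i) choose (m - i)), which leaves the
  binomial theorem for exponent N - i.\<close>

lemma binomial_moment_sum:
  fixes w :: complex
  assumes "i \<le> N"
  shows "(\<Sum>m\<le>N. of_nat (N choose m) * of_nat (m choose i) * w ^ m) = of_nat (N choose i) * w ^ i * (1 + w) ^ (N - i)"
proof -
  have "(\<Sum>m\<le>N. of_nat (N choose m) * of_nat (m choose i) * w ^ m)
     = (\<Sum>m\<in>{i..N}. of_nat (N choose m) * of_nat (m choose i) * w ^ m)"
    by (rule sum.mono_neutral_right) (auto simp: binomial_eq_0)
  also have "\<dots> = (\<Sum>m\<in>{i..N}. of_nat (N choose i) * of_nat ((N - i) choose (m - i)) * w ^ m)"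
  proof (rule sum.cong)
    fix m assume "m \<in> {i..N}"
    then have "(N choose m) * (m choose i) = (N choose i) * ((N - i) choose (m - i))"
      by (intro choose_mult) auto
    then show "complex_of_nat (N choose m) * of_nat (m choose i) * w ^ m = of_nat (N choose i) * of_nat ((N - i) choose (m - i)) * w ^ m"
      by (simp only: of_nat_mult[symmetric])
  qed simp
  also have "\<dots> = (\<Sum>k\<le>N - i. of_nat (N choose i) * of_nat ((N - i) choose k) * w ^ (i + k))"
    by (rule sum.reindex_bij_witness[of _ "\<lambda>k. i + k" "\<lambda>m. m - i"]) (use assms in auto)
  also have "\<dots> = of_nat (N choose i) * w ^ i * (w + 1) ^ (N - i)"
    by (simp add: binomial_ring sum_distrib_left power_add mult_ac)
  finally show ?thesis by (simp add: add.commute)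
qed

text \<open>After normalisation the sum is a combination of powers of (1 + w) / w with weights
  \<open>A N i\<close>. The weight at i = \<alpha> tends to 1, the others are O(1/N), and |(1 + w) /
  w| <= 2 for |w| >= 1 makes the limit uniform.\<close>

lemma full_sum_uniform_limit:
  "uniform_limit {w. 1 \<le> cmod w \<and> w \<noteq> -1}
     (\<lambda>N w. (\<Sum>m\<le>N. of_real (gcoef \<alpha> N m) * w ^ m) * ((1 + w) / w) ^ \<alpha> / (1 + w) ^ N) (\<lambda>_. 1) sequentially"
proof -
  obtain b where b: "b \<alpha> = 2 ^ \<alpha> * fact \<alpha>"
    "\<And>m. (\<Prod>j<\<alpha>. 2 * real m + 2 * real j + 1) = (\<Sum>i\<le>\<alpha>. b i * real (m choose i))"
    using odd_product_binomial_expansion by blast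
  define D where "D N = (\<Prod>j<\<alpha>. 2 * real N + 2 * real j + 1)" for N
  define A where "A N i = b i * real (N choose i) / D N" for N i
  have D: "D N > 0" for N unfolding D_def by (intro prod_pos) auto
  have gc: "gcoef \<alpha> N m = (\<Sum>i\<le>\<alpha>. b i / D N * (real (N choose m) * real (m choose i)))" for N m
    unfolding gcoef_def prod_dividef b(2)[of m] D_def[symmetric]
    by (simp add: sum_distrib_left sum_divide_distrib mult_ac)
  have full: "(\<Sum>m\<le>N. of_real (gcoef \<alpha> N m) * w ^ m) * ((1 + w) / w) ^ \<alpha> / (1 + w) ^ N
     = (\<Sum>i\<le>\<alpha>. of_real (A N i) * ((1 + w) / w) ^ (\<alpha> - i))" if N: "\<alpha> \<le> N" and w: "1 \<le> cmod w" "w \<noteq> -1" for N w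
  proof -
    have w0: "w \<noteq> 0" "1 + w \<noteq> 0" using w by (auto simp: add_eq_0_iff)
    have "(\<Sum>m\<le>N. of_real (gcoef \<alpha> N m) * w ^ m)
       = (\<Sum>m\<le>N. \<Sum>i\<le>\<alpha>. of_real (b i / D N) * (of_nat (N choose m) * of_nat (m choose i) * w ^ m))"
      unfolding gc by (simp add: sum_distrib_right sum_distrib_left mult_ac)
    also have "\<dots> = (\<Sum>i\<le>\<alpha>. of_real (b i / D N) * (\<Sum>m\<le>N. of_nat (N choose m) * of_nat (m choose i) * w ^ m))"
      unfolding sum_distrib_left by (rule sum.swap)
    also have "\<dots> = (\<Sum>i\<le>\<alpha>. of_real (A N i) * (w ^ i * (1 + w) ^ (N - i)))"
      using N by (intro sum.cong) (auto simp: binomial_moment_sum A_def)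
    finally have "(\<Sum>m\<le>N. of_real (gcoef \<alpha> N m) * w ^ m) * ((1 + w) / w) ^ \<alpha> / (1 + w) ^ N
       = (\<Sum>i\<le>\<alpha>. of_real (A N i) * (w ^ i * (1 + w) ^ (N - i))) * ((1 + w) / w) ^ \<alpha> / (1 + w) ^ N"
      by (simp only:)
    also have "\<dots> = (\<Sum>i\<le>\<alpha>. of_real (A N i) * (w ^ i * (1 + w) ^ (N - i) * ((1 + w) / w) ^ \<alpha> / (1 + w) ^ N))"
      by (simp only: sum_distrib_right sum_divide_distrib mult.assoc times_divide_eq_right)
    also have "\<dots> = (\<Sum>i\<le>\<alpha>. of_real (A N i) * ((1 + w) / w) ^ (\<alpha> - i))"
    proof (intro sum.cong refl arg_cong2[of _ _ _ _ "(*)"])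
      fix i assume "i \<in> {..\<alpha>}"
      then have i: "i \<le> \<alpha>" "i \<le> N" using N by auto
      have "w ^ i * (1 + w) ^ (N - i) * ((1 + w) / w) ^ \<alpha> / (1 + w) ^ N
         = w ^ i * ((1 + w) ^ N / (1 + w) ^ i) * (((1 + w) / w) ^ (\<alpha> - i) * ((1 + w) / w) ^ i) / (1 + w) ^ N"
      proof -
        have "(1 + w) ^ (N - i) = (1 + w) ^ N / (1 + w) ^ i"
          using i w0 by (simp add: power_diff)
        moreover have "((1 + w) / w) ^ \<alpha> = ((1 + w) / w) ^ (\<alpha> - i) * ((1 + w) / w) ^ i"
          using i by (simp flip: power_add)
        ultimately show ?thesis by (simp only:)
      qed
      also have "\<dots> = ((1 + w) / w) ^ (\<alpha> - i)"
        using w0 by (simp add: power_divide)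
      finally show "w ^ i * (1 + w) ^ (N - i) * ((1 + w) / w) ^ \<alpha> / (1 + w) ^ N = ((1 + w) / w) ^ (\<alpha> - i)" .
    qed
    finally show ?thesis .
  qed
  have Atop: "(\<lambda>N. A N \<alpha>) \<longlonglongrightarrow> 1"
  proof -
    have "(\<lambda>N. \<Prod>j<\<alpha>. 2 * (real N - real j) / (2 * real N + 2 * real j + 1)) \<longlonglongrightarrow> (\<Prod>j<\<alpha>. 1)"
      by (intro tendsto_prod) real_asymp
    moreover have "(\<Prod>j<\<alpha>. 2 * (real N - real j) / (2 * real N + 2 * real j + 1)) = A N \<alpha>" for N
      unfolding A_def b(1) prod_dividef prod.distrib D_def binomial_gbinomial gbinomial_prod_rev
      by (simp add: atLeast0LessThan)
    ultimately show ?thesis by simp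
  qed
  have Alow: "(\<lambda>N. A N i) \<longlonglongrightarrow> 0" if i: "i < \<alpha>" for i
  proof (rule Lim_null_comparison)
    show "\<forall>\<^sub>F N in sequentially. norm (A N i) \<le> \<bar>b i\<bar> * (1 / real N)"
      using eventually_ge_at_top[of 1]
    proof eventually_elim
      case (elim N)
      have "real (N choose i) \<le> real (N ^ i)"
        by (cases "i \<le> N") (use binomial_le_pow[of i N] in \<open>auto simp: binomial_eq_0 simp del: of_nat_power\<close>)
      moreover have "real N ^ Suc i \<le> D N"
      proof -
        have "real N ^ Suc i \<le> real N ^ \<alpha>" using i elim by (intro power_increasing) auto
        also have "\<dots> = (\<Prod>j<\<alpha>. real N)" by simp
        also have "\<dots> \<le> D N" unfolding D_def by (intro prod_mono) auto
        finally show ?thesis .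
      qed
      ultimately have "real (N choose i) / D N \<le> real N ^ i / real N ^ Suc i"
        using elim by (intro frac_le) auto
      also have "\<dots> = 1 / real N" using elim by simp
      finally have "\<bar>b i\<bar> * (real (N choose i) / D N) \<le> \<bar>b i\<bar> * (1 / real N)"
        by (rule mult_left_mono) simp
      then show ?case using D[of N] by (simp add: A_def abs_mult)
    qed
    show "(\<lambda>N. \<bar>b i\<bar> * (1 / real N)) \<longlonglongrightarrow> 0" by real_asymp
  qed
  define \<epsilon> where "\<epsilon> N = (\<Sum>i<\<alpha>. \<bar>A N i\<bar> * 2 ^ (\<alpha> - i)) + \<bar>A N \<alpha> - 1\<bar>" for N
  have "\<epsilon> \<longlonglongrightarrow> (\<Sum>i<\<alpha>. \<bar>0\<bar> * 2 ^ (\<alpha> - i)) + \<bar>1 - 1\<bar>"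
    unfolding \<epsilon>_def[abs_def] using Alow by (intro tendsto_intros Atop) auto
  then have \<epsilon>: "\<epsilon> \<longlonglongrightarrow> 0" by simp
  show ?thesis
  proof (rule uniform_limit_dominated[OF _ \<epsilon>])
    show "\<forall>\<^sub>F N in sequentially. \<forall>w\<in>{w. 1 \<le> cmod w \<and> w \<noteq> -1}.
       dist ((\<Sum>m\<le>N. of_real (gcoef \<alpha> N m) * w ^ m) * ((1 + w) / w) ^ \<alpha> / (1 + w) ^ N) 1 \<le> \<epsilon> N"
      using eventually_ge_at_top[of \<alpha>]
    proof (eventually_elim, intro ballI, elim CollectE conjE)
      fix N w assume N: "\<alpha> \<le> N" and w: "1 \<le> cmod w" "w \<noteq> -1"
      have "cmod (1 + w) \<le> 2 * cmod w"
        using norm_triangle_ineq[of 1 w] w(1) by simp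
      then have le2: "cmod ((1 + w) / w) \<le> 2"
        using w(1) by (simp add: norm_divide divide_simps)
      have "(\<Sum>i\<le>\<alpha>. of_real (A N i) * ((1 + w) / w) ^ (\<alpha> - i)) - 1
         = (\<Sum>i<\<alpha>. of_real (A N i) * ((1 + w) / w) ^ (\<alpha> - i)) + of_real (A N \<alpha> - 1)"
        by (simp add: lessThan_Suc_atMost[symmetric])
      also have "cmod \<dots> \<le> (\<Sum>i<\<alpha>. \<bar>A N i\<bar> * 2 ^ (\<alpha> - i)) + \<bar>A N \<alpha> - 1\<bar>"
      proof (intro order.trans[OF norm_triangle_ineq] add_mono order.trans[OF norm_sum] sum_mono)
        fix i
        show "cmod (of_real (A N i) * ((1 + w) / w) ^ (\<alpha> - i)) \<le> \<bar>A N i\<bar> * 2 ^ (\<alpha> - i)"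
          unfolding norm_mult norm_power norm_of_real using le2 by (intro mult_left_mono power_mono) auto
      qed (simp only: norm_of_real order_refl)
      finally show "dist ((\<Sum>m\<le>N. of_real (gcoef \<alpha> N m) * w ^ m) * ((1 + w) / w) ^ \<alpha> / (1 + w) ^ N) 1 \<le> \<epsilon> N"
        unfolding full[OF N w] dist_norm \<epsilon>_def .
    qed
  qed
qed

lemma norm_phi: "cmod (\<phi> w) = (cmod (1 + w))\<^sup>2 / (4 * cmod w)"
  by (simp add: \<phi>_def norm_divide norm_mult norm_power add.commute)

text \<open>The removed low part is at most 2^N |w|^(N/2), whereas |1 + w| = 2 sqrt |w| sqrt |\<phi>
  w| is at least 2 sqrt |w| sqrt \<rho>; the quotient decays like \<rho>^(-N/2).\<close>

lemma tail_poly_outer_uniform_limit: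
  assumes \<rho>: "1 < \<rho>"
  shows "uniform_limit {w. 1 \<le> cmod w \<and> \<rho> \<le> cmod (\<phi> w)}
     (\<lambda>N w. w ^ ((N + 1) div 2) * poly (tail_poly \<alpha> N) w * ((1 + w) / w) ^ \<alpha> / (1 + w) ^ N) (\<lambda>_. 1) sequentially"
    (is "uniform_limit ?S ?f _ _")
proof -
  let ?P = "\<lambda>N w. (\<Sum>m\<le>N. of_real (gcoef \<alpha> N m) * w ^ m) * ((1 + w) / w) ^ \<alpha> / (1 + w) ^ N"
  let ?L = "\<lambda>N w. (\<Sum>m<(N + 1) div 2. of_real (gcoef \<alpha> N m) * w ^ m) * ((1 + w) / w) ^ \<alpha> / (1 + w) ^ N"
  have "w \<noteq> -1" if "w \<in> ?S" for w using that \<rho> by (auto simp: \<phi>_def)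
  then have P: "uniform_limit ?S ?P (\<lambda>_. 1) sequentially"
    by (intro uniform_limit_on_subset[OF full_sum_uniform_limit]) auto
  have "uniform_limit ?S ?L (\<lambda>_. 0) sequentially"
  proof (rule uniform_limit_dominated)
    have "(\<lambda>N. (1 / sqrt \<rho>) ^ N) \<longlonglongrightarrow> 0"
      using \<rho> by (intro LIMSEQ_realpow_zero) auto
    then show "(\<lambda>N. 2 ^ \<alpha> * (1 / sqrt \<rho>) ^ N) \<longlonglongrightarrow> 0" by (rule tendsto_mult_right_zero)
    show "\<forall>\<^sub>F N in sequentially. \<forall>w\<in>?S. dist (?L N w) 0 \<le> 2 ^ \<alpha> * (1 / sqrt \<rho>) ^ N"
    proof (intro always_eventually allI ballI, elim CollectE conjE)
      fix N :: nat and w assume w: "1 \<le> cmod w" and \<phi>w: "\<rho> \<le> cmod (\<phi> w)"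
      let ?M = "(N + 1) div 2"
      have sq: "4 * cmod w * \<rho> \<le> (cmod (1 + w))\<^sup>2"
      proof -
        have "0 < 4 * cmod w" using w by linarith
        with \<phi>w show ?thesis unfolding norm_phi by (simp only: pos_le_divide_eq mult.commute)
      qed
      have "2 * sqrt (cmod w) * sqrt \<rho> = sqrt (4 * cmod w * \<rho>)"
        by (simp add: real_sqrt_mult)
      also have "\<dots> \<le> cmod (1 + w)"
        using sq by (rule real_le_lsqrt[rotated]) simp
      finally have lb: "2 * sqrt (cmod w) * sqrt \<rho> \<le> cmod (1 + w)" .
      have "cmod w ^ (?M - 1) = sqrt (cmod w) ^ (2 * (?M - 1))"
        by (simp add: power_mult)
      \<comment> \<open>The \<open>- 1\<close> matters: without it the exponent would be N + 1 for
        odd N.\<close>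
      also have "\<dots> \<le> sqrt (cmod w) ^ N"
        using w by (intro power_increasing) auto
      finally have "cmod (\<Sum>m<?M. of_real (gcoef \<alpha> N m) * w ^ m) \<le> 2 ^ N * sqrt (cmod w) ^ N"
        by (intro order.trans[OF norm_low_sum_le[OF w]] mult_left_mono) auto
      also have "\<dots> = (2 * sqrt (cmod w) * sqrt \<rho>) ^ N * (1 / sqrt \<rho>) ^ N"
      proof -
        have "2 * sqrt (cmod w) = (2 * sqrt (cmod w) * sqrt \<rho>) * (1 / sqrt \<rho>)" using \<rho> by simp
        then show ?thesis by (metis power_mult_distrib)
      qed
      also have "\<dots> \<le> cmod (1 + w) ^ N * (1 / sqrt \<rho>) ^ N"
        using lb w \<rho> by (intro mult_right_mono power_mono) auto
      finally have 1: "cmod (\<Sum>m<?M. of_real (gcoef \<alpha> N m) * w ^ m) \<le> cmod (1 + w) ^ N * (1 / sqrt \<rho>) ^ N" .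
      have "0 < 2 * sqrt (cmod w) * sqrt \<rho>" using w \<rho> by (intro mult_pos_pos) auto
      then have pos: "cmod (1 + w) > 0" using lb by linarith
      have "cmod (1 + w) \<le> 2 * cmod w"
        using norm_triangle_ineq[of 1 w] w by simp
      then have "cmod ((1 + w) / w) \<le> 2"
        using w by (simp add: norm_divide divide_simps)
      then have 2: "cmod (((1 + w) / w) ^ \<alpha>) \<le> 2 ^ \<alpha>" unfolding norm_power by (rule power_mono) simp
      have "cmod (?L N w) = cmod (((1 + w) / w) ^ \<alpha>) * (cmod (\<Sum>m<?M. of_real (gcoef \<alpha> N m) * w ^ m) / cmod (1 + w) ^ N)"
        by (simp only: norm_mult norm_divide norm_power) (simp add: mult_ac)
      also have "\<dots> \<le> 2 ^ \<alpha> * (1 / sqrt \<rho>) ^ N"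
        using 1 2 pos by (intro mult_mono) (auto simp: divide_simps mult_ac)
      finally show "dist (?L N w) 0 \<le> 2 ^ \<alpha> * (1 / sqrt \<rho>) ^ N" by (simp only: dist_norm diff_zero)
    qed
  qed
  from uniform_limit_minus[OF P this]
  have "uniform_limit ?S (\<lambda>N w. ?P N w - ?L N w) (\<lambda>_. 1) sequentially" by simp
  then show ?thesis
    unfolding full_sum_split by (simp add: ring_distribs add_divide_distrib)
qed

lemma I_int_outer:
  assumes z: "z \<in> F1"
  shows "(\<lambda>N. poly (I_int N (ultraspherical \<alpha> N)) z)
        \<sim>[sequentially] (\<lambda>N. (z^2 - 1) powi (int N - int \<alpha>) * z ^ (2*\<alpha>))"
proof -
  define w where "w = \<phi>1 z"
  have "w \<in> E1" using z by (simp add: F1_def w_def)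
  then have w: "1 < cmod w" "1 < cmod (\<phi> w)" by (auto simp: E1_def)
  then have nz: "w \<noteq> 0" "1 + w \<noteq> 0"
    by (fastforce simp: norm_phi)+
  have "(\<lambda>N. w ^ ((N + 1) div 2) * poly (tail_poly \<alpha> N) w * ((1 + w) / w) ^ \<alpha> / (1 + w) ^ N) \<longlonglongrightarrow> 1"
    by (rule tendsto_uniform_limitI[OF tail_poly_outer_uniform_limit[OF w(2)]]) (use w in auto)
  then have "(\<lambda>N. w ^ ((N + 1) div 2) * poly (tail_poly \<alpha> N) w / ((1 + w) ^ N * (w / (1 + w)) ^ \<alpha>)) \<longlonglongrightarrow> 1"
    using nz by (simp add: power_divide mult_ac)
  then have "(\<lambda>N. w ^ ((N + 1) div 2) * poly (tail_poly \<alpha> N) w) \<sim>[sequentially] (\<lambda>N. (1 + w) ^ N * (w / (1 + w)) ^ \<alpha>)"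
    by (rule asymp_equivI')
  from asymp_equiv_mult[OF asymp_equiv_refl this]
  have "(\<lambda>N. (-1) ^ N * (w ^ ((N + 1) div 2) * poly (tail_poly \<alpha> N) w)) \<sim>[sequentially]
     (\<lambda>N. (-1) ^ N * ((1 + w) ^ N * (w / (1 + w)) ^ \<alpha>))" .
  also have "(\<lambda>N. (-1) ^ N * ((1 + w) ^ N * (w / (1 + w)) ^ \<alpha>)) =
     (\<lambda>N. (z^2 - 1) powi (int N - int \<alpha>) * z ^ (2*\<alpha>))"
  proof
    fix N
    have z2: "z^2 - 1 = - (1 + w)" "z ^ (2 * \<alpha>) = (- w) ^ \<alpha>"
      by (simp_all add: w_def \<phi>1_def power_mult)
    have "(- (1 + w)) powi (int N - int \<alpha>) = (- (1 + w)) ^ N / (- (1 + w)) ^ \<alpha>"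
      using nz(2) power_int_diff[of "- (1 + w)" "int N" "int \<alpha>"] by (simp only: power_int_of_nat neg_equal_0_iff_equal) simp
    also have "\<dots> * (- w) ^ \<alpha> = (- (1 + w)) ^ N * ((- w) / (- (1 + w))) ^ \<alpha>"
      by (simp only: power_divide times_divide_eq_left times_divide_eq_right)
    also have "(- w) / (- (1 + w)) = w / (1 + w)" by (rule minus_divide_divide)
    finally show "(-1) ^ N * ((1 + w) ^ N * (w / (1 + w)) ^ \<alpha>) = (z^2 - 1) powi (int N - int \<alpha>) * z ^ (2*\<alpha>)"
      unfolding z2 power_minus[of "1 + w" N] by simp
  qed
  finally show ?thesis unfolding poly_I_int_ultraspherical w_def[symmetric] .
qed

subsection \<open>Location of the zeros\<close>

lemma tail_poly_coeff_0_nz: "coeff (tail_poly \<alpha> N) 0 \<noteq> 0"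
proof -
  have "(N + 1) div 2 \<le> N" by (cases N) auto
  then show ?thesis using gcoef_pos[of "(N + 1) div 2" N \<alpha>] by (simp add: coeff_tail_poly)
qed

lemma tail_poly_nz [simp]: "tail_poly \<alpha> N \<noteq> 0"
  using tail_poly_coeff_0_nz[of \<alpha> N] by auto

lemma zero_notin_proots_tail_poly: "0 \<notin># proots (tail_poly \<alpha> N)"
  using tail_poly_coeff_0_nz[of \<alpha> N] by (simp add: poly_0_coeff_0)

text \<open>Exhibits the union as a closed set. The unit circle adds nothing to it, because |w| = 1
  implies |w + 1|^2 <= 4 = 4 |w|.\<close>

lemma inner_dom_Un_Gamma:
  "inner_dom \<union> \<Gamma> = {w. cmod w \<le> 1} \<union> {w. (cmod (w + 1))\<^sup>2 \<le> 4 * cmod w}"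
proof (intro set_eqI)
  fix w
  have G: "w \<in> \<Gamma> \<longleftrightarrow> (cmod (w + 1))\<^sup>2 = 4 * cmod w \<and> 1 \<le> cmod w"
    by (auto simp: \<Gamma>_def norm_phi add.commute divide_simps split: if_splits)
  have "(cmod (w + 1))\<^sup>2 \<le> 4 * cmod w" if "cmod w = 1"
  proof -
    have "cmod (w + 1) \<le> 2" using norm_triangle_ineq[of w 1] that by simp
    then have "(cmod (w + 1))\<^sup>2 \<le> 2\<^sup>2" by (rule power_mono) simp
    then show ?thesis using that by simp
  qed
  then show "w \<in> inner_dom \<union> \<Gamma> \<longleftrightarrow> w \<in> {w. cmod w \<le> 1} \<union> {w. (cmod (w + 1))\<^sup>2 \<le> 4 * cmod w}"
    unfolding Un_iff G inner_dom_def mem_Collect_eq by linarith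
qed

text \<open>From |1 + w| >= |w| - 1 and (t - 1)^2 >= t^2 - 2t >= 6t for t >= 8. A neighbourhood of
  infinity is thus uniformly outside; this bounds the zeros and later allows inversion with radius
  1/8.\<close>

lemma norm_phi_ge_far:
  assumes "8 \<le> cmod w"
  shows "3 / 2 \<le> cmod (\<phi> w)"
proof -
  have "cmod w - 1 \<le> cmod (1 + w)"
    using norm_triangle_ineq2[of w "-1"] by (simp add: add.commute)
  then have "(cmod w - 1)\<^sup>2 \<le> (cmod (1 + w))\<^sup>2"
    using assms by (intro power_mono) auto
  moreover have "8 * cmod w \<le> cmod w * cmod w" using assms by (intro mult_right_mono) auto
  ultimately have "6 * cmod w \<le> (cmod (1 + w))\<^sup>2"
    by (simp add: power2_eq_square algebra_simps)
  moreover have "0 < 4 * cmod w" using assms by linarith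
  ultimately show ?thesis unfolding norm_phi by (simp add: pos_le_divide_eq)
qed

lemma compact_inner_dom_Un_Gamma: "compact (inner_dom \<union> \<Gamma>)"
proof -
  have "closed (inner_dom \<union> \<Gamma>)"
    unfolding inner_dom_Un_Gamma by (intro closed_Un closed_Collect_le continuous_intros)
  moreover have "cmod w \<le> 8" if "w \<in> inner_dom \<union> \<Gamma>" for w
  proof (rule ccontr)
    assume far: "\<not> cmod w \<le> 8"
    then have "3 / 2 \<le> (cmod (1 + w))\<^sup>2 / (4 * cmod w)"
      using norm_phi_ge_far[of w] by (simp add: norm_phi)
    moreover have "0 < 4 * cmod w" using far by linarith
    ultimately have "6 * cmod w \<le> (cmod (1 + w))\<^sup>2" by (simp add: pos_le_divide_eq)
    then show False using that far
      unfolding inner_dom_Un_Gamma by (simp add: add.commute)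
  qed
  then have "bounded (inner_dom \<union> \<Gamma>)" unfolding bounded_iff by blast
  ultimately show ?thesis by (simp add: compact_eq_bounded_closed)
qed

lemma tail_poly_inner_zero_free:
  assumes K: "compact K" "K \<subseteq> inner_dom"
  shows "\<forall>\<^sub>F N in sequentially. \<forall>w\<in>K. poly (tail_poly \<alpha> N) w \<noteq> 0"
proof -
  obtain R where R: "\<And>w. w \<in> K \<Longrightarrow> cmod w \<le> R" "R \<ge> 0"
    using compact_imp_bounded[OF K(1)] unfolding bounded_iff by (meson norm_ge_zero order.trans linear)
  have "1 / 2 ^ \<alpha> / (1 + R) > 0" using R(2) by simp
  from uniform_limitD[OF tail_poly_uniform_limit[OF K] this]
  show ?thesis
  proof (eventually_elim, intro ballI notI)
    fix N w assume *: "\<forall>w\<in>K. dist (poly (tail_poly \<alpha> N) w / of_nat (N choose (N div 2))) (1 / 2 ^ \<alpha> / (1 - w)) < 1 / 2 ^ \<alpha> / (1 + R)"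
      and w: "w \<in> K" and z: "poly (tail_poly \<alpha> N) w = 0"
    have nz: "1 - w \<noteq> 0" using w K one_notin_inner_dom by auto
    have "cmod (1 - w) \<le> 1 + R"
      using norm_triangle_ineq4[of 1 w] R(1)[OF w] by simp
    then have "1 / 2 ^ \<alpha> / (1 + R) \<le> 1 / 2 ^ \<alpha> / cmod (1 - w)"
      using nz R(2) by (intro divide_left_mono) (auto intro!: mult_pos_pos)
    moreover have "cmod (1 / 2 ^ \<alpha> / (1 - w)) < 1 / 2 ^ \<alpha> / (1 + R)"
      using *[rule_format, OF w] by (simp add: z dist_norm)
    ultimately show False by (simp add: norm_divide norm_power norm_mult)
  qed
qed

lemma tail_poly_outer_zero_free:
  assumes \<rho>: "1 < \<rho>"
  shows "\<forall>\<^sub>F N in sequentially. \<forall>w. 1 \<le> cmod w \<and> \<rho> \<le> cmod (\<phi> w) \<longrightarrow> poly (tail_poly \<alpha> N) w \<noteq> 0"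
  using uniform_limitD[OF tail_poly_outer_uniform_limit[OF \<rho>, of \<alpha>] zero_less_one]
  by eventually_elim auto

text \<open>The complement of G is covered by a compact subset K of \<open>inner_dom\<close>, a
  compact set T on which |\<phi>| exceeds 1 uniformly because T misses \<Gamma>, and a part of the
  region |w| > 8. On each of them the uniform limit has no zeros, so neither do the approximants
  eventually.\<close>

lemma zeros_near_Gamma:
  assumes G: "open G" "\<Gamma> \<subseteq> G"
  shows "\<forall>\<^sub>F N in sequentially. \<forall>\<zeta>. poly (tail_poly \<alpha> N) \<zeta> = 0 \<longrightarrow> \<zeta> \<in> G"
proof -
  define K where "K = (inner_dom \<union> \<Gamma>) - G"
  have K: "compact K" "K \<subseteq> inner_dom"
    using compact_diff[OF compact_inner_dom_Un_Gamma G(1)] G(2) by (auto simp: K_def)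
  define T where "T = {w. 1 \<le> cmod w} \<inter> {w. 4 * cmod w \<le> (cmod (w + 1))\<^sup>2} \<inter> cball 0 8 - G"
  have T: "compact T"
    unfolding T_def by (intro compact_diff closed_Int_compact closed_Int closed_Collect_le continuous_intros compact_cball G)
  obtain \<rho> where \<rho>: "1 < \<rho>" "\<And>w. w \<in> T \<Longrightarrow> \<rho> \<le> cmod (\<phi> w)"
  proof (cases "T = {}")
    case True
    then show ?thesis using that[of 2] by auto
  next
    case False
    have "continuous_on T (\<lambda>w. cmod (\<phi> w))"
      unfolding \<phi>_def by (intro continuous_intros) (auto simp: T_def)
    from continuous_attains_inf[OF T False this]
    obtain w where w: "w \<in> T" "\<forall>v\<in>T. cmod (\<phi> w) \<le> cmod (\<phi> v)" by blast
    have "0 < 4 * cmod w" "4 * cmod w \<le> (cmod (1 + w))\<^sup>2" using w(1) by (auto simp: T_def add.commute)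
    then have "1 \<le> cmod (\<phi> w)" unfolding norm_phi by simp
    moreover have "cmod (\<phi> w) \<noteq> 1" using w(1) G by (auto simp: T_def \<Gamma>_def)
    ultimately show ?thesis using that[of "cmod (\<phi> w)"] w(2) by force
  qed
  have "1 < min \<rho> (3 / 2)" using \<rho>(1) by simp
  from tail_poly_inner_zero_free[OF K, of \<alpha>] tail_poly_outer_zero_free[OF this, of \<alpha>] show ?thesis
  proof eventually_elim
    case (elim N)
    note inner = elim(1) and outer = elim(2)
    show ?case
    proof (intro allI impI, rule ccontr)
      fix \<zeta> assume z: "poly (tail_poly \<alpha> N) \<zeta> = 0" "\<zeta> \<notin> G"
      have "\<zeta> \<notin> inner_dom \<union> \<Gamma>" using inner z by (auto simp: K_def)
      then have out: "1 < cmod \<zeta>" "4 * cmod \<zeta> < (cmod (\<zeta> + 1))\<^sup>2" unfolding inner_dom_Un_Gamma by auto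
      have "min \<rho> (3 / 2) \<le> cmod (\<phi> \<zeta>)"
      proof (cases "cmod \<zeta> \<le> 8")
        case True
        then have "\<zeta> \<in> T" using out z(2) by (auto simp: T_def)
        then show ?thesis using \<rho>(2) by fastforce
      next
        case False
        then show ?thesis using norm_phi_ge_far[of \<zeta>] by simp
      qed
      then show False using outer z(1) out by auto
    qed
  qed
qed

subsection \<open>Power sums of the zeros\<close>

lemma higher_deriv_simple_pole:
  "z \<noteq> a \<Longrightarrow> (deriv ^^ j) (\<lambda>z. 1 / (z - a)) z = (-1) ^ j * fact j / (z - a) ^ (j + 1)" for z a :: complex
proof (induction j arbitrary: z)
  case (Suc j)
  have "(deriv ^^ Suc j) (\<lambda>z. 1 / (z - a)) z = deriv ((deriv ^^ j) (\<lambda>z. 1 / (z - a))) z" by simp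
  also have "\<dots> = deriv (\<lambda>z. (-1) ^ j * fact j / (z - a) ^ (j + 1)) z"
  proof (rule deriv_cong_ev[OF _ refl])
    have "eventually (\<lambda>x. x \<in> - {a}) (nhds z)"
      using Suc.prems by (intro eventually_nhds_in_open) auto
    then show "eventually (\<lambda>x. (deriv ^^ j) (\<lambda>z. 1 / (z - a)) x = (-1) ^ j * fact j / (x - a) ^ (j + 1)) (nhds z)"
      by eventually_elim (use Suc.IH in auto)
  qed
  also have "\<dots> = (-1) ^ Suc j * fact (Suc j) / (z - a) ^ (Suc j + 1)"
  proof (rule DERIV_imp_deriv)
    have w: "z - a \<noteq> 0" using Suc.prems by simp
    have "((\<lambda>z. (z - a) ^ (j + 1)) has_field_derivative of_nat (j + 1) * (1 * (z - a) ^ (j + 1 - Suc 0))) (at z)"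
      by (intro DERIV_power) (auto intro!: derivative_eq_intros)
    from DERIV_divide[OF DERIV_const this, of "(-1) ^ j * fact j"]
    have "((\<lambda>z. (-1) ^ j * fact j / (z - a) ^ (j + 1)) has_field_derivative
       (0 * (z - a) ^ (j + 1) - (-1) ^ j * fact j * (of_nat (j + 1) * (1 * (z - a) ^ (j + 1 - Suc 0))))
         / ((z - a) ^ (j + 1) * (z - a) ^ (j + 1))) (at z)"
      using w by simp
    moreover have gen: "(0 * (w * P) - s * f * (n * (1 * P))) / ((w * P) * (w * P)) = (- s) * (n * f) / (w * (w * P))"
      if "w \<noteq> 0" "P \<noteq> 0" for w P s f n :: complex using that by (simp add: field_simps)
    have "(0 * (z - a) ^ (j + 1) - (-1) ^ j * fact j * (of_nat (j + 1) * (1 * (z - a) ^ (j + 1 - Suc 0))))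
         / ((z - a) ^ (j + 1) * (z - a) ^ (j + 1)) = (-1) ^ Suc j * fact (Suc j) / (z - a) ^ (Suc j + 1)"
      using gen[OF w, of "(z - a) ^ j" "(-1) ^ j" "fact j" "of_nat (j + 1)"] w by simp
    ultimately show "((\<lambda>z. (-1) ^ j * fact j / (z - a) ^ (j + 1)) has_field_derivative
        (-1) ^ Suc j * fact (Suc j) / (z - a) ^ (Suc j + 1)) (at z)" by simp
  qed
  finally show ?case .
qed simp

text \<open>Reads off power sums of reciprocal zeros from a logarithmic derivative at 0. Holomorphy
  is carried along because the induction adds higher derivatives.\<close>

lemma higher_deriv_simple_pole_sum:
  assumes "\<And>x. x \<in># A \<Longrightarrow> s \<le> cmod x" "0 < s"
  shows "(\<lambda>z. \<Sum>x\<in>#A. 1 / (z - x)) holomorphic_on ball 0 s \<and>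
    (deriv ^^ j) (\<lambda>z. \<Sum>x\<in>#A. 1 / (z - x)) 0 = - fact j * (\<Sum>x\<in>#A. (1 / x) ^ (j + 1))"
  using assms(1)
proof (induction A)
  case empty
  show ?case by simp
next
  case (add x A)
  have x: "s \<le> cmod x" "x \<noteq> 0" using add.prems assms(2) by force+
  have h: "(\<lambda>z. 1 / (z - x)) holomorphic_on ball 0 s"
    by (intro holomorphic_intros) (use x in auto)
  have IH: "(\<lambda>z. \<Sum>x\<in>#A. 1 / (z - x)) holomorphic_on ball 0 s"
    "(deriv ^^ j) (\<lambda>z. \<Sum>x\<in>#A. 1 / (z - x)) 0 = - fact j * (\<Sum>x\<in>#A. (1 / x) ^ (j + 1))"
    using add.IH add.prems by auto
  have "(deriv ^^ j) (\<lambda>z. 1 / (z - x) + (\<Sum>x\<in>#A. 1 / (z - x))) 0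
     = (deriv ^^ j) (\<lambda>z. 1 / (z - x)) 0 + (deriv ^^ j) (\<lambda>z. \<Sum>x\<in>#A. 1 / (z - x)) 0"
    using assms(2) by (intro higher_deriv_add[OF h IH(1)]) auto
  also have "(deriv ^^ j) (\<lambda>z. 1 / (z - x)) 0 = - fact j * (1 / x) ^ (j + 1)"
    using x(2) higher_deriv_simple_pole[of 0 x j] by (simp add: power_minus[of x] power_divide divide_simps)
  finally show ?case
    using holomorphic_on_add[OF h IH(1)] by (simp add: IH(2) algebra_simps)
qed

lemma poly_pderiv_prod_mset:
  fixes z :: complex
  assumes "z \<notin># A"
  shows "poly (pderiv (\<Prod>x\<in>#A. [:-x, 1:])) z = poly (\<Prod>x\<in>#A. [:-x, 1:]) z * (\<Sum>x\<in>#A. 1 / (z - x))"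
  using assms
proof (induction A)
  case (add x A)
  define P where "P = (\<Prod>x\<in>#A. [:-x, 1:])"
  have "poly (pderiv (\<Prod>x\<in>#add_mset x A. [:-x, 1:])) z = poly (pderiv ([:-x, 1:] * P)) z"
    by (simp only: P_def image_mset_add_mset prod_mset.add_mset)
  also have "\<dots> = poly P z + (z - x) * poly (pderiv P) z"
    unfolding pderiv_mult by (simp add: pderiv_pCons algebra_simps)
  also have "poly (pderiv P) z = poly P z * (\<Sum>x\<in>#A. 1 / (z - x))"
    unfolding P_def using add by auto
  also have "poly P z + (z - x) * (poly P z * (\<Sum>x\<in>#A. 1 / (z - x)))
      = ((z - x) * poly P z) * (1 / (z - x) + (\<Sum>x\<in>#A. 1 / (z - x)))"
    using add.prems by (simp add: distrib_left)
  also have "(z - x) * poly P z = poly (\<Prod>x\<in>#add_mset x A. [:-x, 1:]) z"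
    by (simp only: P_def image_mset_add_mset prod_mset.add_mset poly_mult) simp
  finally show ?case by simp
qed simp

lemma poly_pderiv_eq_sum_roots:
  fixes p :: "complex poly"
  assumes "poly p z \<noteq> 0"
  shows "poly (pderiv p) z / poly p z = (\<Sum>x\<in>#proots p. 1 / (z - x))"
proof -
  have p0: "p \<noteq> 0" using assms by auto
  have z: "z \<notin># proots p" using assms p0 by simp
  define P where "P = (\<Prod>x\<in>#proots p. [:-x, 1:])"
  have p: "p = smult (lead_coeff p) P" unfolding P_def by (rule complex_poly_decompose_multiset[symmetric])
  have "poly (pderiv p) z = lead_coeff p * poly (pderiv P) z" by (subst p) (simp add: pderiv_smult)
  also have "poly (pderiv P) z = poly P z * (\<Sum>x\<in>#proots p. 1 / (z - x))"
    unfolding P_def using z by (rule poly_pderiv_prod_mset)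
  also have "lead_coeff p * (poly P z * (\<Sum>x\<in>#proots p. 1 / (z - x))) = poly p z * (\<Sum>x\<in>#proots p. 1 / (z - x))"
    by (subst (4) p) simp
  finally show ?thesis using assms by simp
qed

text \<open>Write p = c q (1 + z)^e with |q| between \<delta> and M. Then p'/p - e / (1 + z) = q'/q
  is bounded by Cauchy's estimate, so after division by d only L / (1 + z) survives, and its Taylor
  coefficients give the limits.\<close>

lemma reciprocal_power_sum_tendsto:
  fixes p :: "nat \<Rightarrow> complex poly" and d e :: "nat \<Rightarrow> nat"
  assumes bounds: "\<forall>\<^sub>F N in sequentially. \<forall>z\<in>ball 0 r.
      \<delta> \<le> cmod (poly (p N) z / (c N * (1 + z) ^ e N)) \<and> cmod (poly (p N) z / (c N * (1 + z) ^ e N)) \<le> M"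
    and r: "0 < r" "r \<le> 1" and \<delta>: "0 < \<delta>"
    and d: "filterlim d at_top sequentially"
    and e: "(\<lambda>N. real (e N) / real (d N)) \<longlonglongrightarrow> L"
  shows "(\<lambda>N. (\<Sum>x\<in>#proots (p N). (1 / x) ^ (j + 1)) / of_nat (d N)) \<longlonglongrightarrow> of_real L * (-1) ^ (j + 1)"
proof -
  define F where "F N z = (\<Sum>x\<in>#proots (p N). 1 / (z - x)) / of_nat (d N)" for N z
  define H where "H z = of_real L / (1 + z)" for z :: complex
  \<comment> \<open>Cauchy's estimate on discs of radius r/2 centred in \<open>ball 0 (r/2)\<close>,
    which stay in \<open>ball 0 r\<close>, divided by the lower bound of |q|.\<close>
  define B where "B = M / (r / 2) / \<delta>"
  have good: "\<forall>\<^sub>F N in sequentially. (\<forall>x\<in>#proots (p N). r \<le> cmod x) \<and>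
      (\<forall>z\<in>ball 0 (r/2). dist (F N z) (H z) \<le> B / real (d N) + \<bar>real (e N) / real (d N) - L\<bar> * 2)"
    using bounds
  proof eventually_elim
    case (elim N)
    define q where "q z = poly (p N) z / (c N * (1 + z) ^ e N)" for z
    have q: "\<delta> \<le> cmod (q z)" "cmod (q z) \<le> M" if "z \<in> ball 0 r" for z
      using elim that by (auto simp: q_def)
    \<comment> \<open>As x / 0 = 0, the positive lower bound on |q| excludes zeros of p as well as c
      = 0.\<close>
    have nz: "poly (p N) z \<noteq> 0" "c N \<noteq> 0" if "z \<in> ball 0 r" for z
      using q(1)[OF that] \<delta> by (auto simp: q_def)
    have c0: "c N \<noteq> 0" using nz(2)[of 0] r by simp
    have p0: "p N \<noteq> 0" using nz(1)[of 0] r by auto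
    have z1: "1 + z \<noteq> 0" if "z \<in> ball 0 r" for z :: complex
      using that r by (auto simp: add_eq_0_iff)
    have roots: "\<forall>x\<in>#proots (p N). r \<le> cmod x"
      using nz(1) p0 by force
    have holq: "q holomorphic_on ball 0 r"
      unfolding q_def by (intro holomorphic_intros) (use z1 c0 in auto)
    have "dist (F N z) (H z) \<le> B / real (d N) + \<bar>real (e N) / real (d N) - L\<bar> * 2" if z: "z \<in> ball 0 (r/2)" for z
    proof -
      have zr: "z \<in> ball 0 r" using z r by auto
      have sub: "cball z (r/2) \<subseteq> ball 0 r"
      proof
        fix x assume "x \<in> cball z (r/2)"
        then have "cmod (x - z) \<le> r/2" by (simp add: dist_norm norm_minus_commute)
        then show "x \<in> ball 0 r" using z norm_triangle_ineq[of "x - z" z] by simp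
      qed
      have "cmod ((deriv ^^ 1) q z) \<le> fact 1 * M / (r/2) ^ 1"
      proof (rule Cauchy_inequality)
        show "q holomorphic_on ball z (r/2)" using holq sub ball_subset_cball by (metis holomorphic_on_subset order.trans)
        show "continuous_on (cball z (r/2)) q"
          using holq sub by (metis holomorphic_on_imp_continuous_on continuous_on_subset)
        fix x assume "cmod (z - x) = r/2"
        then have "x \<in> cball z (r/2)" by (simp add: dist_norm)
        then show "cmod (q x) \<le> M" using sub q(2) by blast
      qed (use r in auto)
      then have dq: "cmod (deriv q z) \<le> M / (r/2)" by simp
      have "(q has_field_derivative (poly (pderiv (p N)) z * (c N * (1 + z) ^ e N)
           - poly (p N) z * (c N * (of_nat (e N) * (1 + z) ^ (e N - 1)))) / ((c N * (1 + z) ^ e N) * (c N * (1 + z) ^ e N))) (at z)"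
        unfolding q_def using z1[OF zr] c0
        by (auto intro!: derivative_eq_intros poly_DERIV simp: mult_ac)
      then have "deriv q z = (poly (pderiv (p N)) z * (c N * (1 + z) ^ e N)
           - poly (p N) z * (c N * (of_nat (e N) * (1 + z) ^ (e N - 1)))) / ((c N * (1 + z) ^ e N) * (c N * (1 + z) ^ e N))"
        by (rule DERIV_imp_deriv)
      also have "\<dots> = q z * (poly (pderiv (p N)) z / poly (p N) z - of_nat (e N) / (1 + z))"
      proof -
        have gen: "(p' * (a * Y) - p * (a * (n * (Y / y)))) / ((a * Y) * (a * Y)) = p / (a * Y) * (p' / p - n / y)"
          if "a \<noteq> 0" "Y \<noteq> 0" "p \<noteq> 0" "y \<noteq> 0" for a Y p p' n y :: complex
          using that by (simp add: field_simps)
        have "of_nat (e N) * (1 + z) ^ (e N - 1) = of_nat (e N) * ((1 + z) ^ e N / (1 + z))"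
          using z1[OF zr] by (cases "e N") auto
        then show ?thesis
          unfolding q_def using z1[OF zr] c0 nz(1)[OF zr] by (simp only:) (rule gen, auto)
      qed
      finally have "cmod (q z) * cmod (poly (pderiv (p N)) z / poly (p N) z - of_nat (e N) / (1 + z)) \<le> M / (r/2)"
        using dq by (simp add: norm_mult)
      moreover have "\<delta> * cmod (poly (pderiv (p N)) z / poly (p N) z - of_nat (e N) / (1 + z))
        \<le> cmod (q z) * cmod (poly (pderiv (p N)) z / poly (p N) z - of_nat (e N) / (1 + z))"
        using q(1)[OF zr] by (intro mult_right_mono) auto
      ultimately have "\<delta> * cmod (poly (pderiv (p N)) z / poly (p N) z - of_nat (e N) / (1 + z)) \<le> M / (r/2)"
        by linarith
      then have "cmod (poly (pderiv (p N)) z / poly (p N) z - of_nat (e N) / (1 + z)) \<le> B"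
        unfolding B_def using \<delta> by (simp only: pos_le_divide_eq mult.commute)
      then have 1: "cmod ((\<Sum>x\<in>#proots (p N). 1 / (z - x)) - of_nat (e N) / (1 + z)) \<le> B"
        by (simp only: poly_pderiv_eq_sum_roots[OF nz(1)[OF zr]])
      have half: "1/2 \<le> cmod (1 + z)"
        using z r norm_triangle_ineq2[of 1 "- z"] by simp
      have "F N z - H z = ((\<Sum>x\<in>#proots (p N). 1 / (z - x)) - of_nat (e N) / (1 + z)) / of_nat (d N)
          + of_real (real (e N) / real (d N) - L) / (1 + z)"
        by (simp add: F_def H_def diff_divide_distrib)
      also have "cmod \<dots> \<le> B / real (d N) + \<bar>real (e N) / real (d N) - L\<bar> * 2"
      proof (intro order.trans[OF norm_triangle_ineq] add_mono)
        show "cmod (((\<Sum>x\<in>#proots (p N). 1 / (z - x)) - of_nat (e N) / (1 + z)) / of_nat (d N)) \<le> B / real (d N)"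
          unfolding norm_divide[of _ "of_nat (d N)"] norm_of_nat using 1 by (rule divide_right_mono) simp
        have "cmod (of_real (real (e N) / real (d N) - L) / (1 + z)) = \<bar>real (e N) / real (d N) - L\<bar> / cmod (1 + z)"
          by (simp only: norm_divide norm_of_real)
        also have "\<dots> \<le> \<bar>real (e N) / real (d N) - L\<bar> / (1/2)"
          using half by (intro divide_left_mono) auto
        finally show "cmod (of_real (real (e N) / real (d N) - L) / (1 + z)) \<le> \<bar>real (e N) / real (d N) - L\<bar> * 2" by simp
      qed
      finally show ?thesis by (simp only: dist_norm)
    qed
    with roots show ?case by blast
  qed
  have ul: "uniform_limit (ball 0 (r/2)) F H sequentially"
  proof (rule uniform_limit_dominated)
    show "\<forall>\<^sub>F N in sequentially. \<forall>z\<in>ball 0 (r/2). dist (F N z) (H z) \<le> B / real (d N) + \<bar>real (e N) / real (d N) - L\<bar> * 2"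
      using good by eventually_elim blast
    have "(\<lambda>N. B / real (d N)) \<longlonglongrightarrow> 0"
      by (intro tendsto_divide_0[OF tendsto_const] filterlim_at_top_imp_at_infinity filterlim_compose[OF filterlim_real_sequentially d])
    moreover have "(\<lambda>N. \<bar>real (e N) / real (d N) - L\<bar> * 2) \<longlonglongrightarrow> \<bar>L - L\<bar> * 2"
      by (intro tendsto_intros e)
    ultimately have "(\<lambda>N. B / real (d N) + \<bar>real (e N) / real (d N) - L\<bar> * 2) \<longlonglongrightarrow> 0 + \<bar>L - L\<bar> * 2"
      by (rule tendsto_add)
    then show "(\<lambda>N. B / real (d N) + \<bar>real (e N) / real (d N) - L\<bar> * 2) \<longlonglongrightarrow> 0" by simp
  qed
  have F: "F N holomorphic_on ball 0 (r/2)"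
    "(deriv ^^ j) (F N) 0 = - fact j * ((\<Sum>x\<in>#proots (p N). (1 / x) ^ (j + 1)) / of_nat (d N))"
    if roots: "\<forall>x\<in>#proots (p N). r \<le> cmod x" for N
  proof -
    have *: "(\<lambda>z. \<Sum>x\<in>#proots (p N). 1 / (z - x)) holomorphic_on ball 0 r"
      "(deriv ^^ j) (\<lambda>z. \<Sum>x\<in>#proots (p N). 1 / (z - x)) 0 = - fact j * (\<Sum>x\<in>#proots (p N). (1 / x) ^ (j + 1))"
      using higher_deriv_simple_pole_sum[of "proots (p N)" r j] roots r by auto
    have F_eq: "F N = (\<lambda>z. (1 / of_nat (d N)) * (\<Sum>x\<in>#proots (p N). 1 / (z - x)))"
      by (simp add: F_def[abs_def])
    show "F N holomorphic_on ball 0 (r/2)"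
      unfolding F_eq by (intro holomorphic_on_mult holomorphic_on_const holomorphic_on_subset[OF *(1)]) (use r in auto)
    show "(deriv ^^ j) (F N) 0 = - fact j * ((\<Sum>x\<in>#proots (p N). (1 / x) ^ (j + 1)) / of_nat (d N))"
      unfolding F_eq using r by (subst higher_deriv_cmult[OF *(1)]) (auto simp: *(2))
  qed
  have "(\<lambda>N. (deriv ^^ j) (F N) 0) \<longlonglongrightarrow> (deriv ^^ j) H 0"
    using ul
  proof (rule higher_deriv_complex_uniform_limit)
    show "\<forall>\<^sub>F N in sequentially. F N holomorphic_on ball 0 (r/2)"
      using good by eventually_elim (use F(1) in blast)
  qed (use r in auto)
  moreover have "(deriv ^^ j) H 0 = of_real L * ((-1) ^ j * fact j)"
  proof -
    have "(\<lambda>z. 1 / (z - (-1))) holomorphic_on ball (0::complex) 1"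
      by (intro holomorphic_intros) (auto simp: add_eq_0_iff dest: arg_cong[of _ _ cmod])
    then have "(deriv ^^ j) (\<lambda>z :: complex. of_real L * (1 / (z - (-1)))) 0 = of_real L * (deriv ^^ j) (\<lambda>z. 1 / (z - (-1))) 0"
      by (intro higher_deriv_cmult) auto
    also have "(\<lambda>z. of_real L * (1 / (z - (-1)))) = H" by (auto simp: H_def add.commute)
    finally show ?thesis using higher_deriv_simple_pole[of 0 "-1" j] by simp
  qed
  ultimately have "(\<lambda>N. (deriv ^^ j) (F N) 0) \<longlonglongrightarrow> of_real L * ((-1) ^ j * fact j)" by simp
  then have "(\<lambda>N. (deriv ^^ j) (F N) 0 / (- fact j)) \<longlonglongrightarrow> of_real L * ((-1) ^ j * fact j) / (- fact j)"
    by (intro tendsto_divide tendsto_const) auto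
  moreover have "of_real L * ((-1) ^ j * fact j) / (- fact j) = (of_real L * (-1) ^ (j + 1) :: complex)" by simp
  moreover have "\<forall>\<^sub>F N in sequentially. (deriv ^^ j) (F N) 0 / (- fact j)
      = (\<Sum>x\<in>#proots (p N). (1 / x) ^ (j + 1)) / of_nat (d N)"
    using good by eventually_elim (use F(2) in auto)
  ultimately show ?thesis by (simp only:) (rule Lim_transform_eventually)
qed

text \<open>Near 0 the tail divided by its lowest coefficient tends to 1 / (2^\<alpha> (1 - z)), of
  modulus between 2 \<delta> and 8 \<delta> on the disc of radius 1/2; an error below \<delta> gives
  the bounds \<delta> and 9 \<delta>. There is no factor 1 + z to a growing power, hence the limit
  0.\<close>

lemma negative_power_sum_tendsto:
  "(\<lambda>N. (\<Sum>x\<in>#proots (tail_poly \<alpha> N). (1 / x) ^ (j + 1)) / of_nat (N div 2)) \<longlonglongrightarrow> 0"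
proof -
  define \<delta> where "\<delta> = 1 / 2 ^ \<alpha> / (4 :: real)"
  have \<delta>: "\<delta> > 0" by (simp add: \<delta>_def)
  have "(\<lambda>N. (\<Sum>x\<in>#proots (tail_poly \<alpha> N). (1 / x) ^ (j + 1)) / of_nat (N div 2)) \<longlonglongrightarrow> of_real 0 * (-1) ^ (j + 1)"
  proof (rule reciprocal_power_sum_tendsto[where r = "1/2" and \<delta> = \<delta> and M = "9 * \<delta>"
      and e = "\<lambda>_. 0" and c = "\<lambda>N. of_nat (N choose (N div 2))"])
    have sub: "cball 0 (1/2) \<subseteq> inner_dom" by (auto simp: inner_dom_def)
    have l: "2 * \<delta> \<le> cmod (1 / 2 ^ \<alpha> / (1 - z))" "cmod (1 / 2 ^ \<alpha> / (1 - z)) \<le> 8 * \<delta>" if "cmod z \<le> 1/2" for z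
    proof -
      have *: "1/2 \<le> cmod (1 - z)" "cmod (1 - z) \<le> 2"
        using that norm_triangle_ineq2[of 1 z] norm_triangle_ineq4[of 1 z] by auto
      then have "z \<noteq> 1" by auto
      have eq: "cmod (1 / 2 ^ \<alpha> / (1 - z)) = 4 * \<delta> / cmod (1 - z)"
        by (simp add: \<delta>_def norm_divide norm_mult norm_power)
      show "2 * \<delta> \<le> cmod (1 / 2 ^ \<alpha> / (1 - z))" "cmod (1 / 2 ^ \<alpha> / (1 - z)) \<le> 8 * \<delta>"
        unfolding eq using divide_left_mono[OF *(2), of "4 * \<delta>"] divide_left_mono[OF *(1), of "4 * \<delta>"] * \<delta> \<open>z \<noteq> 1\<close>
        by (auto simp: zero_less_mult_iff)
    qed
    from uniform_limitD[OF tail_poly_uniform_limit[OF compact_cball sub, of \<alpha>] \<delta>]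
    show "\<forall>\<^sub>F N in sequentially. \<forall>z\<in>ball 0 (1/2).
      \<delta> \<le> cmod (poly (tail_poly \<alpha> N) z / (of_nat (N choose (N div 2)) * (1 + z) ^ 0)) \<and>
      cmod (poly (tail_poly \<alpha> N) z / (of_nat (N choose (N div 2)) * (1 + z) ^ 0)) \<le> 9 * \<delta>"
    proof eventually_elim
      case (elim N)
      show ?case
      proof
        fix z :: complex assume z: "z \<in> ball 0 (1/2)"
        define f where "f = poly (tail_poly \<alpha> N) z / of_nat (N choose (N div 2))"
        have "cmod (f - 1 / 2 ^ \<alpha> / (1 - z)) < \<delta>"
          using elim z by (simp add: f_def dist_norm)
        then have "\<delta> \<le> cmod f \<and> cmod f \<le> 9 * \<delta>"
          using l[of z] z norm_triangle_ineq2[of f "1 / 2 ^ \<alpha> / (1 - z)"] norm_triangle_ineq3[of f "1 / 2 ^ \<alpha> / (1 - z)"] by auto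
        then show "\<delta> \<le> cmod (poly (tail_poly \<alpha> N) z / (of_nat (N choose (N div 2)) * (1 + z) ^ 0)) \<and>
           cmod (poly (tail_poly \<alpha> N) z / (of_nat (N choose (N div 2)) * (1 + z) ^ 0)) \<le> 9 * \<delta>"
          by (simp add: f_def)
      qed
    qed
  qed (use \<delta> filterlim_half in auto)
  then show ?thesis by simp
qed

section \<open>Power sums with positive exponents, through the reversed polynomial\<close>

lemma proots_reflect_prod_mset:
  fixes A :: "complex multiset"
  assumes "0 \<notin># A"
  shows "proots (reflect_poly (\<Prod>x\<in>#A. [:-x, 1:])) = image_mset inverse A"
  using assms
proof (induction A)
  case (add x A)
  let ?P = "\<Prod>x\<in>#A. [:-x, 1:]"
  have x: "x \<noteq> 0" using add.prems by auto
  have "reflect_poly [:-x, 1:] = smult (-x) [:- inverse x, 1:]"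
    using x by (simp add: reflect_poly_def)
  then have "reflect_poly ([:-x, 1:] * ?P) = smult (-x) ([:- inverse x, 1:] * reflect_poly ?P)"
    by (simp only: reflect_poly_mult mult_smult_left)
  moreover have "reflect_poly ?P \<noteq> 0"
    by (auto simp: prod_mset_zero_iff)
  ultimately show ?case
    using add x by (simp add: proots_mult del: mult_pCons_left)
qed simp

lemma proots_reflect_poly:
  fixes p :: "complex poly"
  assumes "coeff p 0 \<noteq> 0"
  shows "proots (reflect_poly p) = image_mset inverse (proots p)"
proof -
  have p0: "p \<noteq> 0" using assms by auto
  have "0 \<notin># proots p" using assms p0 by (simp add: poly_0_coeff_0)
  then have "proots (reflect_poly (\<Prod>x\<in>#proots p. [:-x, 1:])) = image_mset inverse (proots p)"
    by (rule proots_reflect_prod_mset)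
  moreover have "reflect_poly p = smult (lead_coeff p) (reflect_poly (\<Prod>x\<in>#proots p. [:-x, 1:]))"
    by (subst complex_poly_decompose_multiset[symmetric]) (rule reflect_poly_smult)
  ultimately show ?thesis using p0 by simp
qed

lemma half_ratio_tendsto: "(\<lambda>N. real N / real (N div 2)) \<longlonglongrightarrow> 2"
proof (rule tendsto_sandwich)
  show "\<forall>\<^sub>F N in sequentially. 2 \<le> real N / real (N div 2)"
    using eventually_ge_at_top[of 2]
  proof eventually_elim
    case (elim N)
    have "2 * real (N div 2) = real (2 * (N div 2))" by simp
    also have "\<dots> \<le> real N" by (subst of_nat_le_iff) simp
    finally show ?case using elim by (simp add: pos_le_divide_eq)
  qed
  show "\<forall>\<^sub>F N in sequentially. real N / real (N div 2) \<le> 2 + 1 / real (N div 2)"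
    using eventually_ge_at_top[of 2]
  proof eventually_elim
    case (elim N)
    have "real N \<le> real (2 * (N div 2) + 1)" by (subst of_nat_le_iff) simp
    also have "\<dots> = 2 * real (N div 2) + 1" by simp
    finally show ?case using elim by (simp add: divide_simps)
  qed
  have "(\<lambda>n. 2 + 1 / real n) \<longlonglongrightarrow> 2" by real_asymp
  from filterlim_compose[OF this filterlim_half]
  show "(\<lambda>N. 2 + 1 / real (N div 2)) \<longlonglongrightarrow> 2" .
qed simp

text \<open>The reversed polynomial has the reciprocal zeros and behaves near 0 like (1 + u)^(N -
  \<alpha>). With e = N and d = N div 2 the ratio tends to L = 2; the shift by \<alpha> is absorbed
  into the bounds.\<close>

lemma positive_power_sum_tendsto:
  "(\<lambda>N. (\<Sum>x\<in>#proots (tail_poly \<alpha> N). x ^ (j + 1)) / of_nat (N div 2)) \<longlonglongrightarrow> 2 * (-1) ^ (j + 1)"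
proof -
  let ?R = "\<lambda>N. reflect_poly (tail_poly \<alpha> N)"
  have "(\<lambda>N. (\<Sum>x\<in>#proots (?R N). (1 / x) ^ (j + 1)) / of_nat (N div 2)) \<longlonglongrightarrow> of_real 2 * (-1) ^ (j + 1)"
  proof (rule reciprocal_power_sum_tendsto[where r = "1/8" and \<delta> = "1/2 * (1/2) ^ \<alpha>" and M = "2 * 2 ^ \<alpha>"
      and e = "\<lambda>N. N" and c = "\<lambda>N. 1"])
    have "1 < (3/2 :: real)" "1/2 > (0::real)" by simp_all
    from uniform_limitD[OF tail_poly_outer_uniform_limit[OF this(1), of \<alpha>] this(2)]
    show "\<forall>\<^sub>F N in sequentially. \<forall>u\<in>ball 0 (1/8).
      1/2 * (1/2) ^ \<alpha> \<le> cmod (poly (?R N) u / (1 * (1 + u) ^ N)) \<and>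
      cmod (poly (?R N) u / (1 * (1 + u) ^ N)) \<le> 2 * 2 ^ \<alpha>"
    proof eventually_elim
      case (elim N)
      show ?case
      proof
        fix u :: complex assume u: "u \<in> ball 0 (1/8)"
        show "1/2 * (1/2) ^ \<alpha> \<le> cmod (poly (?R N) u / (1 * (1 + u) ^ N)) \<and>
           cmod (poly (?R N) u / (1 * (1 + u) ^ N)) \<le> 2 * 2 ^ \<alpha>"
        proof (cases "u = 0")
          case True
          have "(N + 1) div 2 + N div 2 = N" by linarith
          then have "poly (?R N) u = 1"
            using True by (simp add: poly_reflect_poly_0 degree_tail_poly coeff_tail_poly)
          moreover have "1/2 * (1/2) ^ \<alpha> \<le> (1::real)" using power_le_one[of "1/2 :: real" \<alpha>] by linarith
          moreover have "1 \<le> 2 * (2::real) ^ \<alpha>" using one_le_power[of "2::real" \<alpha>] by linarith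
          ultimately show ?thesis using True by simp
        next
          case False
          define w where "w = inverse u"
          have w: "cmod w \<ge> 8" proof -
            have "cmod w = inverse (cmod u)" by (simp only: w_def norm_inverse)
            then show ?thesis using u False le_imp_inverse_le[of "cmod u" "1/8"] by simp
          qed
          have wu: "u = inverse w" "w \<noteq> 0" using False by (simp_all add: w_def)
          have w1: "1 + w \<noteq> 0" using w by (auto simp: add_eq_0_iff)
          have u1: "1 + u = (1 + w) / w" using wu(2) by (simp add: wu(1) field_simps)
          define q where "q = poly (?R N) u / (1 * (1 + u) ^ N)"
          have N: "(N + 1) div 2 + N div 2 = N" by linarith
          have "poly (?R N) u = u ^ (N div 2) * poly (tail_poly \<alpha> N) w"
            using False by (simp add: poly_reflect_poly_nz degree_tail_poly w_def)
          also have "u ^ (N div 2) = w ^ ((N + 1) div 2) / w ^ N"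
          proof -
            have "w ^ N = w ^ ((N + 1) div 2) * w ^ (N div 2)" by (simp only: N flip: power_add)
            then show ?thesis using wu(2) by (simp add: wu(1) power_inverse divide_simps)
          qed
          finally have "q * ((1 + w) / w) ^ \<alpha> =
              w ^ ((N + 1) div 2) * poly (tail_poly \<alpha> N) w * ((1 + w) / w) ^ \<alpha> / (1 + w) ^ N"
            unfolding q_def u1 using wu(2) w1 by (simp add: power_divide[of _ _ N])
          moreover have "1 \<le> cmod w" "3/2 \<le> cmod (\<phi> w)" using w norm_phi_ge_far by auto
          ultimately have near: "cmod (q * (1 + u) ^ \<alpha> - 1) < 1/2"
            using elim by (auto simp: dist_norm u1)
          then have low: "1/2 \<le> cmod (q * (1 + u) ^ \<alpha>)" and up: "cmod (q * (1 + u) ^ \<alpha>) \<le> 2"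
            using norm_triangle_ineq2[of 1 "q * (1 + u) ^ \<alpha>"] norm_triangle_ineq2[of "q * (1 + u) ^ \<alpha>" 1]
            by (auto simp: norm_minus_commute)
          have "1/2 \<le> cmod (1 + u)" "cmod (1 + u) \<le> 2"
            using u norm_triangle_ineq[of 1 u] norm_triangle_ineq2[of 1 "- u"] by auto
          then have b: "(1/2) ^ \<alpha> \<le> cmod (1 + u) ^ \<alpha>" "cmod (1 + u) ^ \<alpha> \<le> 2 ^ \<alpha>"
            by (auto intro: power_mono)
          have "1/2 \<le> cmod q * 2 ^ \<alpha>"
            using low mult_left_mono[OF b(2), of "cmod q"] by (simp add: norm_mult norm_power)
          then have "1/2 * (1/2) ^ \<alpha> \<le> cmod q" by (simp add: power_divide field_simps)
          moreover have "cmod q * (1/2) ^ \<alpha> \<le> 2"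
            using up mult_left_mono[OF b(1), of "cmod q"] by (simp add: norm_mult norm_power)
          then have "cmod q \<le> 2 * 2 ^ \<alpha>" by (simp add: power_divide field_simps)
          ultimately show ?thesis by (simp add: q_def)
        qed
      qed
    qed
  qed (use filterlim_half half_ratio_tendsto in auto)
  moreover have "(\<Sum>x\<in>#proots (?R N). (1 / x) ^ (j + 1)) = (\<Sum>x\<in>#proots (tail_poly \<alpha> N). x ^ (j + 1))" for N
    unfolding proots_reflect_poly[OF tail_poly_coeff_0_nz]
    by (simp only: image_mset.compositionality o_def inverse_eq_divide divide_divide_eq_right mult_1 div_by_1)
  ultimately show ?thesis by (simp only:) simp
qed

text \<open>The quotient of powers encodes the integer exponent i - k in the shape in which the
  expansion of \<open>\<phi> x ^ k\<close> produces it.\<close>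

lemma laurent_power_sum_tendsto:
  "(\<lambda>N. (\<Sum>x\<in>#proots (tail_poly \<alpha> N). x ^ i / x ^ k) / of_nat (N div 2)) \<longlonglongrightarrow>
     (if i = k then 1 else if k < i then 2 * ((-1) ^ i * (-1) ^ k) else 0)"
proof -
  have nz: "x \<noteq> 0" if "x \<in># proots (tail_poly \<alpha> N)" for x N
    using that zero_notin_proots_tail_poly[of \<alpha> N] by metis
  consider "i = k" | j where "i = k + (j + 1)" | j where "k = i + (j + 1)"
    by (metis add.assoc add.commute less_imp_Suc_add linorder_neqE_nat Suc_eq_plus1 add_Suc_right)
  then show ?thesis
  proof cases
    case 1
    have "(\<Sum>x\<in>#proots (tail_poly \<alpha> N). x ^ i / x ^ k) = of_nat (N div 2)" for N
    proof -
      have "(\<Sum>x\<in>#proots (tail_poly \<alpha> N). x ^ i / x ^ k) = (\<Sum>x\<in>#proots (tail_poly \<alpha> N). 1)"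
        using nz 1 by (intro arg_cong[of _ _ sum_mset] image_mset_cong) auto
      then show ?thesis by (simp add: size_proots_complex degree_tail_poly)
    qed
    moreover have "\<forall>\<^sub>F N in sequentially. of_nat (N div 2) / of_nat (N div 2) = (1::complex)"
      using eventually_ge_at_top[of 2] by eventually_elim auto
    ultimately show ?thesis
      using 1 by (simp only:) (simp add: tendsto_eventually)
  next
    case (2 j)
    have "(\<Sum>x\<in>#proots (tail_poly \<alpha> N). x ^ i / x ^ k) = (\<Sum>x\<in>#proots (tail_poly \<alpha> N). x ^ (j + 1))" for N
      using nz 2 by (intro arg_cong[of _ _ sum_mset] image_mset_cong) (auto simp: power_add)
    moreover have "(if i = k then 1 else if k < i then 2 * ((-1) ^ i * (-1) ^ k) else 0) = (2 * (-1) ^ (j + 1) :: complex)"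
      using 2 by (cases "even k") (auto simp: power_add)
    ultimately show ?thesis using positive_power_sum_tendsto[where \<alpha> = \<alpha> and j = j] by (simp only:)
  next
    case (3 j)
    have "(\<Sum>x\<in>#proots (tail_poly \<alpha> N). x ^ i / x ^ k) = (\<Sum>x\<in>#proots (tail_poly \<alpha> N). (1 / x) ^ (j + 1))" for N
      using nz 3 by (intro arg_cong[of _ _ sum_mset] image_mset_cong) (auto simp: power_add power_divide)
    then show ?thesis using negative_power_sum_tendsto[where \<alpha> = \<alpha> and j = j] 3 by simp
  qed
qed

text \<open>Expand (x + 1)^(2k) / (4x)^k and insert the limits. Adding the sum to its reflection
  under i -> 2k - i turns every term into a multiple of (-1)^i (2k choose i), and the alternating
  sum vanishes for k > 0.\<close>

lemma phi_power_sum_tendsto: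
  "(\<lambda>N. (\<Sum>x\<in>#proots (tail_poly \<alpha> N). \<phi> x ^ k) / of_nat (N div 2)) \<longlonglongrightarrow> (if k = 0 then 1 else 0)"
proof -
  define m where "m i = (if i = k then 1 else if k < i then 2 * ((-1) ^ i * (-1) ^ k) else 0 :: complex)" for i
  have pk: "\<phi> x ^ k = (\<Sum>i\<le>2*k. of_nat (2 * k choose i) / 4 ^ k * (x ^ i / x ^ k))" for x
  proof -
    have "\<phi> x ^ k = (x + 1) ^ (2 * k) / (4 ^ k * x ^ k)"
      by (simp add: \<phi>_def power_divide power_mult_distrib power_mult)
    also have "\<dots> = (\<Sum>i\<le>2*k. of_nat (2 * k choose i) / 4 ^ k * (x ^ i / x ^ k))"
      by (simp add: binomial_ring sum_divide_distrib)
    finally show ?thesis .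
  qed
  have "(\<Sum>x\<in>#proots (tail_poly \<alpha> N). \<phi> x ^ k) / of_nat (N div 2)
     = (\<Sum>i\<le>2*k. of_nat (2 * k choose i) / 4 ^ k * ((\<Sum>x\<in>#proots (tail_poly \<alpha> N). x ^ i / x ^ k) / of_nat (N div 2)))" for N
  proof -
    have swap: "(\<Sum>x\<in>#A. \<Sum>i\<le>2*k. c i * g i x) = (\<Sum>i\<le>2*k. c i * (\<Sum>x\<in>#A. g i x))" for A and c :: "nat \<Rightarrow> complex" and g :: "nat \<Rightarrow> complex \<Rightarrow> complex"
      by (induction A) (auto simp: sum.distrib distrib_left)
    show ?thesis
      unfolding pk swap[where c = "\<lambda>i. of_nat (2 * k choose i) / 4 ^ k" and g = "\<lambda>i x. x ^ i / x ^ k"] sum_divide_distrib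
      by (simp only: times_divide_eq_right)
  qed
  moreover have "(\<lambda>N. \<Sum>i\<le>2*k. of_nat (2 * k choose i) / 4 ^ k * ((\<Sum>x\<in>#proots (tail_poly \<alpha> N). x ^ i / x ^ k) / of_nat (N div 2)))
     \<longlonglongrightarrow> (\<Sum>i\<le>2*k. of_nat (2 * k choose i) / 4 ^ k * m i)"
    unfolding m_def by (intro tendsto_intros laurent_power_sum_tendsto)
  moreover have "(\<Sum>i\<le>2*k. of_nat (2 * k choose i) / 4 ^ k * m i) = (if k = 0 then 1 else 0)"
  proof (cases "k = 0")
    case False
    let ?S = "\<Sum>i\<le>2*k. of_nat (2 * k choose i) * m i"
    have "?S = (\<Sum>i\<le>2*k. of_nat (2 * k choose i) * m (2 * k - i))"
      by (rule sum.reindex_bij_witness[of _ "\<lambda>i. 2 * k - i" "\<lambda>i. 2 * k - i"]) (auto simp flip: binomial_symmetric)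
    then have "?S + ?S = (\<Sum>i\<le>2*k. of_nat (2 * k choose i) * (m i + m (2 * k - i)))"
      by (simp add: sum.distrib distrib_left)
    also have "\<dots> = (\<Sum>i\<le>2*k. 2 * (-1) ^ k * ((-1) ^ i * of_nat (2 * k choose i)))"
    proof (intro sum.cong refl)
      fix i assume "i \<in> {..2 * k}"
      then have i: "i \<le> 2 * k" by simp
      have "(-1) ^ (2 * k - i) = ((-1) ^ i :: complex)"
        using i by (simp add: minus_one_power_iff even_diff_nat)
      \<comment> \<open>For i different from k one summand is 0 and the other 2 (-1)^(i + k); for i
        = k both are 1.\<close>
      then have "m i + m (2 * k - i) = 2 * (-1) ^ k * (-1) ^ i"
        using i by (cases i k rule: linorder_cases) (auto simp: m_def simp flip: power_mult_distrib)
      then show "of_nat (2 * k choose i) * (m i + m (2 * k - i)) = 2 * (-1) ^ k * ((-1) ^ i * of_nat (2 * k choose i))"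
        by (simp add: mult_ac)
    qed
    also have "\<dots> = 2 * (-1) ^ k * (\<Sum>i\<le>2*k. (-1) ^ i * of_nat (2 * k choose i))"
      by (simp only: sum_distrib_left)
    also have "(\<Sum>i\<le>2*k. (-1) ^ i * of_nat (2 * k choose i)) = (0::complex)"
      using False by (intro choose_alternating_sum) simp
    finally have "?S = 0" by simp
    then show ?thesis using False by (simp flip: sum_divide_distrib)
  qed (simp add: m_def)
  ultimately show ?thesis by (simp only:)
qed

subsection \<open>Trigonometric polynomials on the unit circle\<close>

text \<open>Exponents k >= 0 suffice because the functions are real: on the circle negative
  frequencies are conjugates of positive ones. Hence nonnegative moments of \<open>\<phi>\<close> at
  the zeros are enough.\<close>

inductive trig_poly :: "(complex \<Rightarrow> real) \<Rightarrow> bool" where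
  monom: "trig_poly (\<lambda>u. Re (a * u ^ k))"
| add: "trig_poly f \<Longrightarrow> trig_poly g \<Longrightarrow> trig_poly (\<lambda>u. f u + g u)"

lemma continuous_on_trig_poly: "trig_poly f \<Longrightarrow> continuous_on S f"
  by (induction rule: trig_poly.induct) (auto intro!: continuous_intros)

lemma trig_poly_scale: "trig_poly f \<Longrightarrow> trig_poly (\<lambda>u. c * f u)"
proof (induction rule: trig_poly.induct)
  case (monom a k)
  then show ?case using trig_poly.monom[of "of_real c * a" k] by (simp add: mult.assoc)
next
  case (add f g)
  then show ?case using trig_poly.add[OF add.IH] by (simp add: distrib_left)
qed

text \<open>Re x Re y is half of Re (x y) + Re (x cnj y). On the circle u cnj(u) = 1 collapses the
  second term to a single power, after a conjugation if l > k.\<close>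

lemma trig_poly_mult_monom:
  "\<exists>h. trig_poly h \<and> (\<forall>u. cmod u = 1 \<longrightarrow> Re (a * u ^ k) * Re (b * u ^ l) = h u)"
proof -
  have cn: "u ^ (j + i) * cnj (u ^ i) = u ^ j" if "cmod u = 1" for u :: complex and i j
  proof -
    have "u ^ (j + i) * cnj (u ^ i) = u ^ j * (u ^ i * cnj (u ^ i))" by (simp add: power_add)
    also have "u ^ i * cnj (u ^ i) = 1"
      using complex_norm_square[of "u ^ i"] that by (simp add: norm_power)
    finally show ?thesis by simp
  qed
  have prod: "Re x * Re y = 1/2 * (Re (x * y) + Re (x * cnj y))" for x y
    by (simp add: algebra_simps)
  have "\<exists>h. trig_poly h \<and> (\<forall>u. cmod u = 1 \<longrightarrow> Re (a * u ^ k * cnj (b * u ^ l)) = h u)"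
  proof (cases "l \<le> k")
    case True
    then obtain j where "k = j + l" by (metis add.commute le_Suc_ex)
    then have "Re (a * u ^ k * cnj (b * u ^ l)) = Re (a * cnj b * u ^ j)" if "cmod u = 1" for u
      using cn[OF that, of j l] by (simp only: complex_cnj_mult) (simp add: mult_ac)
    then show ?thesis using trig_poly.monom by blast
  next
    case False
    then obtain j where "l = j + k" by (metis add.commute le_Suc_ex nat_le_linear)
    then have "Re (a * u ^ k * cnj (b * u ^ l)) = Re (cnj a * b * u ^ j)" if "cmod u = 1" for u
    proof -
      have "Re (a * u ^ k * cnj (b * u ^ l)) = Re (cnj (a * u ^ k * cnj (b * u ^ l)))" by (simp only: cnj.sel)
      also have "cnj (a * u ^ k * cnj (b * u ^ l)) = cnj a * b * (u ^ (j + k) * cnj (u ^ k))"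
        using \<open>l = j + k\<close> by (simp only: complex_cnj_mult complex_cnj_cnj) (simp add: mult_ac)
      finally show ?thesis by (simp only: cn[OF that])
    qed
    then show ?thesis using trig_poly.monom by blast
  qed
  then obtain h where h: "trig_poly h" "\<And>u. cmod u = 1 \<Longrightarrow> Re (a * u ^ k * cnj (b * u ^ l)) = h u" by blast
  have "Re (a * u ^ k) * Re (b * u ^ l) = 1/2 * (Re (a * b * u ^ (k + l)) + h u)" if "cmod u = 1" for u
    unfolding prod h(2)[OF that] by (simp add: power_add mult_ac)
  moreover have "trig_poly (\<lambda>u. 1/2 * (Re (a * b * u ^ (k + l)) + h u))"
    by (intro trig_poly_scale trig_poly.add trig_poly.monom h(1))
  ultimately show ?thesis by blast
qed

lemma trig_poly_mult:
  assumes "trig_poly f" "trig_poly g"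
  shows "\<exists>h. trig_poly h \<and> (\<forall>u. cmod u = 1 \<longrightarrow> f u * g u = h u)"
  using assms
proof (induction rule: trig_poly.induct)
  case (monom a k)
  from monom show ?case
  proof (induction rule: trig_poly.induct)
    case (monom b l)
    show ?case by (rule trig_poly_mult_monom)
  next
    case (add g1 g2)
    then obtain h1 h2 where "trig_poly h1" "\<forall>u. cmod u = 1 \<longrightarrow> Re (a * u ^ k) * g1 u = h1 u"
      "trig_poly h2" "\<forall>u. cmod u = 1 \<longrightarrow> Re (a * u ^ k) * g2 u = h2 u" by blast
    then show ?case
      by (intro exI[of _ "\<lambda>u. h1 u + h2 u"] conjI trig_poly.add) (simp_all add: distrib_left)
  qed
next
  case (add f1 f2)
  then obtain h1 h2 where "trig_poly h1" "\<forall>u. cmod u = 1 \<longrightarrow> f1 u * g u = h1 u"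
    "trig_poly h2" "\<forall>u. cmod u = 1 \<longrightarrow> f2 u * g u = h2 u" by blast
  then show ?case
    by (intro exI[of _ "\<lambda>u. h1 u + h2 u"] conjI trig_poly.add) (simp_all add: distrib_right)
qed

lemma trig_poly_approx:
  assumes F: "continuous_on (sphere 0 1) F" and e: "0 < e"
  obtains h where "trig_poly h" "\<And>u. cmod u = 1 \<Longrightarrow> \<bar>F u - h u\<bar> < e"
proof -
  \<comment> \<open>Agreement is required on the circle only, since it is only there that products
    are again trigonometric polynomials.\<close>
  let ?R = "{f. \<exists>h. trig_poly h \<and> (\<forall>u. cmod u = 1 \<longrightarrow> f u = h u)}"
  interpret function_ring_on ?R "sphere 0 1"
  proof unfold_locales
    show "compact (sphere (0::complex) 1)" by simp
  next
    fix f assume "f \<in> ?R"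
    then obtain h where "trig_poly h" "\<forall>u. cmod u = 1 \<longrightarrow> f u = h u" by blast
    then show "continuous_on (sphere 0 1) f"
      using continuous_on_trig_poly[of h "sphere 0 1"] by (subst continuous_on_cong[OF refl, of _ f h]) auto
  next
    fix f g assume "f \<in> ?R" "g \<in> ?R"
    then obtain h1 h2 where h: "trig_poly h1" "\<forall>u. cmod u = 1 \<longrightarrow> f u = h1 u"
      "trig_poly h2" "\<forall>u. cmod u = 1 \<longrightarrow> g u = h2 u" by blast
    then show "(\<lambda>x. f x + g x) \<in> ?R"
      by (intro CollectI exI[of _ "\<lambda>u. h1 u + h2 u"] conjI trig_poly.add) simp_all
    from trig_poly_mult[OF h(1,3)] show "(\<lambda>x. f x * g x) \<in> ?R" using h(2,4) by simp
  next
    fix c :: real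
    show "(\<lambda>_. c) \<in> ?R"
      using trig_poly.monom[of "of_real c" 0] by (intro CollectI exI[of _ "\<lambda>_. c"]) simp
  next
    fix x y :: complex assume "x \<noteq> y"
    then consider "Re x \<noteq> Re y" | "Im x \<noteq> Im y" by (auto simp: complex_eq_iff)
    then show "\<exists>f\<in>?R. f x \<noteq> f y"
    proof cases
      case 1
      then show ?thesis using trig_poly.monom[of 1 1] by (intro bexI[of _ Re]) auto
    next
      case 2
      then show ?thesis using trig_poly.monom[of "- \<i>" 1] by (intro bexI[of _ Im]) auto
    qed
  qed
  obtain f where "f \<in> ?R" "\<forall>x\<in>sphere 0 1. \<bar>F x - f x\<bar> < e"
    using Stone_Weierstrass_basic[OF F e] by blast
  then obtain h where "trig_poly h" "\<forall>u. cmod u = 1 \<longrightarrow> f u = h u" "\<forall>u\<in>sphere 0 1. \<bar>F u - f u\<bar> < e" by blast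
  then show ?thesis using that[of h] by simp
qed

subsection \<open>The equilibrium measure\<close>

lemma sets_unit_circle_measure [simp, measurable_cong]: "sets unit_circle_measure = sets borel"
  and space_unit_circle_measure [simp]: "space unit_circle_measure = UNIV"
  by (simp_all add: unit_circle_measure_def)

lemma borel_measurable_cis [measurable]: "cis \<in> borel_measurable borel"
  by (intro borel_measurable_continuous_onI continuous_intros)

lemma prob_space_uniform_arc: "prob_space (uniform_measure lborel {0..<2 * pi})"
  by (rule prob_space_uniform_measure) simp_all

lemma prob_space_unit_circle_measure: "prob_space unit_circle_measure"
  unfolding unit_circle_measure_def
  by (rule prob_space.prob_space_distr[OF prob_space_uniform_arc]) simp

lemma AE_unit_circle_measure: "AE u in unit_circle_measure. cmod u = 1"
  unfolding unit_circle_measure_def by (subst AE_distr_iff) auto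

lemma integral_unit_circle_power:
  "integrable unit_circle_measure (\<lambda>u. Re (a * u ^ k))"
  "integral\<^sup>L unit_circle_measure (\<lambda>u. Re (a * u ^ k)) = (if k = 0 then Re a else 0)"
proof -
  interpret prob_space unit_circle_measure by (rule prob_space_unit_circle_measure)
  have meas [measurable]: "(\<lambda>u. Re (a * u ^ k)) \<in> borel_measurable borel"
    by (intro borel_measurable_continuous_onI continuous_intros)
  have "AE u in unit_circle_measure. norm (Re (a * u ^ k)) \<le> cmod a"
    using AE_unit_circle_measure
  proof eventually_elim
    case (elim u)
    then show ?case using abs_Re_le_cmod[of "a * u ^ k"] by (simp add: norm_mult norm_power)
  qed
  then show "integrable unit_circle_measure (\<lambda>u. Re (a * u ^ k))"
    by (rule integrable_const_bound) simp
  define F where "F t = (if k = 0 then Re a * t else (Re a * sin (real k * t) + Im a * cos (real k * t)) / real k)" for t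
  have F: "(F has_real_derivative Re (a * cis t ^ k)) (at t)" for t
  proof -
    have Re_eq: "Re (a * cis t ^ k) = Re a * cos (real k * t) - Im a * sin (real k * t)"
      by (simp only: Complex.DeMoivre times_complex.sel cis.sel)
    show ?thesis
      unfolding F_def Re_eq by (cases "k = 0") (auto intro!: derivative_eq_intros simp: field_simps)
  qed
  have "integral\<^sup>L unit_circle_measure (\<lambda>u. Re (a * u ^ k)) =
      integral\<^sup>L (uniform_measure lborel {0..<2 * pi}) (\<lambda>t. Re (a * cis t ^ k))"
    unfolding unit_circle_measure_def by (rule integral_distr) simp_all
  also have "uniform_measure lborel {0..<2 * pi} = density lborel (\<lambda>t. ennreal (indicator {0..<2 * pi} t / (2 * pi)))"
    unfolding uniform_measure_def by (intro density_cong) (auto simp: divide_ennreal ennreal_1[symmetric] indicator_def simp del: ennreal_1)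
  also have "integral\<^sup>L \<dots> (\<lambda>t. Re (a * cis t ^ k)) =
      integral\<^sup>L lborel (\<lambda>t. (indicator {0..<2 * pi} t / (2 * pi)) *\<^sub>R Re (a * cis t ^ k))"
    by (rule integral_density) (auto intro!: borel_measurable_continuous_onI continuous_intros)
  also have "\<dots> = integral\<^sup>L lborel (\<lambda>t. (Re (a * cis t ^ k) * indicator {0..2 * pi} t) / (2 * pi))"
  proof (rule integral_cong_AE)
    show "AE t in lborel. (indicator {0..<2 * pi} t / (2 * pi)) *\<^sub>R Re (a * cis t ^ k) =
        (Re (a * cis t ^ k) * indicator {0..2 * pi} t) / (2 * pi)"
      using AE_lborel_singleton[of "2 * pi"] by eventually_elim (auto simp: indicator_def)
  qed measurable
  also have "\<dots> = integral\<^sup>L lborel (\<lambda>t. Re (a * cis t ^ k) * indicator {0..2 * pi} t) / (2 * pi)"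
    by simp
  also have "integral\<^sup>L lborel (\<lambda>t. Re (a * cis t ^ k) * indicator {0..2 * pi} t) = F (2 * pi) - F 0"
  proof (rule integral_FTC_Icc_real[OF _ F])
    have "continuous_on UNIV (\<lambda>t. Re (a * cis t ^ k))" by (intro continuous_intros)
    then show "isCont (\<lambda>t. Re (a * cis t ^ k)) t" for t by (simp add: continuous_on_eq_continuous_at)
  qed simp
  also have "\<dots> / (2 * pi) = (if k = 0 then Re a else 0)"
    using sin_2npi[of k] cos_2npi[of k] by (auto simp: F_def mult_ac)
  finally show "integral\<^sup>L unit_circle_measure (\<lambda>u. Re (a * u ^ k)) = (if k = 0 then Re a else 0)" .
qed

text \<open>\<open>\<phi> w = u\<close> is the quadratic w^2 + (2 - 4u) w + 1 = 0, with roots 2u - 1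
  + s and 2u - 1 - s of product 1; so one of them has modulus at least 1.\<close>

lemma phi_image_Gamma: "\<phi> ` \<Gamma> = sphere 0 1"
proof
  show "\<phi> ` \<Gamma> \<subseteq> sphere 0 1" by (auto simp: \<Gamma>_def)
  show "sphere 0 1 \<subseteq> \<phi> ` \<Gamma>"
  proof
    fix u :: complex assume "u \<in> sphere 0 1"
    then have u: "cmod u = 1" by simp
    define s where "s = csqrt ((2 * u - 1)\<^sup>2 - 1)"
    have s: "s\<^sup>2 = (2 * u - 1)\<^sup>2 - 1" by (simp add: s_def)
    have prod: "(2 * u - 1 + s) * (2 * u - 1 - s) = 1"
      using s by (simp add: algebra_simps power2_eq_square)
    have sol: "w \<in> \<Gamma> \<and> \<phi> w = u" if w: "w = 2 * u - 1 + t" "t\<^sup>2 = s\<^sup>2" "1 \<le> cmod w" for w t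
    proof -
      have "w \<noteq> 0" using w(3) by auto
      have "t\<^sup>2 = 4 * u\<^sup>2 - 4 * u" using w(2) s by (simp add: algebra_simps power2_eq_square)
      then have "(w + 1)\<^sup>2 = 4 * u * w" unfolding w(1) by (simp add: algebra_simps power2_eq_square)
      then have "\<phi> w = u" using \<open>w \<noteq> 0\<close> by (simp add: \<phi>_def)
      then show ?thesis using w(3) u by (simp add: \<Gamma>_def)
    qed
    have "1 \<le> cmod (2 * u - 1 + s) \<or> 1 \<le> cmod (2 * u - 1 - s)"
    proof (rule ccontr)
      assume "\<not> ?thesis"
      then have "cmod (2 * u - 1 + s) * cmod (2 * u - 1 - s) < 1 * 1"
        by (intro mult_strict_mono') auto
      then show False using prod by (metis norm_mult norm_one mult_1 less_irrefl)
    qed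
    then have "\<exists>w\<in>\<Gamma>. \<phi> w = u"
      using sol[of "2 * u - 1 + s" s] sol[of "2 * u - 1 - s" "- s"] by auto
    then show "u \<in> \<phi> ` \<Gamma>" by blast
  qed
qed

lemma borel_measurable_phi [measurable]: "\<phi> \<in> borel_measurable borel"
  unfolding \<phi>_def[abs_def] by measurable

text \<open>As \<Gamma> covers the whole circle, the part of \<Gamma> over A is mapped onto the part
  of A on the circle, which carries all the mass of A.\<close>

lemma distr_mu_Gamma_phi: "distr \<mu>\<Gamma> borel \<phi> = unit_circle_measure"
proof (rule measure_eqI)
  fix A assume "A \<in> sets (distr \<mu>\<Gamma> borel \<phi>)"
  then have A: "A \<in> sets borel" by simp
  have pre: "\<phi> -` A \<in> sets borel"
    using measurable_sets_borel[OF borel_measurable_phi A] .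
  have "emeasure (distr \<mu>\<Gamma> borel \<phi>) A = emeasure \<mu>\<Gamma> (\<phi> -` A)"
    using A by (subst emeasure_distr) auto
  also have "\<dots> = emeasure unit_circle_measure (\<phi> ` (\<phi> -` A \<inter> \<Gamma>))"
    by (rule emeasure_\<mu>\<Gamma>[OF pre])
  also have "\<phi> ` (\<phi> -` A \<inter> \<Gamma>) = A \<inter> sphere 0 1"
  proof -
    have "\<phi> ` (\<phi> -` A \<inter> \<Gamma>) = A \<inter> \<phi> ` \<Gamma>" by auto
    then show ?thesis by (simp only: phi_image_Gamma)
  qed
  also have "emeasure unit_circle_measure (A \<inter> sphere 0 1) = emeasure unit_circle_measure A"
    using A by (intro emeasure_eq_AE eventually_mono[OF AE_unit_circle_measure]) auto
  finally show "emeasure (distr \<mu>\<Gamma> borel \<phi>) A = emeasure unit_circle_measure A" .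
qed simp

lemma prob_space_mu_Gamma: "prob_space \<mu>\<Gamma>"
proof
  have "emeasure \<mu>\<Gamma> (space \<mu>\<Gamma>) = emeasure (distr \<mu>\<Gamma> borel \<phi>) UNIV"
    by (subst emeasure_distr) auto
  then show "emeasure \<mu>\<Gamma> (space \<mu>\<Gamma>) = 1"
    using prob_space.emeasure_space_1[OF prob_space_unit_circle_measure]
    by (simp add: distr_mu_Gamma_phi)
qed

lemma Gamma_borel: "\<Gamma> \<in> sets borel"
  using compact_\<Gamma> by (rule borel_compact)

lemma emeasure_mu_Gamma_compl: "emeasure \<mu>\<Gamma> (- \<Gamma>) = 0"
  using Gamma_borel by (subst emeasure_\<mu>\<Gamma>) auto

lemma AE_mu_Gamma: "AE w in \<mu>\<Gamma>. w \<in> \<Gamma>"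
  by (rule AE_I[of _ _ "- \<Gamma>"]) (use Gamma_borel emeasure_mu_Gamma_compl in auto)

lemma integrable_mu_Gamma:
  fixes g :: "complex \<Rightarrow> real"
  assumes "continuous_on \<Gamma> g" "g \<in> borel_measurable borel"
  shows "integrable \<mu>\<Gamma> g"
proof -
  interpret prob_space \<mu>\<Gamma> by (rule prob_space_mu_Gamma)
  obtain B where B: "\<And>w. w \<in> \<Gamma> \<Longrightarrow> norm (g w) \<le> B"
    using compact_imp_bounded[OF compact_continuous_image[OF assms(1) compact_\<Gamma>]]
    unfolding bounded_iff by blast
  have "AE w in \<mu>\<Gamma>. norm (g w) \<le> B"
    using AE_mu_Gamma by eventually_elim (rule B)
  then show ?thesis by (rule integrable_const_bound) (use assms(2) in simp)
qed

section \<open>Convergence of averages over the zeros in the variable w\<close>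

lemma continuous_on_phi_Gamma: "continuous_on \<Gamma> \<phi>"
  unfolding \<phi>_def by (intro continuous_intros) (auto simp: \<Gamma>_def)

lemma trig_poly_zero_mean:
  assumes "trig_poly h"
  shows "integrable \<mu>\<Gamma> (\<lambda>w. h (\<phi> w)) \<and>
    (\<lambda>N. (\<Sum>x\<in>#proots (tail_poly \<alpha> N). h (\<phi> x)) / real (N div 2)) \<longlonglongrightarrow> integral\<^sup>L \<mu>\<Gamma> (\<lambda>w. h (\<phi> w))"
  using assms
proof (induction rule: trig_poly.induct)
  case (monom a k)
  have meas: "(\<lambda>u. Re (a * u ^ k)) \<in> borel_measurable borel"
    by (intro borel_measurable_continuous_onI continuous_intros)
  have "integrable (distr \<mu>\<Gamma> borel \<phi>) (\<lambda>u. Re (a * u ^ k))"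
    unfolding distr_mu_Gamma_phi by (rule integral_unit_circle_power)
  then have int: "integrable \<mu>\<Gamma> (\<lambda>w. Re (a * \<phi> w ^ k))"
    by (subst (asm) integrable_distr_eq) (use meas in auto)
  have "integral\<^sup>L \<mu>\<Gamma> (\<lambda>w. Re (a * \<phi> w ^ k)) = integral\<^sup>L (distr \<mu>\<Gamma> borel \<phi>) (\<lambda>u. Re (a * u ^ k))"
    by (subst integral_distr) (use meas in auto)
  also have "\<dots> = Re (a * (if k = 0 then 1 else 0))"
    unfolding distr_mu_Gamma_phi integral_unit_circle_power by simp
  finally have I: "integral\<^sup>L \<mu>\<Gamma> (\<lambda>w. Re (a * \<phi> w ^ k)) = Re (a * (if k = 0 then 1 else 0))" .
  have "(\<Sum>x\<in>#A. Re (a * \<phi> x ^ k)) = Re (a * (\<Sum>x\<in>#A. \<phi> x ^ k))" for A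
    by (induction A) (simp_all add: distrib_left)
  then have eq: "(\<Sum>x\<in>#A. Re (a * \<phi> x ^ k)) / real d = Re (a * ((\<Sum>x\<in>#A. \<phi> x ^ k) / of_nat d))" for A d
    using Re_divide_of_nat[of "a * (\<Sum>x\<in>#A. \<phi> x ^ k)" d] by simp
  show ?case
    unfolding I eq using int by (intro conjI tendsto_intros phi_power_sum_tendsto)
next
  case (add f g)
  have "(\<Sum>x\<in>#A. f (\<phi> x) + g (\<phi> x)) = (\<Sum>x\<in>#A. f (\<phi> x)) + (\<Sum>x\<in>#A. g (\<phi> x))" for A
    by (rule sum_mset.distrib)
  then show ?case
    using add.IH by (auto simp: add_divide_distrib intro!: tendsto_add)
qed

text \<open>On \<Gamma>, g is a continuous function of \<open>\<phi>\<close>, hence within e/3 of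
  some h(\<open>\<phi>\<close>). By continuity this persists on a neighbourhood G of \<Gamma>, where
  eventually all zeros lie. The three thirds are the errors at the zeros, in the limit for h, and in
  the integral.\<close>

lemma tail_poly_zeros_weak_limit:
  fixes g :: "complex \<Rightarrow> real"
  assumes g: "continuous_on UNIV g"
  shows "(\<lambda>N. (\<Sum>x\<in>#proots (tail_poly \<alpha> N). g x) / real (N div 2)) \<longlonglongrightarrow> integral\<^sup>L \<mu>\<Gamma> g"
proof (rule LIMSEQ_I)
  fix e :: real assume "0 < e"
  interpret prob_space \<mu>\<Gamma> by (rule prob_space_mu_Gamma)
  have "continuous_on (\<phi> ` \<Gamma>) (g \<circ> inv_into \<Gamma> \<phi>)"
    by (intro continuous_on_compose continuous_on_inv continuous_on_subset[OF g])
       (auto simp: continuous_on_phi_Gamma compact_\<Gamma> inj_on_\<phi>_\<Gamma>)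
  then have F: "continuous_on (sphere 0 1) (g \<circ> inv_into \<Gamma> \<phi>)" by (simp add: phi_image_Gamma)
  have "0 < e / 3" using \<open>0 < e\<close> by simp
  then obtain h where h: "trig_poly h" and hF: "\<And>u. cmod u = 1 \<Longrightarrow> \<bar>(g \<circ> inv_into \<Gamma> \<phi>) u - h u\<bar> < e / 3"
    using trig_poly_approx[OF F] by blast
  have near: "\<bar>g w - h (\<phi> w)\<bar> < e / 3" if "w \<in> \<Gamma>" for w
    using hF[of "\<phi> w"] that inj_on_\<phi>_\<Gamma> by (auto simp: \<Gamma>_def[symmetric] inv_into_f_f) (auto simp: \<Gamma>_def)
  define d where "d w = \<bar>g w - h (\<phi> w)\<bar>" for w
  \<comment> \<open>0 is removed because \<phi> has its pole there; \<Gamma> keeps away from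
    it.\<close>
  define G where "G = - {0} \<inter> d -` {..<e / 3}"
  have "continuous_on (- {0}) \<phi>"
    unfolding \<phi>_def by (intro continuous_intros) auto
  then have hphi: "continuous_on (- {0}) (\<lambda>w. h (\<phi> w))"
    using continuous_on_compose[of "-{0}" \<phi> h] continuous_on_trig_poly[OF h] by (simp add: o_def)
  have "continuous_on (- {0}) d"
    unfolding d_def by (intro continuous_intros hphi continuous_on_subset[OF g]) auto
  then have "open G" unfolding G_def by (intro continuous_open_preimage) auto
  moreover have "\<Gamma> \<subseteq> G" using near by (auto simp: G_def d_def \<Gamma>_def)
  ultimately have ev: "\<forall>\<^sub>F N in sequentially. \<forall>\<zeta>. poly (tail_poly \<alpha> N) \<zeta> = 0 \<longrightarrow> \<zeta> \<in> G"
    by (rule zeros_near_Gamma)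
  have lim: "(\<lambda>N. (\<Sum>x\<in>#proots (tail_poly \<alpha> N). h (\<phi> x)) / real (N div 2)) \<longlonglongrightarrow> integral\<^sup>L \<mu>\<Gamma> (\<lambda>w. h (\<phi> w))"
    and inth: "integrable \<mu>\<Gamma> (\<lambda>w. h (\<phi> w))"
    using trig_poly_zero_mean[OF h] by auto
  have intg: "integrable \<mu>\<Gamma> g"
    by (intro integrable_mu_Gamma continuous_on_subset[OF g] borel_measurable_continuous_onI g) auto
  have "\<bar>integral\<^sup>L \<mu>\<Gamma> g - integral\<^sup>L \<mu>\<Gamma> (\<lambda>w. h (\<phi> w))\<bar> = \<bar>integral\<^sup>L \<mu>\<Gamma> (\<lambda>w. g w - h (\<phi> w))\<bar>"
    using intg inth by simp
  also have "\<dots> \<le> integral\<^sup>L \<mu>\<Gamma> (\<lambda>w. \<bar>g w - h (\<phi> w)\<bar>)" by (rule integral_abs_bound)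
  also have "\<dots> \<le> integral\<^sup>L \<mu>\<Gamma> (\<lambda>w. e / 3)"
  proof (rule integral_mono_AE)
    show "AE w in \<mu>\<Gamma>. \<bar>g w - h (\<phi> w)\<bar> \<le> e / 3"
      using AE_mu_Gamma by eventually_elim (use near in fastforce)
  qed (use intg inth in auto)
  also have "\<dots> = e / 3" using prob_space by simp
  finally have close: "\<bar>integral\<^sup>L \<mu>\<Gamma> g - integral\<^sup>L \<mu>\<Gamma> (\<lambda>w. h (\<phi> w))\<bar> \<le> e / 3" .
  have "\<forall>\<^sub>F N in sequentially. dist ((\<Sum>x\<in>#proots (tail_poly \<alpha> N). h (\<phi> x)) / real (N div 2)) (integral\<^sup>L \<mu>\<Gamma> (\<lambda>w. h (\<phi> w))) < e / 3"
    using lim \<open>0 < e / 3\<close> by (rule tendstoD)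
  from this ev eventually_ge_at_top[of 2]
  have "\<forall>\<^sub>F N in sequentially. norm ((\<Sum>x\<in>#proots (tail_poly \<alpha> N). g x) / real (N div 2) - integral\<^sup>L \<mu>\<Gamma> g) < e"
  proof eventually_elim
    case (elim N)
    let ?Z = "proots (tail_poly \<alpha> N)"
    have pos: "real (N div 2) > 0" using elim(3) by simp
    have "\<bar>(\<Sum>x\<in>#A. g x) - (\<Sum>x\<in>#A. h (\<phi> x))\<bar> \<le> e / 3 * real (size A)" if "\<And>x. x \<in># A \<Longrightarrow> \<bar>g x - h (\<phi> x)\<bar> \<le> e / 3" for A
      using that
    proof (induction A)
      case (add x A)
      have 1: "\<bar>g x - h (\<phi> x)\<bar> \<le> e / 3" using add.prems by simp
      have 2: "\<bar>(\<Sum>x\<in>#A. g x) - (\<Sum>x\<in>#A. h (\<phi> x))\<bar> \<le> e / 3 * real (size A)" using add by simp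
      have 3: "e / 3 * real (size (add_mset x A)) = e / 3 + e / 3 * real (size A)" by (simp add: algebra_simps)
      show ?case unfolding image_mset_add_mset sum_mset.add_mset 3 using 1 2 by linarith
    qed simp
    moreover have "\<bar>g x - h (\<phi> x)\<bar> \<le> e / 3" if "x \<in># ?Z" for x
    proof -
      have "x \<in> G" using elim(2) that by simp
      then show ?thesis by (simp add: G_def d_def)
    qed
    ultimately have "\<bar>(\<Sum>x\<in>#?Z. g x) - (\<Sum>x\<in>#?Z. h (\<phi> x))\<bar> \<le> e / 3 * real (N div 2)"
      by (metis size_proots_complex degree_tail_poly)
    then have "\<bar>(\<Sum>x\<in>#?Z. g x) - (\<Sum>x\<in>#?Z. h (\<phi> x))\<bar> / real (N div 2) \<le> e / 3"
      using pos by (simp only: pos_divide_le_eq)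
    then have "\<bar>(\<Sum>x\<in>#?Z. g x) / real (N div 2) - (\<Sum>x\<in>#?Z. h (\<phi> x)) / real (N div 2)\<bar> \<le> e / 3"
      using pos by (simp add: abs_divide flip: diff_divide_distrib)
    then show ?case using elim(1) close unfolding dist_real_def real_norm_def by linarith
  qed
  then show "\<exists>no. \<forall>n\<ge>no. norm ((\<Sum>x\<in>#proots (tail_poly \<alpha> n). g x) / real (n div 2) - integral\<^sup>L \<mu>\<Gamma> g) < e"
    by (simp add: eventually_sequentially)
qed

subsection \<open>Pulling back along the quadratic map\<close>

text \<open>A section of \<open>\<phi>1\<close>, discontinuous across the cut of
  \<open>csqrt\<close>; the other preimage of w is the negative of this value.\<close>

definition sqr_root :: "complex \<Rightarrow> complex" where
  "sqr_root w = csqrt (- w)"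

lemma phi1_sqr_root [simp]: "\<phi>1 (sqr_root w) = w" "\<phi>1 (- sqr_root w) = w"
  by (simp_all add: \<phi>1_def sqr_root_def)

lemma sqr_root_phi1: "sqr_root (\<phi>1 z) = z \<or> sqr_root (\<phi>1 z) = - z"
proof -
  have "(sqr_root (\<phi>1 z))\<^sup>2 = z\<^sup>2" by (simp add: sqr_root_def \<phi>1_def)
  then show ?thesis by (simp only: power2_eq_iff)
qed

lemma sqr_root_eq_0 [simp]: "sqr_root w = 0 \<longleftrightarrow> w = 0"
  by (simp add: sqr_root_def)

lemma borel_measurable_csqrt [measurable]: "csqrt \<in> borel_measurable borel"
  unfolding borel_measurable_complex_iff csqrt.sel by measurable

lemma borel_measurable_sqr_root [measurable]: "sqr_root \<in> borel_measurable borel"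
  unfolding sqr_root_def[abs_def] by measurable

lemma borel_measurable_phi1 [measurable]: "\<phi>1 \<in> borel_measurable borel"
  unfolding \<phi>1_def[abs_def] by measurable

lemma open_phi1_image:
  assumes "open U"
  shows "open (\<phi>1 ` U)"
proof (rule open_mapping_thm[of _ UNIV])
  show "\<phi>1 holomorphic_on UNIV" unfolding \<phi>1_def[abs_def] by (intro holomorphic_intros)
  have "\<phi>1 0 \<noteq> \<phi>1 1" by (simp add: \<phi>1_def)
  then show "\<not> \<phi>1 constant_on UNIV" unfolding constant_on_def by (metis UNIV_I)
qed (use assms in auto)

text \<open>Although \<open>sqr_root\<close> has a branch cut, the symmetrisation is continuous, because \<open>\<phi>1\<close> is an open map.\<close>

lemma continuous_symmetrisation:
  fixes f :: "complex \<Rightarrow> real"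
  assumes f: "continuous_on UNIV f"
  shows "continuous_on UNIV (\<lambda>w. (f (sqr_root w) + f (- sqr_root w)) / 2)"
proof -
  let ?g = "\<lambda>w. (f (sqr_root w) + f (- sqr_root w)) / 2"
  have gphi: "?g (\<phi>1 z) = (f z + f (- z)) / 2" for z
    using sqr_root_phi1[of z] by auto
  have "open (?g -` B)" if B: "open B" for B
  proof -
    have "continuous_on UNIV (\<lambda>z. (f z + f (- z)) / 2)"
      by (intro continuous_intros continuous_on_compose2[OF f]) auto
    then have "open ((\<lambda>z. (f z + f (- z)) / 2) -` B)"
      using B by (simp add: continuous_on_open_vimage)
    then have "open (\<phi>1 ` ((\<lambda>z. (f z + f (- z)) / 2) -` B))" by (rule open_phi1_image)
    also have "\<phi>1 ` ((\<lambda>z. (f z + f (- z)) / 2) -` B) = ?g -` B"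
    proof (intro equalityI subsetI)
      fix w assume "w \<in> ?g -` B"
      then show "w \<in> \<phi>1 ` ((\<lambda>z. (f z + f (- z)) / 2) -` B)"
        by (intro image_eqI[of _ _ "sqr_root w"]) simp_all
    next
      fix w assume "w \<in> \<phi>1 ` ((\<lambda>z. (f z + f (- z)) / 2) -` B)"
      then obtain z where z: "w = \<phi>1 z" "(f z + f (- z)) / 2 \<in> B" by auto
      then show "w \<in> ?g -` B" by (simp only: vimage_eq gphi)
    qed
    finally show ?thesis .
  qed
  then show ?thesis by (simp add: continuous_on_open_vimage)
qed

text \<open>The mean of the images of \<open>\<mu>\<Gamma>\<close> under the two sections of
  \<open>\<phi>1\<close>. Using both removes the dependence on the branch and matches the pairing of
  the zeros z and -z.\<close>

definition zero_measure :: "complex measure" where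
  "zero_measure = measure_of UNIV (sets borel)
     (\<lambda>E. (emeasure \<mu>\<Gamma> (sqr_root -` E) + emeasure \<mu>\<Gamma> ((\<lambda>w. - sqr_root w) -` E)) / 2)"

lemma sets_zero_measure [simp, measurable_cong]: "sets zero_measure = sets borel"
  and space_zero_measure [simp]: "space zero_measure = UNIV"
  using sets.sigma_sets_eq[of "borel :: complex measure"]
  by (simp_all add: zero_measure_def sets_measure_of space_measure_of)

lemma borel_vimage:
  assumes "(f :: complex \<Rightarrow> complex) \<in> borel_measurable borel" "B \<in> sets borel"
  shows "f -` B \<in> sets borel"
  using measurable_sets_borel[OF assms] .

lemma emeasure_zero_measure:
  assumes "E \<in> sets borel"
  shows "emeasure zero_measure E =
    (emeasure \<mu>\<Gamma> (sqr_root -` E) + emeasure \<mu>\<Gamma> ((\<lambda>w. - sqr_root w) -` E)) / 2"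
proof (rule emeasure_measure_of[OF zero_measure_def])
  show "countably_additive (sets zero_measure)
     (\<lambda>E. (emeasure \<mu>\<Gamma> (sqr_root -` E) + emeasure \<mu>\<Gamma> ((\<lambda>w. - sqr_root w) -` E)) / 2)"
  proof (rule countably_additiveI)
    fix A :: "nat \<Rightarrow> complex set"
    assume A: "range A \<subseteq> sets zero_measure" "disjoint_family A"
    have "(\<Sum>i. emeasure \<mu>\<Gamma> (f -` A i)) = emeasure \<mu>\<Gamma> (f -` \<Union> (range A))"
      if f: "f \<in> borel_measurable borel" for f
    proof -
      have "(\<Sum>i. emeasure \<mu>\<Gamma> (f -` A i)) = emeasure \<mu>\<Gamma> (\<Union>i. f -` A i)"
      proof (rule suminf_emeasure)
        show "range (\<lambda>i. f -` A i) \<subseteq> sets \<mu>\<Gamma>" using A(1) borel_vimage[OF f] by auto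
        show "disjoint_family (\<lambda>i. f -` A i)" using A(2) by (auto simp: disjoint_family_on_def)
      qed
      then show ?thesis by (simp add: vimage_UN)
    qed
    moreover have "(\<lambda>w. - sqr_root w) \<in> borel_measurable borel" by measurable
    ultimately show "(\<Sum>i. (emeasure \<mu>\<Gamma> (sqr_root -` A i) + emeasure \<mu>\<Gamma> ((\<lambda>w. - sqr_root w) -` A i)) / 2)
      = (emeasure \<mu>\<Gamma> (sqr_root -` \<Union> (range A)) + emeasure \<mu>\<Gamma> ((\<lambda>w. - sqr_root w) -` \<Union> (range A))) / 2"
      by (simp only: ennreal_suminf_divide suminf_add[OF summableI summableI, symmetric] borel_measurable_sqr_root)
  qed
qed (use assms in \<open>auto simp: positive_def\<close>)

lemma ennreal_half_add: "(a + a) / 2 = (a :: ennreal)"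
  by (simp flip: mult_2 add: ennreal_mult_divide_eq mult.commute)

lemma uminus_image_eq_vimage: "uminus ` E = uminus -` (E :: complex set)"
proof (intro equalityI subsetI)
  fix x assume "x \<in> uminus -` E"
  then show "x \<in> uminus ` E" by (intro image_eqI[of _ _ "- x"]) auto
qed auto

text \<open>For symmetric E the preimages under both sections equal the image under
  \<open>\<phi>1\<close>, and the two halves add up. A set disjoint from its negative has the same
  image as the union of the two, but only half the measure of that union.\<close>

lemma emeasure_zero_measure_symmetric:
  assumes E: "E \<in> sets borel" and sym: "uminus ` E = E"
  shows "emeasure zero_measure E = emeasure \<mu>\<Gamma> (\<phi>1 ` E)"
proof -
  have neg: "- z \<in> E \<longleftrightarrow> z \<in> E" for z
  proof -
    have "- z \<in> E \<longleftrightarrow> z \<in> uminus ` E" by (simp add: uminus_image_eq_vimage)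
    then show ?thesis by (simp only: sym)
  qed
  have "sqr_root -` E = \<phi>1 ` E"
  proof (intro equalityI subsetI)
    fix w assume "w \<in> sqr_root -` E"
    then show "w \<in> \<phi>1 ` E" by (intro image_eqI[of _ _ "sqr_root w"]) simp_all
  next
    fix w assume "w \<in> \<phi>1 ` E"
    then obtain z where "z \<in> E" "w = \<phi>1 z" by blast
    from sqr_root_phi1[of z] have "sqr_root w \<in> E"
    proof
      assume "sqr_root (\<phi>1 z) = z"
      then show ?thesis using \<open>z \<in> E\<close> \<open>w = \<phi>1 z\<close> by (simp only:)
    next
      assume "sqr_root (\<phi>1 z) = - z"
      then show ?thesis using \<open>z \<in> E\<close> \<open>w = \<phi>1 z\<close> by (simp only: neg)
    qed
    then show "w \<in> sqr_root -` E" by simp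
  qed
  moreover have "(\<lambda>w. - sqr_root w) -` E = sqr_root -` E" by (simp only: vimage_def neg)
  ultimately show ?thesis by (simp add: emeasure_zero_measure[OF E] ennreal_half_add)
qed

lemma uminus_image_borel:
  assumes E: "E \<in> sets (borel :: complex measure)"
  shows "uminus ` E \<in> sets borel"
  unfolding uminus_image_eq_vimage by (rule borel_vimage[OF _ E]) measurable

lemma emeasure_zero_measure_uminus:
  assumes E: "E \<in> sets borel"
  shows "emeasure zero_measure (uminus ` E) = emeasure zero_measure E"
proof -
  have "sqr_root -` (uminus ` E) = (\<lambda>w. - sqr_root w) -` E" "(\<lambda>w. - sqr_root w) -` (uminus ` E) = sqr_root -` E"
    by (auto simp: uminus_image_eq_vimage)
  then show ?thesis
    by (simp add: emeasure_zero_measure[OF E] emeasure_zero_measure[OF uminus_image_borel[OF E]] add.commute)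
qed

lemma emeasure_zero_measure_support: "emeasure zero_measure (- (\<phi>1 -` \<Gamma>)) = 0"
proof -
  have "- (\<phi>1 -` \<Gamma>) \<in> sets borel"
    using borel_vimage[OF borel_measurable_phi1 Gamma_borel] by auto
  moreover have "sqr_root -` (- (\<phi>1 -` \<Gamma>)) = - \<Gamma>" "(\<lambda>w. - sqr_root w) -` (- (\<phi>1 -` \<Gamma>)) = - \<Gamma>"
    by auto
  ultimately show ?thesis by (simp add: emeasure_zero_measure emeasure_mu_Gamma_compl)
qed

lemma distr_zero_measure_phi1: "distr zero_measure borel \<phi>1 = \<mu>\<Gamma>"
proof (rule measure_eqI)
  fix B assume "B \<in> sets (distr zero_measure borel \<phi>1)"
  then have B: "B \<in> sets borel" by simp
  have "emeasure (distr zero_measure borel \<phi>1) B = emeasure zero_measure (\<phi>1 -` B)"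
    using B by (subst emeasure_distr) auto
  also have "\<dots> = (emeasure \<mu>\<Gamma> B + emeasure \<mu>\<Gamma> B) / 2"
    by (subst emeasure_zero_measure[OF borel_vimage[OF borel_measurable_phi1 B]]) (simp add: vimage_def)
  finally show "emeasure (distr zero_measure borel \<phi>1) B = emeasure \<mu>\<Gamma> B"
    by (simp add: ennreal_half_add)
qed simp

lemma distr_zero_measure_uminus: "distr zero_measure borel uminus = zero_measure"
proof (rule measure_eqI)
  fix B assume "B \<in> sets (distr zero_measure borel uminus)"
  then have B: "B \<in> sets borel" by simp
  have "emeasure (distr zero_measure borel uminus) B = emeasure zero_measure (uminus ` B)"
    using B by (subst emeasure_distr) (auto simp: uminus_image_eq_vimage)
  then show "emeasure (distr zero_measure borel uminus) B = emeasure zero_measure B"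
    using B by (simp only: emeasure_zero_measure_uminus)
qed simp

text \<open>Invariance under negation allows f to be replaced by its even part, which factors
  through \<open>\<phi>1\<close>; the integral is then pushed forward. The bound B gives
  integrability.\<close>

lemma integral_zero_measure:
  fixes f :: "complex \<Rightarrow> real"
  assumes f: "continuous_on UNIV f" and B: "\<And>z. \<bar>f z\<bar> \<le> B"
  shows "integral\<^sup>L zero_measure f = integral\<^sup>L \<mu>\<Gamma> (\<lambda>w. (f (sqr_root w) + f (- sqr_root w)) / 2)"
proof -
  have "emeasure zero_measure UNIV = 1"
    using prob_space.emeasure_space_1[OF prob_space_mu_Gamma] by (simp add: emeasure_zero_measure ennreal_half_add)
  then interpret prob_space zero_measure by (intro prob_spaceI) simp
  have fm [measurable]: "f \<in> borel_measurable borel" using f by (rule borel_measurable_continuous_onI)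
  have int: "integrable zero_measure f" "integrable zero_measure (\<lambda>z. f (- z))"
    using B by (auto intro!: integrable_const_bound[where B = B])
  have g: "(\<lambda>w. (f (sqr_root w) + f (- sqr_root w)) / 2) \<in> borel_measurable borel"
    by measurable
  have "integral\<^sup>L zero_measure f = integral\<^sup>L (distr zero_measure borel uminus) f"
    by (simp only: distr_zero_measure_uminus)
  also have "\<dots> = integral\<^sup>L zero_measure (\<lambda>z. f (- z))"
    by (rule integral_distr) auto
  finally have "integral\<^sup>L zero_measure f = integral\<^sup>L zero_measure (\<lambda>z. (f z + f (- z)) / 2)"
    using int by simp
  also have "\<dots> = integral\<^sup>L zero_measure (\<lambda>z. (f (sqr_root (\<phi>1 z)) + f (- sqr_root (\<phi>1 z))) / 2)"
  proof (rule Bochner_Integration.integral_cong[OF refl])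
    fix z show "(f z + f (- z)) / 2 = (f (sqr_root (\<phi>1 z)) + f (- sqr_root (\<phi>1 z))) / 2"
      using sqr_root_phi1[of z] by auto
  qed
  also have "\<dots> = integral\<^sup>L (distr zero_measure borel \<phi>1) (\<lambda>w. (f (sqr_root w) + f (- sqr_root w)) / 2)"
    by (rule integral_distr[symmetric]) (use g in auto)
  finally show ?thesis by (simp only: distr_zero_measure_phi1)
qed

subsection \<open>The nonzero zeros of the integrated polynomials\<close>

lemma proots_prod_mset_sqr_root:
  "proots (\<Prod>x\<in>#A. [:- sqr_root x, 1:] * [:sqr_root x, 1:]) = (\<Sum>x\<in>#A. {#sqr_root x, - sqr_root x#})"
proof (induction A)
  case (add x A)
  have "(\<Prod>x\<in>#A. [:- sqr_root x, 1:] * [:sqr_root x, 1:]) \<noteq> 0"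
    by (auto simp: prod_mset_zero_iff simp del: mult_pCons_left mult_pCons_right)
  moreover have "[:- sqr_root x, 1:] * [:sqr_root x, 1:] \<noteq> 0" by (simp del: mult_pCons_left mult_pCons_right)
  ultimately show ?case
    unfolding image_mset_add_mset prod_mset.add_mset sum_mset.add_mset
    by (subst proots_mult) (simp_all add: add proots_mult del: mult_pCons_left mult_pCons_right)
qed simp

text \<open>Each factor -z^2 - x splits as -(z - s) (z + s) with s = \<open>sqr_root x\<close>, so
  multiplicities are inherited; the remaining zeros come from the power of z.\<close>

lemma nonzero_proots_I_int:
  "{#z \<in># proots (I_int N (ultraspherical \<alpha> N)). z \<noteq> 0#} =
     (\<Sum>x\<in>#proots (tail_poly \<alpha> N). {#sqr_root x, - sqr_root x#})"
proof -
  let ?Z = "proots (tail_poly \<alpha> N)" and ?a = "(N + 1) div 2"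
  \<comment> \<open>Besides the leading coefficient, this collects the signs of the reduction to the
    tail, of (-z^2)^((N + 1) div 2), and of one factor -1 for each zero.\<close>
  define c where "c = (-1) ^ N * (-1) ^ ?a * lead_coeff (tail_poly \<alpha> N) * (-1) ^ size ?Z"
  define P where "P = (\<Prod>x\<in>#?Z. [:- sqr_root x, 1:] * [:sqr_root x, 1:])"
  have c: "c \<noteq> 0" by (simp add: c_def)
  have prod: "poly (\<Prod>x\<in>#A. [:-x, 1:]) (\<phi>1 z) = (-1) ^ size A * poly (\<Prod>x\<in>#A. [:- sqr_root x, 1:] * [:sqr_root x, 1:]) z" for A z
  proof (induction A)
    case (add x A)
    have "(sqr_root x)\<^sup>2 = - x" by (simp add: sqr_root_def)
    then have *: "\<phi>1 z - x = - ((z - sqr_root x) * (z + sqr_root x))"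
      by (simp add: \<phi>1_def power2_eq_square algebra_simps)
    have "poly (\<Prod>x\<in>#add_mset x A. [:-x, 1:]) (\<phi>1 z) = (\<phi>1 z - x) * poly (\<Prod>x\<in>#A. [:-x, 1:]) (\<phi>1 z)"
      unfolding image_mset_add_mset prod_mset.add_mset poly_mult by simp
    also have "\<dots> = (-1) ^ size (add_mset x A) * (((z - sqr_root x) * (z + sqr_root x)) *
        poly (\<Prod>x\<in>#A. [:- sqr_root x, 1:] * [:sqr_root x, 1:]) z)"
      unfolding add * by simp
    also have "((z - sqr_root x) * (z + sqr_root x)) * poly (\<Prod>x\<in>#A. [:- sqr_root x, 1:] * [:sqr_root x, 1:]) z
      = poly (\<Prod>x\<in>#add_mset x A. [:- sqr_root x, 1:] * [:sqr_root x, 1:]) z"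
    proof -
      have "poly ([:- sqr_root x, 1:] * [:sqr_root x, 1:]) z = (z - sqr_root x) * (z + sqr_root x)"
        unfolding poly_mult by (simp add: add.commute)
      then show ?thesis unfolding image_mset_add_mset prod_mset.add_mset poly_mult[of "_ * _"] by (simp only:)
    qed
    finally show ?case .
  qed simp
  have "I_int N (ultraspherical \<alpha> N) = smult c ([:0, 1:] ^ (2 * ?a) * P)"
  proof (rule poly_ext)
    fix z
    have "poly (tail_poly \<alpha> N) (\<phi>1 z) = lead_coeff (tail_poly \<alpha> N) * poly (\<Prod>x\<in>#?Z. [:-x, 1:]) (\<phi>1 z)"
      by (subst complex_poly_decompose_multiset[symmetric]) (rule poly_smult)
    also have "\<dots> = lead_coeff (tail_poly \<alpha> N) * ((-1) ^ size ?Z * poly P z)"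
      unfolding prod P_def ..
    finally have tail: "poly (tail_poly \<alpha> N) (\<phi>1 z) = lead_coeff (tail_poly \<alpha> N) * ((-1) ^ size ?Z * poly P z)" .
    have "\<phi>1 z ^ ?a = (-1) ^ ?a * z ^ (2 * ?a)"
      unfolding \<phi>1_def by (simp only: power_minus[of "z\<^sup>2"] power_mult)
    then show "poly (I_int N (ultraspherical \<alpha> N)) z = poly (smult c ([:0, 1:] ^ (2 * ?a) * P)) z"
      unfolding poly_I_int_ultraspherical tail by (simp add: c_def mult_ac)
  qed
  moreover have pP: "proots P = (\<Sum>x\<in>#?Z. {#sqr_root x, - sqr_root x#})"
    unfolding P_def by (rule proots_prod_mset_sqr_root)
  moreover have "P \<noteq> 0"
    by (auto simp: P_def prod_mset_zero_iff simp del: mult_pCons_left mult_pCons_right)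
  ultimately have "proots (I_int N (ultraspherical \<alpha> N)) = repeat_mset (2 * ?a) {#0#} + (\<Sum>x\<in>#?Z. {#sqr_root x, - sqr_root x#})"
    using c proots_linear_factor[of "0::complex"] pP
    by (simp add: proots_mult proots_power)
  moreover have "{#z \<in># repeat_mset n {#0#}. z \<noteq> 0#} = ({#} :: complex multiset)" for n
    by (induction n) auto
  moreover have "{#z \<in># (\<Sum>x\<in>#A. {#sqr_root x, - sqr_root x#}). z \<noteq> 0#} = (\<Sum>x\<in>#A. {#sqr_root x, - sqr_root x#})"
    if "0 \<notin># A" for A
    using that by (induction A) auto
  ultimately show ?thesis using zero_notin_proots_tail_poly[of \<alpha> N] by (simp only: filter_union_mset) simp
qed

lemma sum_set_mset_count:
  fixes f :: "'a \<Rightarrow> real"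
  assumes "finite S" "set_mset A \<subseteq> S"
  shows "(\<Sum>x\<in>S. f x * real (count A x)) = (\<Sum>x\<in>#A. f x)"
  using assms(2)
proof (induction A)
  case (add y A)
  have "(\<Sum>x\<in>S. f x * real (count (add_mset y A) x)) = (\<Sum>x\<in>S. f x * real (count A x) + (if x = y then f y else 0))"
    by (intro sum.cong) (auto simp: algebra_simps)
  also have "\<dots> = (\<Sum>x\<in>#A. f x) + f y"
    using add assms(1) by (simp add: sum.distrib)
  finally show ?case by (simp add: add.commute)
qed simp

text \<open>N >= 2 makes N div 2 positive; otherwise there is no nonzero zero and the measure is
  unspecified. Each x contributes two of the 2 (N div 2) points, whence the halves.\<close>

lemma integral_nonzero_zeros_measure:
  fixes f :: "complex \<Rightarrow> real"
  assumes N: "2 \<le> N" and f: "f \<in> borel_measurable borel"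
  shows "integral\<^sup>L (nonzero_zeros_measure (I_int N (ultraspherical \<alpha> N))) f =
    (\<Sum>x\<in>#proots (tail_poly \<alpha> N). (f (sqr_root x) + f (- sqr_root x)) / 2) / real (N div 2)"
proof -
  define A where "A = (\<Sum>x\<in>#proots (tail_poly \<alpha> N). {#sqr_root x, - sqr_root x#})"
  have "size (\<Sum>x\<in>#B. {#sqr_root x, - sqr_root x#}) = 2 * size B" for B
    by (induction B) auto
  then have size: "size A = 2 * (N div 2)"
    by (simp add: A_def size_proots_complex degree_tail_poly)
  then have ne: "A \<noteq> {#}" using N by auto
  have "integral\<^sup>L (nonzero_zeros_measure (I_int N (ultraspherical \<alpha> N))) f = integral\<^sup>L (measure_pmf (pmf_of_multiset A)) f"
    unfolding nonzero_zeros_measure_def nonzero_proots_I_int A_def[symmetric] using f by (subst integral_distr) auto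
  also have "\<dots> = (\<Sum>x\<in>set_mset A. f x * pmf (pmf_of_multiset A) x)"
    by (rule integral_measure_pmf_real) (use ne in auto)
  also have "\<dots> = (\<Sum>x\<in>set_mset A. f x * real (count A x)) / real (size A)"
    using ne by (simp add: sum_divide_distrib)
  also have "\<dots> = (\<Sum>x\<in>#A. f x) / real (size A)"
    by (simp add: sum_set_mset_count)
  also have "(\<Sum>x\<in>#A. f x) = (\<Sum>x\<in>#proots (tail_poly \<alpha> N). f (sqr_root x) + f (- sqr_root x))"
  proof -
    have "(\<Sum>x\<in># (\<Sum>x\<in>#B. {#sqr_root x, - sqr_root x#}). f x) = (\<Sum>x\<in>#B. f (sqr_root x) + f (- sqr_root x))" for B
      by (induction B) (auto simp: add_ac)
    then show ?thesis by (simp only: A_def)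
  qed
  also have "\<dots> = 2 * (\<Sum>x\<in>#proots (tail_poly \<alpha> N). (f (sqr_root x) + f (- sqr_root x)) / 2)"
    by (simp only: sum_mset_distrib_left mult_2 field_sum_of_halves)
  finally show ?thesis by (simp add: size)
qed

lemma nonzero_zeros_weak_star_tendsto:
  "weak_star_tendsto (\<lambda>n. nonzero_zeros_measure (I_int n (ultraspherical \<alpha> n))) zero_measure"
  unfolding weak_star_tendsto_def
proof (intro allI impI, elim conjE)
  fix f :: "complex \<Rightarrow> real"
  assume f: "continuous_on UNIV f" and supp: "compact (closure {z. f z \<noteq> 0})"
  let ?g = "\<lambda>w. (f (sqr_root w) + f (- sqr_root w)) / 2"
  \<comment> \<open>Compact support enters here: it bounds f, as
    \<open>integral_zero_measure\<close> requires.\<close>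
  have "compact (f ` closure {z. f z \<noteq> 0})"
    by (intro compact_continuous_image continuous_on_subset[OF f] supp) auto
  then have "bounded (f ` closure {z. f z \<noteq> 0})" by (rule compact_imp_bounded)
  then obtain B where B: "\<forall>y\<in>f ` closure {z. f z \<noteq> 0}. norm y \<le> B"
    unfolding bounded_iff by blast
  have bnd: "\<bar>f z\<bar> \<le> max B 0" for z
  proof (cases "f z = 0")
    case False
    then have "z \<in> closure {z. f z \<noteq> 0}" using closure_subset[of "{z. f z \<noteq> 0}"] by auto
    then have "norm (f z) \<le> B" using B by blast
    then show ?thesis by simp
  qed simp
  have "(\<lambda>n. (\<Sum>x\<in>#proots (tail_poly \<alpha> n). ?g x) / real (n div 2)) \<longlonglongrightarrow> integral\<^sup>L \<mu>\<Gamma> ?g"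
    by (rule tail_poly_zeros_weak_limit[OF continuous_symmetrisation[OF f]])
  then have "(\<lambda>n. (\<Sum>x\<in>#proots (tail_poly \<alpha> n). ?g x) / real (n div 2)) \<longlonglongrightarrow> integral\<^sup>L zero_measure f"
    by (simp only: integral_zero_measure[OF f bnd])
  moreover have "\<forall>\<^sub>F n in sequentially. (\<Sum>x\<in>#proots (tail_poly \<alpha> n). ?g x) / real (n div 2)
     = integral\<^sup>L (nonzero_zeros_measure (I_int n (ultraspherical \<alpha> n))) f"
    using eventually_ge_at_top[of 2]
    by eventually_elim (simp add: integral_nonzero_zeros_measure borel_measurable_continuous_onI[OF f])
  ultimately show "(\<lambda>n. integral\<^sup>L (nonzero_zeros_measure (I_int n (ultraspherical \<alpha> n))) f) \<longlonglongrightarrow> integral\<^sup>L zero_measure f"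
    by (rule Lim_transform_eventually)
qed

theorem theorem2:
  fixes \<alpha> :: nat
  shows
   "(\<forall>z\<in>F1. (\<lambda>n. poly (I_int (2*n) (ultraspherical \<alpha> (2*n))) z)
        \<sim>[sequentially] (\<lambda>n. (z^2 - 1) powi (int (2*n) - int \<alpha>) * z ^ (2*\<alpha>))) \<and>
    (\<forall>z\<in>F2. (\<lambda>n. poly (I_int (2*n) (ultraspherical \<alpha> (2*n))) z)
        \<sim>[sequentially] (\<lambda>n. (-1)^n * 2 powi (int (2*n) - int \<alpha>) * z ^ (2*n)
            / (complex_of_real (sqrt (pi * real n)) * (1 + z^2)))) \<and>
    (\<forall>z\<in>F1. (\<lambda>n. poly (I_int (2*n+1) (ultraspherical \<alpha> (2*n+1))) z)
        \<sim>[sequentially] (\<lambda>n. (z^2 - 1) powi (int (2*n+1) - int \<alpha>) * z ^ (2*\<alpha>))) \<and>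
    (\<forall>z\<in>F2. (\<lambda>n. poly (I_int (2*n+1) (ultraspherical \<alpha> (2*n+1))) z)
        \<sim>[sequentially] (\<lambda>n. (-1)^n * 2 powi (int (2*n+1) - int \<alpha>) * z ^ (2*n+2)
            / (complex_of_real (sqrt (pi * real n)) * (1 + z^2)))) \<and>
    (\<exists>\<beta> :: complex measure. sets \<beta> = sets borel \<and>
        weak_star_tendsto (\<lambda>n. nonzero_zeros_measure (I_int n (ultraspherical \<alpha> n))) \<beta> \<and>
        emeasure \<beta> (- (\<phi>1 -` \<Gamma>)) = 0 \<and>
        (\<forall>E\<in>sets borel. emeasure \<beta> (uminus ` E) = emeasure \<beta> E) \<and>
        (\<forall>E\<in>sets borel. uminus ` E = E \<longrightarrow> emeasure \<beta> E = emeasure \<mu>\<Gamma> (\<phi>1 ` E)))"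
proof (intro conjI ballI)
  fix z assume z: "z \<in> F1"
  show "(\<lambda>n. poly (I_int (2*n) (ultraspherical \<alpha> (2*n))) z)
        \<sim>[sequentially] (\<lambda>n. (z^2 - 1) powi (int (2*n) - int \<alpha>) * z ^ (2*\<alpha>))"
    using I_int_outer[OF z] filterlim_double by (rule asymp_equiv_compose')
  show "(\<lambda>n. poly (I_int (2*n+1) (ultraspherical \<alpha> (2*n+1))) z)
        \<sim>[sequentially] (\<lambda>n. (z^2 - 1) powi (int (2*n+1) - int \<alpha>) * z ^ (2*\<alpha>))"
    using I_int_outer[OF z] filterlim_double_Suc by (rule asymp_equiv_compose')
next
  show "\<exists>\<beta> :: complex measure. sets \<beta> = sets borel \<and>
        weak_star_tendsto (\<lambda>n. nonzero_zeros_measure (I_int n (ultraspherical \<alpha> n))) \<beta> \<and>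
        emeasure \<beta> (- (\<phi>1 -` \<Gamma>)) = 0 \<and>
        (\<forall>E\<in>sets borel. emeasure \<beta> (uminus ` E) = emeasure \<beta> E) \<and>
        (\<forall>E\<in>sets borel. uminus ` E = E \<longrightarrow> emeasure \<beta> E = emeasure \<mu>\<Gamma> (\<phi>1 ` E))"
    using nonzero_zeros_weak_star_tendsto emeasure_zero_measure_support
      emeasure_zero_measure_uminus emeasure_zero_measure_symmetric
    by (intro exI[of _ zero_measure] conjI ballI impI) simp_all
qed (rule I_int_even_inner I_int_odd_inner, assumption)+

end
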